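(* Let $\alpha\in(0,1)$ and let $r\geq3$ be fixed. Assume that, for each $k\in\{1,2,\dots\}$, the crossed random effects model $Y\sim\mathrm{N}(1_n\beta,\Sigma(\psi))$, $\Sigma(\psi)=\sum_{j=1}^{r-1}\psi_jn_{(j)}\mathcal{P}_j+\psi_rI_n$, holds with an $n_{\min}=n_{\min}^k$ such that $n_{\min}^k\to\infty$ as $k\to\infty$. Then, as $k\to\infty$, \[ \sup_{\psi\in[0,\infty)^{r-1}\times(0,\infty)}\left\vert\mathrm{P}_\psi\{\psi\in\tilde{\mathbb{C}}_n^S(\alpha)\}-(1-\alpha)\right\vert\to0 . \]
   Context: Model (the $n_j$, hence $n$, and $\beta$ may depend on $k$; the index is suppressed): $n_1,\dots,n_{r-1}$ are positive integers, $n=\prod_{i=1}^{r-1}n_i$, $n_{(j)}=\prod_{i\ne j}n_i$, $n_{\min}=\min_{1\leq j\leq r-1}n_j$. $1_d\in\mathbb{R}^d$ is the vector of ones, $P_j=1_{n_j}1_{n_j}^{\mathsf T}/n_j$, and $\mathcal{P}_j=P_1\otimes\cdots\otimes P_{j-1}\otimes I_{n_j}\otimes P_{j+1}\otimes\cdots\otimes P_{r-1}$, $j\in\{1,\dots,r-1\}$; $\beta\in\mathbb{R}$. The parameter set for $\psi$ is $\mathbb{P}=[0,\infty)^{r-1}\times(0,\infty)$. $\mathrm{P}_\psi$ is probability when $\psi$ is the true covariance parameter (the distribution of the restricted score below does not depend on $\beta$). Restricted score confidence region: let $V\in\mathbb{R}^{n\times(n-1)}$ be semi-orthogonal ($V^{\mathsf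 T}V=I_{n-1}$) with $V^{\mathsf T}1_n=0$; $\tilde Y=V^{\mathsf T}Y$, $\tilde\Sigma(\psi)=V^{\mathsf T}\Sigma(\psi)V$, $\tilde R=\tilde\Sigma^{-1/2}\tilde Y$, $\tilde A_j=\tilde\Sigma^{-1/2}\{\partial\tilde\Sigma/\partial\psi_j\}\tilde\Sigma^{-1/2}$, i.e. $\tilde A_j=\tilde\Sigma^{-1/2}V^{\mathsf T}n_{(j)}\mathcal{P}_jV\tilde\Sigma^{-1/2}$ for $j<r$ and $\tilde A_r=\tilde\Sigma^{-1}$. $\tilde S(\psi)\in\mathbb{R}^r$ has elements $\frac12\{\tilde R^{\mathsf T}\tilde A_j\tilde R-\mathrm{tr}(\tilde A_j)\}$, $\tilde{\mathcal{I}}(\psi)=[\mathrm{tr}(\tilde A_i\tilde A_j)/2]_{i,j=1}^r$, $\tilde W^S(\psi)=\tilde{\mathcal{I}}(\psi)^{-1/2}\tilde S(\psi)$ (when $\tilde{\mathcal I}(\psi)$ is invertible), $\tilde T_n^S(\psi)=\|\tilde W^S(\psi)\|^2$ with $\|\cdot\|$ the Euclidean norm. Then $\tilde{\mathbb{C}}_n^S(\alpha)=\{\psi\in\mathbb{P}:\tilde T_n^S(\psi)\leq c_{r,1-\alpha}\}$, where $c_{r,1-\alpha}$ is the $(1-\alpha)$th quantile of the $\chi^2_r$ distribution. *)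

theory Defs
  imports "HOL-Probability.Probability" "Jordan_Normal_Form.Determinant"
    "Jordan_Normal_Form.Gauss_Jordan_Elimination"
begin

unbundle no vec_syntax
unbundle no inner_syntax

section \<open>Matrices\<close>

definition kron :: "real mat \<Rightarrow> real mat \<Rightarrow> real mat" where
  "kron A B = mat (dim_row A * dim_row B) (dim_col A * dim_col B)
     (\<lambda>(i, j). A $$ (i div dim_row B, j div dim_col B) * B $$ (i mod dim_row B, j mod dim_col B))"

definition mat_trace :: "real mat \<Rightarrow> real" where
  "mat_trace A = (\<Sum>i<dim_row A. A $$ (i, i))"

definition mat_inv :: "real mat \<Rightarrow> real mat" where
  "mat_inv A = the (mat_inverse A)"

definition sym_psd :: "nat \<Rightarrow> real mat \<Rightarrow> bool" where
  "sym_psd d A \<longleftrightarrow> A \<in> carrier_mat d d \<and> transpose_mat A = A \<and>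
     (\<forall>v\<in>carrier_vec d. 0 \<le> v \<bullet> (A *\<^sub>v v))"

definition psd_sqrt :: "real mat \<Rightarrow> real mat" where
  "psd_sqrt A = (THE B. sym_psd (dim_row A) B \<and> B * B = A)"

text \<open>The power $-1/2$; meaningful for symmetric positive definite \<open>A\<close>, unspecified for singular \<open>A\<close>.\<close>

definition psd_inv_sqrt :: "real mat \<Rightarrow> real mat" where
  "psd_inv_sqrt A = mat_inv (psd_sqrt A)"

definition ones :: "nat \<Rightarrow> real vec" where
  "ones d = vec d (\<lambda>_. 1)"

section \<open>Distributions\<close>

definition mvn_density :: "real vec \<Rightarrow> real mat \<Rightarrow> real vec \<Rightarrow> real" where
  "mvn_density \<mu> \<Sigma> x =
     exp (- ((x - \<mu>) \<bullet> (mat_inv \<Sigma> *\<^sub>v (x - \<mu>))) / 2) / sqrt ((2 * pi) ^ dim_vec \<mu> * det \<Sigma>)"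

text \<open>The nondegenerate normal distribution (\<open>\<Sigma>\<close> positive definite). As \<^typ>\<open>real vec\<close> carries no
  measurable structure, the law is that of the coordinates, indexed by \<open>{..<n}\<close>.\<close>

definition mvn_distributed :: "'a measure \<Rightarrow> ('a \<Rightarrow> real vec) \<Rightarrow> real vec \<Rightarrow> real mat \<Rightarrow> bool" where
  "mvn_distributed M X \<mu> \<Sigma> \<longleftrightarrow>
     (\<forall>\<omega>\<in>space M. X \<omega> \<in> carrier_vec (dim_vec \<mu>)) \<and>
     distributed M (\<Pi>\<^sub>M i\<in>{..<dim_vec \<mu>}. lborel) (\<lambda>\<omega>. \<lambda>i\<in>{..<dim_vec \<mu>}. X \<omega> $ i)
       (\<lambda>x. ennreal (mvn_density \<mu> \<Sigma> (vec (dim_vec \<mu>) x)))"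

definition chi_square :: "nat \<Rightarrow> real measure" where
  "chi_square d =
     distr (\<Pi>\<^sub>M i\<in>{..<d}. density lborel (\<lambda>x. ennreal (std_normal_density x))) borel
       (\<lambda>z. \<Sum>i<d. (z i)\<^sup>2)"

definition quantile :: "real measure \<Rightarrow> real \<Rightarrow> real" where
  "quantile M p = Inf {x. p \<le> cdf M x}"

section \<open>Crossed random effects model\<close>

text \<open>The list \<open>ns\<close> holds $n_1, \dots, n_{r-1}$, so that $r$ is \<open>length ns + 1\<close> and $n$ is \<open>prod_list ns\<close>.
  Indices start from 0: \<open>\<psi> $ j\<close> for \<open>j < length ns\<close> belongs to the factor with \<open>ns ! j\<close> levels,
  and \<open>\<psi> $ length ns\<close> is the error variance $\psi_r$.\<close>

definition param_set :: "nat \<Rightarrow> real vec set" where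
  "param_set r = {\<psi> \<in> carrier_vec r. (\<forall>j<r - 1. 0 \<le> \<psi> $ j) \<and> 0 < \<psi> $ (r - 1)}"

definition n_except :: "nat list \<Rightarrow> nat \<Rightarrow> nat" where
  "n_except ns j = (\<Prod>i\<in>{..<length ns} - {j}. ns ! i)"

definition avg_mat :: "nat \<Rightarrow> real mat" where
  "avg_mat d = mat d d (\<lambda>_. 1 / real d)"

definition factor_proj :: "nat list \<Rightarrow> nat \<Rightarrow> real mat" where
  "factor_proj ns j =
     foldr kron (map (\<lambda>i. if i = j then 1\<^sub>m (ns ! i) else avg_mat (ns ! i)) [0..<length ns]) (1\<^sub>m 1)"

definition model_cov :: "nat list \<Rightarrow> real vec \<Rightarrow> real mat" where
  "model_cov ns \<psi> = mat (prod_list ns) (prod_list ns) (\<lambda>(a, b).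
     (\<Sum>j<length ns. \<psi> $ j * real (n_except ns j) * factor_proj ns j $$ (a, b))
       + \<psi> $ length ns * 1\<^sub>m (prod_list ns) $$ (a, b))"

definition crossed_model :: "nat list \<Rightarrow> real \<Rightarrow> real vec \<Rightarrow> 'a measure \<Rightarrow> ('a \<Rightarrow> real vec) \<Rightarrow> bool" where
  "crossed_model ns \<beta> \<psi> M Y \<longleftrightarrow>
     prob_space M \<and> mvn_distributed M Y (\<beta> \<cdot>\<^sub>v ones (prod_list ns)) (model_cov ns \<psi>)"

section \<open>Restricted score confidence region\<close>

definition contrast_basis :: "nat \<Rightarrow> real mat \<Rightarrow> bool" where
  "contrast_basis n V \<longleftrightarrow> V \<in> carrier_mat n (n - 1) \<and>
     transpose_mat V * V = 1\<^sub>m (n - 1) \<and> transpose_mat V *\<^sub>v ones n = 0\<^sub>v (n - 1)"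

definition restr_cov :: "nat list \<Rightarrow> real mat \<Rightarrow> real vec \<Rightarrow> real mat" where
  "restr_cov ns V \<psi> = transpose_mat V * model_cov ns \<psi> * V"

text \<open>Entrywise partial derivative of \<open>restr_cov\<close> with respect to \<open>\<psi> $ j\<close>. The formula for \<open>restr_cov\<close>
  is affine in \<open>\<psi>\<close>, so the derivative at \<open>\<psi> $ j = 0\<close> is the two-sided one.\<close>

definition restr_cov_deriv :: "nat list \<Rightarrow> real mat \<Rightarrow> real vec \<Rightarrow> nat \<Rightarrow> real mat" where
  "restr_cov_deriv ns V \<psi> j = mat (dim_col V) (dim_col V) (\<lambda>(a, b).
     deriv (\<lambda>t. restr_cov ns V (update_vec \<psi> j t) $$ (a, b)) (\<psi> $ j))"

lemma restr_cov_deriv_eq: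
  fixes ns :: "nat list"
  assumes V: "V \<in> carrier_mat (prod_list ns) m" and \<psi>: "\<psi> \<in> carrier_vec (length ns + 1)"
    and j: "j < length ns + 1"
  defines "n \<equiv> prod_list ns"
  shows "restr_cov_deriv ns V \<psi> j = transpose_mat V *
    mat n n (\<lambda>ab. if j < length ns then real (n_except ns j) * factor_proj ns j $$ ab
                  else 1\<^sub>m n $$ ab) * V"
    (is "_ = transpose_mat V * ?D * V")
proof (rule eq_matI)
  have Vd: "dim_row V = n" "dim_col V = m" using V by (auto simp: n_def)
  show "dim_row (restr_cov_deriv ns V \<psi> j) = dim_row (transpose_mat V * ?D * V)"
    "dim_col (restr_cov_deriv ns V \<psi> j) = dim_col (transpose_mat V * ?D * V)"
    by (auto simp: restr_cov_deriv_def)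
  fix a b
  assume "a < dim_row (transpose_mat V * ?D * V)" "b < dim_col (transpose_mat V * ?D * V)"
  then have ab: "a < m" "b < m" using Vd by auto
  have entry: "(transpose_mat V * M * V) $$ (a, b) = (\<Sum>d<n. (\<Sum>c<n. V $$ (c, a) * M $$ (c, d)) * V $$ (d, b))"
    if "M \<in> carrier_mat n n" for M :: "real mat"
    using that ab Vd by (auto simp: scalar_prod_def lessThan_atLeast0 intro!: sum.cong)
  have cov: "((\<lambda>t. model_cov ns (update_vec \<psi> j t) $$ (c, d)) has_field_derivative ?D $$ (c, d))
      (at (\<psi> $ j))" if "c < n" "d < n" for c d
  proof (cases "j < length ns")
    case True
    have eq: "model_cov ns (update_vec \<psi> j t) $$ (c, d) =
        (\<Sum>i<length ns. (if i = j then t else \<psi> $ i) * (real (n_except ns i) * factor_proj ns i $$ (c, d)))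
          + \<psi> $ length ns * 1\<^sub>m n $$ (c, d)" for t
      using that \<psi> True unfolding model_cov_def n_def[symmetric]
      by (auto simp: update_vec_def mult.assoc intro!: sum.cong)
    have D: "?D $$ (c, d) = (\<Sum>i<length ns. (if i = j then 1 else 0) * (real (n_except ns i) * factor_proj ns i $$ (c, d)))"
      using that True by (simp add: if_distrib[of "\<lambda>x. x * _"] cong: if_cong)
    show ?thesis unfolding eq D
      by (rule derivative_eq_intros DERIV_sum | (auto intro!: derivative_eq_intros))+
  next
    case False
    then have "j = length ns" using j by auto
    then have eq: "model_cov ns (update_vec \<psi> j t) $$ (c, d) =
        (\<Sum>i<length ns. \<psi> $ i * real (n_except ns i) * factor_proj ns i $$ (c, d))
          + t * 1\<^sub>m n $$ (c, d)" for t
      using that \<psi> unfolding model_cov_def n_def[symmetric]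
      by (auto simp: update_vec_def intro!: sum.cong)
    show ?thesis unfolding eq using False that
      by (auto intro!: derivative_eq_intros simp del: index_one_mat)
  qed
  have "((\<lambda>t. restr_cov ns V (update_vec \<psi> j t) $$ (a, b)) has_field_derivative
      (\<Sum>d<n. (\<Sum>c<n. V $$ (c, a) * ?D $$ (c, d)) * V $$ (d, b))) (at (\<psi> $ j))"
  proof -
    have carr: "model_cov ns (update_vec \<psi> j t) \<in> carrier_mat n n" for t
      by (simp add: model_cov_def n_def)
    show ?thesis unfolding restr_cov_def entry[OF carr]
      by (intro DERIV_sum DERIV_cmult_right DERIV_cmult cov) auto
  qed
  then have "deriv (\<lambda>t. restr_cov ns V (update_vec \<psi> j t) $$ (a, b)) (\<psi> $ j) = (transpose_mat V * ?D * V) $$ (a, b)"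
    by (subst entry) (auto intro: DERIV_imp_deriv)
  then show "restr_cov_deriv ns V \<psi> j $$ (a, b) = (transpose_mat V * ?D * V) $$ (a, b)"
    using ab Vd by (simp add: restr_cov_deriv_def)
qed

definition restr_resid :: "nat list \<Rightarrow> real mat \<Rightarrow> real vec \<Rightarrow> real vec \<Rightarrow> real vec" where
  "restr_resid ns V \<psi> y = psd_inv_sqrt (restr_cov ns V \<psi>) *\<^sub>v (transpose_mat V *\<^sub>v y)"

definition restr_A :: "nat list \<Rightarrow> real mat \<Rightarrow> real vec \<Rightarrow> nat \<Rightarrow> real mat" where
  "restr_A ns V \<psi> j =
     psd_inv_sqrt (restr_cov ns V \<psi>) * restr_cov_deriv ns V \<psi> j * psd_inv_sqrt (restr_cov ns V \<psi>)"

definition restr_score :: "nat list \<Rightarrow> real mat \<Rightarrow> real vec \<Rightarrow> real vec \<Rightarrow> real vec" where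
  "restr_score ns V \<psi> y = vec (length ns + 1) (\<lambda>j.
     (restr_resid ns V \<psi> y \<bullet> (restr_A ns V \<psi> j *\<^sub>v restr_resid ns V \<psi> y) - mat_trace (restr_A ns V \<psi> j)) / 2)"

definition restr_info :: "nat list \<Rightarrow> real mat \<Rightarrow> real vec \<Rightarrow> real mat" where
  "restr_info ns V \<psi> = mat (length ns + 1) (length ns + 1)
     (\<lambda>(i, j). mat_trace (restr_A ns V \<psi> i * restr_A ns V \<psi> j) / 2)"

text \<open>The standardized score and the quantities derived from it are meaningful only if \<open>restr_info\<close> is
  invertible, and unspecified otherwise.\<close>

definition restr_std_score :: "nat list \<Rightarrow> real mat \<Rightarrow> real vec \<Rightarrow> real vec \<Rightarrow> real vec" where
  "restr_std_score ns V \<psi> y = psd_inv_sqrt (restr_info ns V \<psi>) *\<^sub>v restr_score ns V \<psi> y"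

definition restr_score_stat :: "nat list \<Rightarrow> real mat \<Rightarrow> real vec \<Rightarrow> real vec \<Rightarrow> real" where
  "restr_score_stat ns V \<psi> y = restr_std_score ns V \<psi> y \<bullet> restr_std_score ns V \<psi> y"

definition restr_conf_region :: "nat list \<Rightarrow> real mat \<Rightarrow> real \<Rightarrow> real vec \<Rightarrow> real vec set" where
  "restr_conf_region ns V \<alpha> y = {\<psi> \<in> param_set (length ns + 1).
     restr_score_stat ns V \<psi> y \<le> quantile (chi_square (length ns + 1)) (1 - \<alpha>)}"

end

theory Submission
  imports Defs "Jordan_Normal_Form.Spectral_Radius"
begin

text \<open>The score statistic is pivotal: its law depends on the numbers of levels only, so that uniformity in
\<open>\<psi>\<close> costs nothing. The matrices \<open>factor_proj ns j\<close> are commuting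
projections whose ranges meet exactly in the constants. After removal of the constants, the contrast
space splits orthogonally into one piece for each factor and one residual piece,
\<open>length ns + 1\<close> in total. On each piece the covariance and each of its partial derivatives
are scalar. In an orthonormal basis adapted to the splitting, the standardized contrasts are independent
standard normal, and each score component is a linear combination of the centred sums of squares of the
pieces. If \<open>w\<close> is the vector of these sums scaled to unit variance and \<open>G\<close> the
coefficient matrix, then the score is \<open>G w\<close> and the information is
\<open>G G\<^sup>T\<close>. The matrix \<open>G\<close> is lower triangular with nonzero diagonal, hence
standardization by the inverse square root of the information turns \<open>G w\<close> into an orthogonal
image of \<open>w\<close>, and the statistic equals the squared norm of \<open>w\<close>
(\<open>restr_score_stat_eq\<close>).

The adapted basis (\<open>ex_eigenbasis\<close>) is a Kronecker product of Householder reflections that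
send the first unit vector to the normalized vector of ones. The pieces then correspond to sets of
indices: those with exactly one nonzero mixed-radix digit, sorted by its position, and those with at
least two. With at least two factors, all of these sets grow with the smallest number of levels
(\<open>card_effect_class_ge\<close>).

By the central limit theorem each entry of \<open>w\<close> is asymptotically standard normal. The
entries are independent, so the characteristic function of the squared norm is a product and converges to
that of the chi-square law with one degree of freedom for each piece
(\<open>sum_sq_char_tendsto\<close>). That law has no atoms, hence by the Levy continuity theorem the
distribution functions converge at its quantile, where the limit is \<open>1 - \<alpha>\<close>.

Normality of the contrasts comes from the density of the model. Instead of a change of variables with a
determinant, the proof uses that the image of Lebesgue measure under an invertible affine map is
translation invariant, hence proportional to Lebesgue measure; the constant is forced by total mass one
(\<open>distr_affine_gaussian\<close>).\<close>

section \<open>Spectral theorem and square roots of positive semidefinite matrices\<close>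

lemma assoc_mult_mat_dim:
  fixes A B C :: "'a::semiring_0 mat"
  assumes "dim_col A = dim_row B" "dim_col B = dim_row C"
  shows "A * B * C = A * (B * C)"
  using assms by (intro assoc_mult_mat) auto

lemma assoc_mult_mat_vec_dim:
  fixes A B :: "'a::semiring_0 mat"
  assumes "dim_col A = dim_row B" "dim_col B = dim_vec v"
  shows "A * B *\<^sub>v v = A *\<^sub>v (B *\<^sub>v v)"
  using assms by (intro assoc_mult_mat_vec) auto

lemma mat_diag_dims [simp]: "dim_row (mat_diag n f) = n" "dim_col (mat_diag n f) = n"
  by (simp_all add: mat_diag_def)

lemma mat_inv_eqI:
  assumes A: "A \<in> carrier_mat n n" and B: "B \<in> carrier_mat n n" and AB: "A * B = 1\<^sub>m n"
  shows "mat_inv A = B"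
proof -
  have BA: "B * A = 1\<^sub>m n" by (rule mat_mult_left_right_inverse[OF A B AB])
  have "A \<in> Units (ring_mat TYPE(real) n b)" for b
    using A B AB BA by (auto simp: Units_def ring_mat_def)
  with mat_inverse(1)[OF A] obtain C where C: "mat_inverse A = Some C" by fastforce
  from mat_inverse(2)[OF A C] have CA: "C * A = 1\<^sub>m n" and Cc: "C \<in> carrier_mat n n" by auto
  have "C = C * (A * B)" using Cc AB by simp
  also have "\<dots> = B" using A B Cc CA by (simp flip: assoc_mult_mat[of _ n n _ n _ n])
  finally show ?thesis by (simp add: mat_inv_def C)
qed

lemma mat_inv_right:
  assumes A: "A \<in> carrier_mat n n" and "det A \<noteq> 0"
  shows "mat_inv A \<in> carrier_mat n n" "A * mat_inv A = 1\<^sub>m n" "mat_inv A * A = 1\<^sub>m n"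
proof -
  have "A \<in> Units (ring_mat TYPE(real) n ())" by (rule det_non_zero_imp_unit[OF assms])
  then obtain B where "B \<in> carrier_mat n n" "A * B = 1\<^sub>m n" "B * A = 1\<^sub>m n"
    by (auto simp: Units_def ring_mat_def)
  with mat_inv_eqI[OF A] show "mat_inv A \<in> carrier_mat n n" "A * mat_inv A = 1\<^sub>m n" "mat_inv A * A = 1\<^sub>m n"
    by auto
qed

lemma symmetric_mat_scalar_prod:
  fixes A :: "real mat"
  assumes "A \<in> carrier_mat n n" "transpose_mat A = A" "x \<in> carrier_vec n" "y \<in> carrier_vec n"
  shows "(A *\<^sub>v x) \<bullet> y = x \<bullet> (A *\<^sub>v y)"
  using transpose_vec_mult_scalar[of A n n y x] assms by simp

lemma scalar_prod_self:
  fixes v :: "real vec"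
  assumes "v \<in> carrier_vec n"
  shows "v \<bullet> v = (\<Sum>i<n. (v $ i)\<^sup>2)" "0 \<le> v \<bullet> v" "v \<bullet> v = 0 \<longleftrightarrow> v = 0\<^sub>v n"
proof -
  show 1: "v \<bullet> v = (\<Sum>i<n. (v $ i)\<^sup>2)"
    using assms by (simp add: scalar_prod_def lessThan_atLeast0 power2_eq_square)
  show "0 \<le> v \<bullet> v" unfolding 1 by (simp add: sum_nonneg)
  show "v \<bullet> v = 0 \<longleftrightarrow> v = 0\<^sub>v n"
    using assms unfolding 1 by (auto simp: sum_nonneg_eq_0_iff intro!: eq_vecI)
qed

text \<open>The reflection that exchanges \<open>u\<close> with the first unit vector. If the two coincide, then the
vector \<open>v\<close> of the reflection is zero and division by \<open>c = 0\<close> gives the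
identity.\<close>

lemma ex_householder:
  fixes u :: "real vec"
  assumes u: "u \<in> carrier_vec n" and n: "0 < n" and norm: "u \<bullet> u = 1"
  shows "\<exists>H\<in>carrier_mat n n. transpose_mat H = H \<and> H * H = 1\<^sub>m n \<and> (\<forall>i<n. H $$ (i, 0) = u $ i)"
proof -
  define v where "v i = (if i = 0 then 1 else 0) - u $ i" for i
  define c where "c = 1 - u $ 0"
  have sq: "(\<Sum>i<n. (u $ i)\<^sup>2) = 1"
    using norm u by (simp add: scalar_prod_def lessThan_atLeast0 power2_eq_square)
  have sq0: "(\<Sum>i<n. (u $ i)\<^sup>2) = (u $ 0)\<^sup>2 + (\<Sum>i\<in>{..<n} - {0}. (u $ i)\<^sup>2)"
    using n by (subst sum.remove[of _ 0]) auto
  have vv: "(\<Sum>i<n. v i * v i) = 2 * c"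
  proof -
    have "(\<Sum>i<n. v i * v i) = (1 - u $ 0)\<^sup>2 + (\<Sum>i\<in>{..<n} - {0}. (u $ i)\<^sup>2)"
      using n by (subst sum.remove[of _ 0]) (auto simp: v_def power2_eq_square)
    also have "\<dots> = 2 * c" using sq sq0 by (simp add: c_def power2_eq_square algebra_simps)
    finally show ?thesis .
  qed
  have v0: "v i = 0" if "c = 0" "i < n" for i
  proof -
    have "(\<Sum>i<n. v i * v i) = 0" using vv that by simp
    then have "v i * v i = 0" using that by (subst (asm) sum_nonneg_eq_0_iff) auto
    then show ?thesis by simp
  qed
  define H where "H = mat n n (\<lambda>(i, j). (if i = j then 1 else 0) - v i * v j / c)"
  have H: "H \<in> carrier_mat n n" by (simp add: H_def)
  have sym: "transpose_mat H = H"
    by (rule eq_matI) (auto simp: H_def)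
  have "(H * H) $$ (i, j) = 1\<^sub>m n $$ (i, j)" if "i < n" "j < n" for i j
  proof -
    have "(H * H) $$ (i, j) = (\<Sum>k<n. ((if i = k then 1 else 0) - v i * v k / c) * ((if k = j then 1 else 0) - v k * v j / c))"
      using that by (simp add: H_def scalar_prod_def lessThan_atLeast0)
    also have "\<dots> = (\<Sum>k<n. (if i = k then (if k = j then 1 else 0) else 0) - (if i = k then v k * v j / c else 0)
        - (if k = j then v i * v k / c else 0) + v i * v j / c\<^sup>2 * (v k * v k))"
      by (intro sum.cong) (auto simp: algebra_simps power2_eq_square)
    also have "\<dots> = (if i = j then 1 else 0) - v i * v j / c - v i * v j / c + v i * v j / c\<^sup>2 * (2 * c)"
      using that by (simp add: sum.distrib sum_subtractf vv sum_distrib_left[symmetric] del: times_divide_eq_left)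
    also have "\<dots> = (if i = j then 1 else 0)" using v0[of i] v0[of j] that
      by (cases "c = 0") (auto simp: power2_eq_square)
    finally show ?thesis using that by simp
  qed
  then have HH: "H * H = 1\<^sub>m n" using H by (intro eq_matI) auto
  have "H $$ (i, 0) = u $ i" if "i < n" for i
    using that n v0[of i] v0[of 0] by (cases "c = 0") (auto simp: H_def v_def c_def divide_simps algebra_simps)
  with H sym HH show ?thesis by blast
qed

text \<open>A complex eigenvector exists. Symmetry forces its eigenvalue to be real, and then its real or its
imaginary part is a real eigenvector.\<close>

lemma symmetric_ex_eigenvector:
  fixes A :: "real mat"
  assumes A: "A \<in> carrier_mat n n" and sym: "transpose_mat A = A" and n: "0 < n"
  shows "\<exists>u\<in>carrier_vec n. \<exists>l. u \<bullet> u = 1 \<and> A *\<^sub>v u = l \<cdot>\<^sub>v u"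
proof -
  define cA where "cA = map_mat complex_of_real A"
  have cA: "cA \<in> carrier_mat n n" using A by (simp add: cA_def)
  from spectrum_non_empty[OF cA n] obtain k where "eigenvalue cA k" by (auto simp: spectrum_def)
  then obtain v where v: "v \<in> carrier_vec n" "v \<noteq> 0\<^sub>v n" "cA *\<^sub>v v = k \<cdot>\<^sub>v v"
    using cA by (auto simp: eigenvalue_def eigenvector_def)
  define x y where "x = map_vec Re v" and "y = map_vec Im v"
  have xc: "x \<in> carrier_vec n" and yc: "y \<in> carrier_vec n" using v by (auto simp: x_def y_def)
  have cAi: "(cA *\<^sub>v v) $ i = k * v $ i" if "i < n" for i using v that by simp
  have cAs: "(cA *\<^sub>v v) $ i = (\<Sum>j<n. complex_of_real (A $$ (i, j)) * v $ j)" if "i < n" for i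
    using that A v(1) by (auto simp: cA_def scalar_prod_def lessThan_atLeast0)
  have Ax: "A *\<^sub>v x = Re k \<cdot>\<^sub>v x - Im k \<cdot>\<^sub>v y"
  proof (rule eq_vecI)
    fix i assume "i < dim_vec (Re k \<cdot>\<^sub>v x - Im k \<cdot>\<^sub>v y)"
    then have i: "i < n" using yc by simp
    have "(A *\<^sub>v x) $ i = Re ((cA *\<^sub>v v) $ i)"
      using i A xc v unfolding cAs[OF i] by (auto simp: scalar_prod_def x_def lessThan_atLeast0)
    then show "(A *\<^sub>v x) $ i = (Re k \<cdot>\<^sub>v x - Im k \<cdot>\<^sub>v y) $ i"
      using i v unfolding cAi[OF i] by (simp add: x_def y_def)
  qed (use A yc in simp)
  have Ay: "A *\<^sub>v y = Re k \<cdot>\<^sub>v y + Im k \<cdot>\<^sub>v x"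
  proof (rule eq_vecI)
    fix i assume "i < dim_vec (Re k \<cdot>\<^sub>v y + Im k \<cdot>\<^sub>v x)"
    then have i: "i < n" using xc by simp
    have "(A *\<^sub>v y) $ i = Im ((cA *\<^sub>v v) $ i)"
      using i A xc v unfolding cAs[OF i] by (auto simp: scalar_prod_def y_def lessThan_atLeast0)
    then show "(A *\<^sub>v y) $ i = (Re k \<cdot>\<^sub>v y + Im k \<cdot>\<^sub>v x) $ i"
      using i v unfolding cAi[OF i] by (simp add: x_def y_def)
  qed (use A xc in simp)
  have pos: "0 < z \<bullet> z" if "z \<in> carrier_vec n" "z \<noteq> 0\<^sub>v n" for z :: "real vec"
    using scalar_prod_self(2,3)[OF that(1)] that(2) by linarith
  have "(A *\<^sub>v x) \<bullet> y = x \<bullet> (A *\<^sub>v y)" by (rule symmetric_mat_scalar_prod[OF A sym xc yc])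
  moreover have "(A *\<^sub>v x) \<bullet> y = Re k * (x \<bullet> y) - Im k * (y \<bullet> y)"
    unfolding Ax using xc yc by (simp add: minus_scalar_prod_distrib[of _ n])
  moreover have "x \<bullet> (A *\<^sub>v y) = Re k * (x \<bullet> y) + Im k * (x \<bullet> x)"
    unfolding Ay using xc yc by (simp add: scalar_prod_add_distrib[of _ n])
  ultimately have "Im k * (x \<bullet> x) + Im k * (y \<bullet> y) = 0" by linarith
  then have "Im k * (x \<bullet> x + y \<bullet> y) = 0" by (simp only: distrib_left)
  moreover have "x \<noteq> 0\<^sub>v n \<or> y \<noteq> 0\<^sub>v n"
  proof (rule ccontr)
    assume a: "\<not> ?thesis"
    have "v $ i = 0" if "i < n" for i
    proof -
      have "x $ i = 0" "y $ i = 0" using a that by auto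
      then show ?thesis using that v by (simp add: x_def y_def complex_eq_iff)
    qed
    then have "v = 0\<^sub>v n" using v(1) by (intro eq_vecI) auto
    with v(2) show False by simp
  qed
  then have "x \<bullet> x + y \<bullet> y \<noteq> 0" using pos[OF xc] pos[OF yc] scalar_prod_self(2)[OF xc] scalar_prod_self(2)[OF yc] by linarith
  ultimately have "Im k = 0" by simp
  then have ev: "A *\<^sub>v x = Re k \<cdot>\<^sub>v x" "A *\<^sub>v y = Re k \<cdot>\<^sub>v y" using xc yc unfolding Ax Ay by (auto intro!: eq_vecI)
  from \<open>x \<noteq> 0\<^sub>v n \<or> y \<noteq> 0\<^sub>v n\<close> ev xc yc obtain w where
    w: "w \<in> carrier_vec n" "w \<noteq> 0\<^sub>v n" "A *\<^sub>v w = Re k \<cdot>\<^sub>v w" by blast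
  define u where "u = (1 / sqrt (w \<bullet> w)) \<cdot>\<^sub>v w"
  have "u \<bullet> u = 1" using pos[OF w(1,2)] w(1) by (simp add: u_def)
  moreover have "A *\<^sub>v u = Re k \<cdot>\<^sub>v u"
    unfolding u_def mult_mat_vec[OF A w(1)] w(3) by (simp add: smult_smult_assoc mult.commute)
  moreover have "u \<in> carrier_vec n" using w by (simp add: u_def)
  ultimately show ?thesis by blast
qed

text \<open>Induction on the dimension: the reflection that sends the first unit vector to an eigenvector splits off
a one-dimensional block.\<close>

lemma real_spectral_theorem:
  fixes A :: "real mat"
  assumes "A \<in> carrier_mat n n" and "transpose_mat A = A"
  shows "\<exists>U\<in>carrier_mat n n. \<exists>d. transpose_mat U * U = 1\<^sub>m n \<and> A = U * mat_diag n d * transpose_mat U"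
  using assms
proof (induction n arbitrary: A)
  case 0
  then show ?case by (intro bexI[of _ "1\<^sub>m 0"]) (auto intro!: eq_matI)
next
  case (Suc n)
  note A = Suc.prems(1) and sym = Suc.prems(2)
  obtain u l where u: "u \<in> carrier_vec (Suc n)" "u \<bullet> u = 1" "A *\<^sub>v u = l \<cdot>\<^sub>v u"
    using symmetric_ex_eigenvector[OF A sym] by auto
  obtain H where H: "H \<in> carrier_mat (Suc n) (Suc n)" "transpose_mat H = H" "H * H = 1\<^sub>m (Suc n)"
    "\<And>i. i < Suc n \<Longrightarrow> H $$ (i, 0) = u $ i"
    using ex_householder[OF u(1) _ u(2)] by auto
  note assoc = assoc_mult_mat[of _ "Suc n" "Suc n" _ "Suc n" _ "Suc n"]
  define B where "B = H * A * H"
  have B: "B \<in> carrier_mat (Suc n) (Suc n)" using H A by (simp add: B_def)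
  have symB: "transpose_mat B = B" using H A sym
    by (simp add: B_def transpose_mult[of _ "Suc n" "Suc n" _ "Suc n"] assoc)
  have colH: "col H 0 = u" using H u by (intro eq_vecI) auto
  have "col B 0 = H *\<^sub>v (A *\<^sub>v col H 0)"
    using H A by (simp add: B_def col_mult2[of _ "Suc n" "Suc n" _ "Suc n"] assoc_mult_mat_vec[of _ "Suc n" "Suc n" _ "Suc n"])
  also have "\<dots> = l \<cdot>\<^sub>v (H *\<^sub>v col H 0)" unfolding colH u(3) using H u by (simp add: mult_mat_vec[of _ "Suc n" "Suc n"])
  also have "H *\<^sub>v col H 0 = col (H * H) 0" using H by (subst col_mult2[of _ "Suc n" "Suc n" _ "Suc n"]) auto
  also have "\<dots> = unit_vec (Suc n) 0" using H by simp
  finally have col0: "col B 0 = l \<cdot>\<^sub>v unit_vec (Suc n) 0" .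
  have B0: "B $$ (i, 0) = (if i = 0 then l else 0)" if "i < Suc n" for i
    using arg_cong[OF col0, of "\<lambda>v. v $ i"] that B by (auto simp: unit_vec_def)
  have B0': "B $$ (0, i) = (if i = 0 then l else 0)" if "i < Suc n" for i
    using arg_cong[OF symB, of "\<lambda>M. M $$ (i, 0)"] B that B0[OF that] by auto
  define C where "C = mat n n (\<lambda>(i, j). B $$ (Suc i, Suc j))"
  have C: "C \<in> carrier_mat n n" by (simp add: C_def)
  have "transpose_mat C = C"
  proof (rule eq_matI)
    fix i j assume "i < dim_row C" "j < dim_col C"
    then show "transpose_mat C $$ (i, j) = C $$ (i, j)"
      using index_transpose_mat(1)[of "Suc i" B "Suc j"] B unfolding symB by (simp add: C_def)
  qed (simp_all add: C_def)
  from Suc.IH[OF C this] obtain U d where U: "U \<in> carrier_mat n n" "transpose_mat U * U = 1\<^sub>m n"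
    "C = U * mat_diag n d * transpose_mat U" by blast
  define L where "L = mat 1 1 (\<lambda>_. l)"
  define W where "W = four_block_mat (1\<^sub>m 1) (0\<^sub>m 1 n) (0\<^sub>m n 1) U"
  have W: "W \<in> carrier_mat (Suc n) (Suc n)" using U(1) unfolding W_def by (intro carrier_matI) simp_all
  have WT: "transpose_mat W = four_block_mat (1\<^sub>m 1) (0\<^sub>m 1 n) (0\<^sub>m n 1) (transpose_mat U)"
    unfolding W_def using U(1) by (subst transpose_four_block_mat[of _ 1 1 _ n _ n]) auto
  have D: "mat_diag (Suc n) (case_nat l d) = four_block_mat L (0\<^sub>m 1 n) (0\<^sub>m n 1) (mat_diag n d)"
    by (rule eq_matI) (auto simp: L_def mat_diag_def split: nat.split)
  have Bb: "B = four_block_mat L (0\<^sub>m 1 n) (0\<^sub>m n 1) C"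
    using B B0 B0' by (intro eq_matI) (auto simp: L_def C_def)
  have Lc: "L \<in> carrier_mat 1 1" by (simp add: L_def)
  have "transpose_mat W * W = four_block_mat (1\<^sub>m 1) (0\<^sub>m 1 n) (0\<^sub>m n 1) (1\<^sub>m n)"
    unfolding WT unfolding W_def using U(1,2)
    by (subst mult_four_block_mat[of _ 1 1 _ n _ n _ _ 1 _ n]) (auto simp: )
  also have "\<dots> = 1\<^sub>m (Suc n)" by (rule eq_matI) auto
  finally have WW: "transpose_mat W * W = 1\<^sub>m (Suc n)" .
  have BW: "B = W * mat_diag (Suc n) (case_nat l d) * transpose_mat W"
    unfolding WT unfolding W_def D Bb U(3) using U(1) Lc C[unfolded U(3)]
    by (simp add: mult_four_block_mat[of _ 1 1 _ n _ n _ _ 1 _ n] mat_diag_dim)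
  have HWT: "transpose_mat (H * W) = transpose_mat W * H"
    using H W by (simp add: transpose_mult[of _ "Suc n" "Suc n" _ "Suc n"])
  have cancel: "H * (H * X) = X" if "X \<in> carrier_mat (Suc n) (Suc n)" for X
    using H that by (simp flip: assoc)
  have "transpose_mat (H * W) * (H * W) = 1\<^sub>m (Suc n)"
    unfolding HWT using H W WW by (simp add: assoc cancel)
  moreover have "A = H * W * mat_diag (Suc n) (case_nat l d) * transpose_mat (H * W)"
  proof -
    have "H * W * mat_diag (Suc n) (case_nat l d) * transpose_mat (H * W) = H * B * H"
      unfolding HWT BW using H(1) W by (simp add: assoc_mult_mat_dim)
    also have "\<dots> = A" unfolding B_def using H A by (simp add: assoc cancel)
    finally show ?thesis ..
  qed
  ultimately show ?case using H W by (intro bexI[of _ "H * W"] exI[of _ "case_nat l d"]) auto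
qed

text \<open>For orthogonal \<open>U\<close> this is the symmetric matrix with the columns of \<open>U\<close> as
eigenvectors and eigenvalues \<open>f\<close>. All matrices of the score statistic have this form with
one common \<open>U\<close>, so that their calculus is that of functions on the index set.\<close>

definition orth_diag :: "nat \<Rightarrow> real mat \<Rightarrow> (nat \<Rightarrow> real) \<Rightarrow> real mat" where
  "orth_diag n U f = U * mat_diag n f * transpose_mat U"

lemma transpose_mat_diag [simp]: "transpose_mat (mat_diag n f) = mat_diag n f"
  by (rule eq_matI) (auto simp: mat_diag_def)

lemma mat_diag_mult_vec:
  assumes "v \<in> carrier_vec n"
  shows "mat_diag n f *\<^sub>v v = vec n (\<lambda>i. f i * v $ i)"
  using assms
  by (intro eq_vecI) (auto simp: mat_diag_def scalar_prod_def if_distrib[of "\<lambda>x. x * _"] cong: if_cong)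

context
  fixes U :: "real mat" and n :: nat
  assumes U: "U \<in> carrier_mat n n" and UU: "transpose_mat U * U = 1\<^sub>m n"
begin

lemma orth_cancel: "dim_row X = n \<Longrightarrow> transpose_mat U * (U * X) = X"
  using U UU by (subst assoc_mult_mat_dim[symmetric]) auto

lemma orth_scalar_prod:
  assumes "v \<in> carrier_vec n" "w \<in> carrier_vec n"
  shows "(U *\<^sub>v v) \<bullet> (U *\<^sub>v w) = v \<bullet> w"
proof -
  have "v \<bullet> w = (transpose_mat U *\<^sub>v (U *\<^sub>v v)) \<bullet> w"
    using U assms by (subst assoc_mult_mat_vec_dim[symmetric]) (auto simp: UU)
  also have "\<dots> = (U *\<^sub>v v) \<bullet> (U *\<^sub>v w)"
    by (rule transpose_vec_mult_scalar) (use U assms in auto)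
  finally show ?thesis ..
qed

lemma orth_diag_carrier: "orth_diag n U f \<in> carrier_mat n n"
  using U by (intro carrier_matI) (auto simp: orth_diag_def)

lemma orth_diag_mult: "orth_diag n U f * orth_diag n U g = orth_diag n U (\<lambda>i. f i * g i)"
proof -
  have "orth_diag n U f * orth_diag n U g = U * (mat_diag n f * mat_diag n g) * transpose_mat U"
    using U by (simp add: orth_diag_def assoc_mult_mat_dim orth_cancel del: mat_diag_diag)
  then show ?thesis by (simp add: orth_diag_def)
qed

lemma orth_diag_transpose: "transpose_mat (orth_diag n U f) = orth_diag n U f"
  using U unfolding orth_diag_def
  by (subst transpose_mult[of _ n n _ n], simp, simp, subst transpose_mult[of _ n n _ n])
     (auto simp: assoc_mult_mat_dim intro!: mult_carrier_mat[of _ n n] mat_diag_dim)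

lemma orth_diag_one: "orth_diag n U (\<lambda>_. 1) = 1\<^sub>m n"
  using mat_mult_left_right_inverse[OF _ U UU] U by (simp add: orth_diag_def)

lemma orth_diag_cong:
  assumes "\<And>i. i < n \<Longrightarrow> f i = g i"
  shows "orth_diag n U f = orth_diag n U g"
proof -
  have "mat_diag n f = mat_diag n g" using assms by (intro eq_matI) (auto simp: mat_diag_def)
  then show ?thesis by (simp add: orth_diag_def)
qed

lemma orth_diag_mult_vec:
  assumes "v \<in> carrier_vec n"
  shows "orth_diag n U f *\<^sub>v (U *\<^sub>v v) = U *\<^sub>v vec n (\<lambda>i. f i * v $ i)"
proof -
  have "orth_diag n U f *\<^sub>v (U *\<^sub>v v) = U *\<^sub>v (mat_diag n f *\<^sub>v (transpose_mat U * U *\<^sub>v v))"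
    using U assms by (simp add: orth_diag_def assoc_mult_mat_vec_dim)
  then show ?thesis using assms by (simp add: UU mat_diag_mult_vec)
qed

lemma orth_diag_quadratic_form:
  assumes "v \<in> carrier_vec n"
  shows "(U *\<^sub>v v) \<bullet> (orth_diag n U f *\<^sub>v (U *\<^sub>v v)) = (\<Sum>i<n. f i * (v $ i)\<^sup>2)"
  using assms unfolding orth_diag_mult_vec[OF assms]
  by (subst orth_scalar_prod) (auto simp: scalar_prod_def lessThan_atLeast0 power2_eq_square mult_ac)

lemma mat_trace_orth_diag: "mat_trace (orth_diag n U f) = (\<Sum>i<n. f i)"
proof -
  have "mat_trace (orth_diag n U f) = (\<Sum>i<n. \<Sum>j<n. U $$ (i, j) * f j * U $$ (i, j))"
    using U by (simp add: mat_trace_def orth_diag_def mat_diag_mult_right[of _ n n] scalar_prod_def lessThan_atLeast0)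
  also have "\<dots> = (\<Sum>j<n. f j * (transpose_mat U * U) $$ (j, j))"
    using U by (subst sum.swap) (simp add: scalar_prod_def lessThan_atLeast0 sum_distrib_left mult_ac)
  finally show ?thesis unfolding UU by simp
qed

lemma orth_diag_sym_psd:
  assumes "\<And>i. i < n \<Longrightarrow> 0 \<le> f i"
  shows "sym_psd n (orth_diag n U f)"
  unfolding sym_psd_def
proof (intro conjI ballI orth_diag_carrier orth_diag_transpose)
  fix v :: "real vec" assume v: "v \<in> carrier_vec n"
  have UU': "U * transpose_mat U = 1\<^sub>m n"
    by (rule mat_mult_left_right_inverse[OF _ U UU]) (use U in simp)
  have w: "transpose_mat U *\<^sub>v v \<in> carrier_vec n" using U by (intro carrier_vecI) simp
  have "U *\<^sub>v (transpose_mat U *\<^sub>v v) = v"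
    using U v by (subst assoc_mult_mat_vec_dim[symmetric]) (auto simp: UU')
  with orth_diag_quadratic_form[OF w, of f] assms show "0 \<le> v \<bullet> (orth_diag n U f *\<^sub>v v)"
    by (auto intro!: sum_nonneg mult_nonneg_nonneg)
qed

end

lemma sym_psd_ex_sqrt:
  assumes "sym_psd n A"
  shows "\<exists>B. sym_psd n B \<and> B * B = A"
proof -
  from assms have A: "A \<in> carrier_mat n n" and sym: "transpose_mat A = A"
    and psd: "\<And>v. v \<in> carrier_vec n \<Longrightarrow> 0 \<le> v \<bullet> (A *\<^sub>v v)" by (auto simp: sym_psd_def)
  obtain U d where U: "U \<in> carrier_mat n n" "transpose_mat U * U = 1\<^sub>m n" and Ad: "A = orth_diag n U d"
    using real_spectral_theorem[OF A sym] unfolding orth_diag_def by blast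
  have d: "0 \<le> d i" if i: "i < n" for i
  proof -
    have "0 \<le> (U *\<^sub>v unit_vec n i) \<bullet> (A *\<^sub>v (U *\<^sub>v unit_vec n i))"
      using U(1) by (intro psd) simp
    also have "\<dots> = (\<Sum>k<n. if k = i then d k else 0)"
      unfolding Ad orth_diag_quadratic_form[OF U unit_vec_carrier]
      by (intro sum.cong) (auto simp: unit_vec_def)
    finally show ?thesis using i by simp
  qed
  have "orth_diag n U (\<lambda>i. sqrt (d i)) * orth_diag n U (\<lambda>i. sqrt (d i)) = A"
    unfolding orth_diag_mult[OF U] Ad by (rule orth_diag_cong) (use U d in auto)
  then show ?thesis using orth_diag_sym_psd[OF U, of "\<lambda>i. sqrt (d i)"] d by auto
qed

text \<open>If \<open>B u = d u\<close> with \<open>d \<ge> 0\<close>, then \<open>w = C u - d u\<close> satisfies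
\<open>C w = - d w\<close>, which contradicts that \<open>C\<close> is positive semidefinite unless
\<open>w = 0\<close> or \<open>d = 0\<close>; for \<open>d = 0\<close>, the symmetry of \<open>C\<close>
turns \<open>C (C u) = 0\<close> into \<open>C u = 0\<close>. So \<open>B\<close> and \<open>C\<close>
agree on an eigenbasis of \<open>B\<close>.\<close>

lemma sym_psd_sqrt_unique:
  assumes "sym_psd n B" "sym_psd n C" and eq: "B * B = C * C"
  shows "B = C"
proof -
  from assms have B: "B \<in> carrier_mat n n" "transpose_mat B = B" "\<And>v. v \<in> carrier_vec n \<Longrightarrow> 0 \<le> v \<bullet> (B *\<^sub>v v)"
    and C: "C \<in> carrier_mat n n" "transpose_mat C = C" "\<And>v. v \<in> carrier_vec n \<Longrightarrow> 0 \<le> v \<bullet> (C *\<^sub>v v)"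
    by (auto simp: sym_psd_def)
  note assoc = assoc_mult_mat[of _ n n _ n _ n]
  obtain U d where U: "U \<in> carrier_mat n n" "transpose_mat U * U = 1\<^sub>m n" "B = U * mat_diag n d * transpose_mat U"
    using real_spectral_theorem[OF B(1,2)] by blast
  have U': "U * transpose_mat U = 1\<^sub>m n"
    by (rule mat_mult_left_right_inverse[OF _ U(1) U(2)]) (use U in simp)
  have BU: "B * U = U * mat_diag n d"
  proof -
    have "B * U = U * mat_diag n d * (transpose_mat U * U)"
      unfolding U(3) using U(1) mat_diag_dim[of n d] by (simp add: assoc del: mat_diag_dim)
    then show ?thesis using U(1,2) right_mult_one_mat[of "U * mat_diag n d" n n] by simp
  qed
  have "col (C * U) i = col (B * U) i" if i: "i < n" for i
  proof -
    define u where "u = col U i"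
    have u: "u \<in> carrier_vec n" using U(1) i by (simp add: u_def)
    have uu: "u \<bullet> u = 1" using arg_cong[OF U(2), of "\<lambda>M. M $$ (i, i)"] U(1) i by (simp add: u_def)
    have Bu: "B *\<^sub>v u = d i \<cdot>\<^sub>v u"
    proof -
      have "B *\<^sub>v u = col (U * mat_diag n d) i"
        unfolding BU[symmetric] u_def by (rule col_mult2[symmetric]) (use U(1) B(1) i in auto)
      also have "\<dots> = d i \<cdot>\<^sub>v u" using U(1) i by (intro eq_vecI) (auto simp: mat_diag_mult_right[of _ n n] u_def)
      finally show ?thesis .
    qed
    have d0: "0 \<le> d i" using B(3)[OF u] Bu u uu by simp
    define w where "w = C *\<^sub>v u - d i \<cdot>\<^sub>v u"
    have w: "w \<in> carrier_vec n" using C u by (simp add: w_def)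
    have Cu: "C *\<^sub>v u \<in> carrier_vec n" using C u by simp
    have CC: "C *\<^sub>v (C *\<^sub>v u) = (d i * d i) \<cdot>\<^sub>v u"
    proof -
      have "C *\<^sub>v (C *\<^sub>v u) = B *\<^sub>v (B *\<^sub>v u)"
        using assoc_mult_mat_vec[OF B(1) B(1) u] assoc_mult_mat_vec[OF C(1) C(1) u] unfolding eq by simp
      also have "\<dots> = (d i * d i) \<cdot>\<^sub>v u" using B(1) u by (simp add: Bu mult_mat_vec[OF B(1)] smult_smult_assoc)
      finally show ?thesis .
    qed
    have "C *\<^sub>v w = C *\<^sub>v (C *\<^sub>v u) - d i \<cdot>\<^sub>v (C *\<^sub>v u)"
      unfolding w_def using C(1) u by (simp add: mult_minus_distrib_mat_vec[of _ n n] mult_mat_vec[OF C(1)])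
    also have "\<dots> = (- d i) \<cdot>\<^sub>v w" unfolding CC w_def using C u Cu
      by (intro eq_vecI) (auto simp: algebra_simps)
    finally have Cw: "C *\<^sub>v w = (- d i) \<cdot>\<^sub>v w" .
    have "0 \<le> - d i * (w \<bullet> w)" using C(3)[OF w] Cw w by simp
    moreover have "0 \<le> w \<bullet> w" by (rule scalar_prod_self(2)[OF w])
    ultimately have *: "d i = 0 \<or> w \<bullet> w = 0" using d0 by (metis mult_minus_left neg_0_le_iff_le mult_nonneg_nonneg order_antisym mult_eq_0_iff)
    have "w \<bullet> w = 0"
    proof (cases "d i = 0")
      case True
      have w': "w = C *\<^sub>v u" unfolding w_def True using C(1) Cu u by (intro eq_vecI) auto
      have "w \<bullet> w = u \<bullet> (C *\<^sub>v (C *\<^sub>v u))" unfolding w' by (rule symmetric_mat_scalar_prod[OF C(1,2) u Cu])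
      then show ?thesis unfolding CC using True u by simp
    qed (use * in simp)
    then have "w = 0\<^sub>v n" using scalar_prod_self(3)[OF w] by simp
    have "C *\<^sub>v u = d i \<cdot>\<^sub>v u"
    proof (rule eq_vecI)
      fix j assume "j < dim_vec (d i \<cdot>\<^sub>v u)"
      then have j: "j < n" using u by simp
      have "w $ j = (C *\<^sub>v u) $ j - d i * u $ j" unfolding w_def using j u Cu by simp
      then show "(C *\<^sub>v u) $ j = (d i \<cdot>\<^sub>v u) $ j" using \<open>w = 0\<^sub>v n\<close> j u by simp
    qed (use C(1) u in simp)
    then show ?thesis using Bu B(1) C(1) U(1) i by (simp add: u_def col_mult2[of _ n n _ n])
  qed
  then have "C * U = B * U" using B(1) C(1) U(1) by (intro mat_col_eqI) auto
  then have "C * U * transpose_mat U = B * U * transpose_mat U" by simp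
  moreover have XU: "X * U * transpose_mat U = X" if "X \<in> carrier_mat n n" for X
    using that U(1) U' by (simp add: assoc[of X])
  ultimately have "C = B" unfolding XU[OF B(1)] XU[OF C(1)] by simp
  then show ?thesis by simp
qed

lemma psd_sqrt_eqI:
  assumes "sym_psd n B" "B * B = A"
  shows "psd_sqrt A = B"
proof -
  have "A \<in> carrier_mat n n" using assms by (auto simp: sym_psd_def)
  then have n: "dim_row A = n" by simp
  have "C = B" if "sym_psd n C \<and> C * C = A" for C
    by (rule sym_psd_sqrt_unique[of n]) (use that assms in simp_all)
  with assms show ?thesis unfolding psd_sqrt_def n by (intro the_equality conjI)
qed

lemma psd_inv_sqrt_orth_diag:
  assumes U: "U \<in> carrier_mat n n" "transpose_mat U * U = 1\<^sub>m n" and d: "\<And>i. i < n \<Longrightarrow> 0 < d i"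
  shows "psd_inv_sqrt (orth_diag n U d) = orth_diag n U (\<lambda>i. 1 / sqrt (d i))"
proof -
  have "psd_sqrt (orth_diag n U d) = orth_diag n U (\<lambda>i. sqrt (d i))"
  proof (rule psd_sqrt_eqI[of n])
    show "sym_psd n (orth_diag n U (\<lambda>i. sqrt (d i)))"
      using d by (intro orth_diag_sym_psd[OF U]) (simp add: less_imp_le)
    show "orth_diag n U (\<lambda>i. sqrt (d i)) * orth_diag n U (\<lambda>i. sqrt (d i)) = orth_diag n U d"
      unfolding orth_diag_mult[OF U] by (rule orth_diag_cong[OF U]) (use d in \<open>simp add: less_imp_le\<close>)
  qed
  moreover have "orth_diag n U (\<lambda>i. sqrt (d i)) * orth_diag n U (\<lambda>i. 1 / sqrt (d i)) = 1\<^sub>m n"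
    unfolding orth_diag_mult[OF U] orth_diag_one[OF U, symmetric]
    by (rule orth_diag_cong[OF U]) (use d in \<open>simp add: less_imp_neq[symmetric]\<close>)
  ultimately show ?thesis
    unfolding psd_inv_sqrt_def using mat_inv_eqI[OF orth_diag_carrier[OF U] orth_diag_carrier[OF U]] by simp
qed

text \<open>With \<open>C\<close> the inverse square root of \<open>G G\<^sup>T\<close>, the matrix
\<open>C G\<close> satisfies \<open>(C G) (C G)\<^sup>T = 1\<close>; being square, it is orthogonal and
preserves norms. So \<open>G\<close> may be any invertible factor of the information.\<close>

lemma standardized_norm_eq:
  fixes G :: "real mat"
  assumes G: "G \<in> carrier_mat n n" and w: "w \<in> carrier_vec n" and det: "det G \<noteq> 0"
  defines "C \<equiv> psd_inv_sqrt (G * transpose_mat G)"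
  shows "(C *\<^sub>v (G *\<^sub>v w)) \<bullet> (C *\<^sub>v (G *\<^sub>v w)) = w \<bullet> w"
proof -
  have "0 \<le> v \<bullet> (G * transpose_mat G *\<^sub>v v)" if v: "v \<in> carrier_vec n" for v
  proof -
    have tv: "transpose_mat G *\<^sub>v v \<in> carrier_vec n" using G by (intro carrier_vecI) simp
    have "v \<bullet> (G * transpose_mat G *\<^sub>v v) = v \<bullet> (G *\<^sub>v (transpose_mat G *\<^sub>v v))"
      using G v by (subst assoc_mult_mat_vec_dim) auto
    also have "\<dots> = (transpose_mat G *\<^sub>v v) \<bullet> (transpose_mat G *\<^sub>v v)"
      by (rule transpose_vec_mult_scalar[symmetric, OF G tv v])
    finally show ?thesis using scalar_prod_self(2)[OF tv] by simp
  qed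
  then have "sym_psd n (G * transpose_mat G)"
    using G by (auto simp: sym_psd_def transpose_mult[of _ n n _ n])
  then obtain B where B: "sym_psd n B" "B * B = G * transpose_mat G" using sym_psd_ex_sqrt by blast
  then have Bc: "B \<in> carrier_mat n n" and Bt: "transpose_mat B = B" by (auto simp: sym_psd_def)
  have C: "C = mat_inv B" unfolding C_def psd_inv_sqrt_def psd_sqrt_eqI[OF B] ..
  have "det B * det B = det G * det G"
    using arg_cong[OF B(2), of det] G Bc by (simp add: det_mult[of _ n] det_transpose)
  then have "det B \<noteq> 0" using det by auto
  note inv = mat_inv_right[OF Bc this, folded C]
  have CB: "transpose_mat C * B = 1\<^sub>m n"
    using arg_cong[OF inv(2), of transpose_mat] Bc inv(1) by (simp add: transpose_mult[of _ n n _ n] Bt)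
  have "C = transpose_mat C"
  proof -
    have "transpose_mat C = transpose_mat C * (B * C)" using inv by simp
    also have "\<dots> = transpose_mat C * B * C" using inv(1) Bc by (subst assoc_mult_mat_dim) auto
    finally show ?thesis using CB inv(1) by simp
  qed
  define K where "K = C * G"
  have K: "K \<in> carrier_mat n n" using inv(1) G by (simp add: K_def)
  have "K * transpose_mat K = C * (G * transpose_mat G) * transpose_mat C"
    using inv(1) G by (simp add: K_def transpose_mult[of _ n n _ n] assoc_mult_mat_dim)
  also have "\<dots> = C * (B * B) * C" unfolding B(2) using \<open>C = transpose_mat C\<close> by simp
  also have "\<dots> = (C * B) * (B * C)" using inv(1) Bc by (simp add: assoc_mult_mat_dim)
  also have "\<dots> = 1\<^sub>m n" unfolding inv by simp
  finally have "transpose_mat K * K = 1\<^sub>m n"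
    using K by (intro mat_mult_left_right_inverse[of K n]) auto
  moreover have "C *\<^sub>v (G *\<^sub>v w) = K *\<^sub>v w"
    using inv(1) G w unfolding K_def by (subst assoc_mult_mat_vec_dim) auto
  ultimately show ?thesis using orth_scalar_prod[OF K _ w w] by simp
qed

section \<open>Kronecker products of mixed-radix structure\<close>

lemma sum_div_mod:
  fixes f :: "nat \<Rightarrow> nat \<Rightarrow> 'a::comm_monoid_add"
  assumes "0 < q"
  shows "(\<Sum>k<p * q. f (k div q) (k mod q)) = (\<Sum>a<p. \<Sum>b<q. f a b)"
  unfolding sum.cartesian_product
proof (rule sum.reindex_bij_witness[where i = "\<lambda>(a, b). a * q + b" and j = "\<lambda>k. (k div q, k mod q)"])
  show "\<And>b. b \<in> {..<p} \<times> {..<q} \<Longrightarrow> (case b of (a, b) \<Rightarrow> a * q + b) \<in> {..<p * q}"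
  proof clarsimp
    fix a b assume "a < p" "b < q"
    then have "a * q + b < (a + 1) * q" by simp
    also have "\<dots> \<le> p * q" using \<open>a < p\<close> by (intro mult_right_mono) auto
    finally show "a * q + b < p * q" .
  qed
qed (use assms in \<open>auto simp: less_mult_imp_div_less\<close>)

lemma kron_dims [simp]:
  "dim_row (kron A B) = dim_row A * dim_row B" "dim_col (kron A B) = dim_col A * dim_col B"
  by (simp_all add: kron_def)

lemma kron_mult:
  assumes "dim_col A = dim_row C" "dim_col B = dim_row D"
  shows "kron A B * kron C D = kron (A * C) (B * D)"
proof (rule eq_matI)
  fix i j assume "i < dim_row (kron (A * C) (B * D))" "j < dim_col (kron (A * C) (B * D))"
  then have i: "i < dim_row A * dim_row B" and j: "j < dim_col C * dim_col D" by auto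
  then have B: "0 < dim_row B" "0 < dim_col D" by (auto intro!: Nat.gr0I)
  let ?i = "i div dim_row B" and ?i' = "i mod dim_row B" and ?j = "j div dim_col D" and ?j' = "j mod dim_col D"
  have ij: "?i < dim_row A" "?i' < dim_row B" "?j < dim_col C" "?j' < dim_col D"
    using i j B by (auto simp: less_mult_imp_div_less)
  have "(kron A B * kron C D) $$ (i, j) = (\<Sum>k<dim_row C * dim_row D.
      (\<lambda>a b. (A $$ (?i, a) * B $$ (?i', b)) * (C $$ (a, ?j) * D $$ (b, ?j'))) (k div dim_row D) (k mod dim_row D))"
    using i j assms by (auto simp: scalar_prod_def lessThan_atLeast0 kron_def intro!: sum.cong)
  also have "\<dots> = (\<Sum>a<dim_row C. \<Sum>b<dim_row D. (A $$ (?i, a) * B $$ (?i', b)) * (C $$ (a, ?j) * D $$ (b, ?j')))"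
  proof (cases "dim_row D = 0")
    case False
    then show ?thesis by (intro sum_div_mod) simp
  qed simp
  also have "\<dots> = (\<Sum>a<dim_row C. A $$ (?i, a) * C $$ (a, ?j)) * (\<Sum>b<dim_row D. B $$ (?i', b) * D $$ (b, ?j'))"
    by (simp add: sum_product mult_ac)
  also have "\<dots> = kron (A * C) (B * D) $$ (i, j)"
    using i j ij assms by (simp add: kron_def scalar_prod_def lessThan_atLeast0)
  finally show "(kron A B * kron C D) $$ (i, j) = kron (A * C) (B * D) $$ (i, j)" .
qed auto

lemma kron_transpose: "transpose_mat (kron A B) = kron (transpose_mat A) (transpose_mat B)"
proof (rule eq_matI)
  fix i j assume "i < dim_row (kron (transpose_mat A) (transpose_mat B))"
    "j < dim_col (kron (transpose_mat A) (transpose_mat B))"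
  then have ij: "i < dim_col A * dim_col B" "j < dim_row A * dim_row B" by auto
  then have "0 < dim_col B" "0 < dim_row B" by (auto intro!: Nat.gr0I)
  then show "transpose_mat (kron A B) $$ (i, j) = kron (transpose_mat A) (transpose_mat B) $$ (i, j)"
    using ij by (simp add: kron_def less_mult_imp_div_less)
qed auto

lemma kron_mat_diag: "kron (mat_diag p f) (mat_diag q g) = mat_diag (p * q) (\<lambda>a. f (a div q) * g (a mod q))"
proof (rule eq_matI)
  fix i j assume "i < dim_row (mat_diag (p * q) (\<lambda>a. f (a div q) * g (a mod q)))"
    "j < dim_col (mat_diag (p * q) (\<lambda>a. f (a div q) * g (a mod q)))"
  then have ij: "i < p * q" "j < p * q" by auto
  then have q: "0 < q" by (auto intro!: Nat.gr0I)
  have "i = j" if "i div q = j div q" "i mod q = j mod q" using that by (metis div_mult_mod_eq)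
  then show "kron (mat_diag p f) (mat_diag q g) $$ (i, j) = mat_diag (p * q) (\<lambda>a. f (a div q) * g (a mod q)) $$ (i, j)"
    using ij q by (auto simp: kron_def mat_diag_def less_mult_imp_div_less)
qed auto

definition kron_list :: "('i \<Rightarrow> real mat) \<Rightarrow> 'i list \<Rightarrow> real mat" where
  "kron_list A is = foldr kron (map A is) (1\<^sub>m 1)"

lemma kron_list_simps [simp]:
  "kron_list A [] = 1\<^sub>m 1" "kron_list A (i # is) = kron (A i) (kron_list A is)"
  by (simp_all add: kron_list_def)

lemma kron_list_carrier:
  assumes "\<And>i. i \<in> set is \<Longrightarrow> A i \<in> carrier_mat (d i) (d i)"
  shows "kron_list A is \<in> carrier_mat (prod_list (map d is)) (prod_list (map d is))"
  using assms
proof (induction "is")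
  case (Cons i "is")
  then have "A i \<in> carrier_mat (d i) (d i)" by simp
  with Cons show ?case by (intro carrier_matI) auto
qed simp

lemma kron_list_mult:
  assumes "\<And>i. i \<in> set is \<Longrightarrow> A i \<in> carrier_mat (d i) (d i)"
    and "\<And>i. i \<in> set is \<Longrightarrow> B i \<in> carrier_mat (d i) (d i)"
  shows "kron_list A is * kron_list B is = kron_list (\<lambda>i. A i * B i) is"
  using assms
proof (induction "is")
  case (Cons i "is")
  have "kron_list A is \<in> carrier_mat (prod_list (map d is)) (prod_list (map d is))"
    "kron_list B is \<in> carrier_mat (prod_list (map d is)) (prod_list (map d is))"
    using Cons.prems by (auto intro!: kron_list_carrier)
  moreover have "A i \<in> carrier_mat (d i) (d i)" "B i \<in> carrier_mat (d i) (d i)"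
    using Cons.prems by auto
  moreover have "kron_list A is * kron_list B is = kron_list (\<lambda>i. A i * B i) is"
    using Cons by simp
  ultimately show ?case by (simp add: kron_mult)
qed simp

lemma kron_list_transpose: "transpose_mat (kron_list A is) = kron_list (\<lambda>i. transpose_mat (A i)) is"
  by (induction "is") (simp_all add: kron_transpose)

text \<open>The list is a mixed radix with the most significant position first, which is the order in which
\<open>kron\<close> arranges the indices of its factors.\<close>

fun digit :: "nat list \<Rightarrow> nat \<Rightarrow> nat \<Rightarrow> nat" where
  "digit [] l a = 0"
| "digit (d # ds) 0 a = a div prod_list ds"
| "digit (d # ds) (Suc l) a = digit ds l (a mod prod_list ds)"

lemma kron_list_mat_diag:
  "kron_list (\<lambda>i. mat_diag (d i) (f i)) is =
     mat_diag (prod_list (map d is)) (\<lambda>a. \<Prod>l<length is. f (is ! l) (digit (map d is) l a))"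
proof (induction "is")
  case Nil
  then show ?case by (simp flip: mat_diag_one)
next
  case (Cons i "is")
  then show ?case by (simp only: kron_list_simps kron_mat_diag)
     (simp add: prod.lessThan_Suc_shift del: prod.lessThan_Suc)
qed

text \<open>Column 0 of a Kronecker product involves column 0 of each factor only.\<close>

lemma kron_list_column_0:
  assumes "\<And>i. i \<in> set is \<Longrightarrow> A i \<in> carrier_mat (d i) (d i)"
    and "\<And>i a. i \<in> set is \<Longrightarrow> a < d i \<Longrightarrow> A i $$ (a, 0) = c i"
    and "a < prod_list (map d is)"
  shows "kron_list A is $$ (a, 0) = prod_list (map c is)"
  using assms
proof (induction "is" arbitrary: a)
  case (Cons i "is")
  have K: "kron_list A is \<in> carrier_mat (prod_list (map d is)) (prod_list (map d is))"
    using Cons.prems by (auto intro!: kron_list_carrier)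
  have A: "A i \<in> carrier_mat (d i) (d i)" using Cons.prems by simp
  have a: "a < d i * prod_list (map d is)" using Cons.prems by simp
  then have p: "0 < prod_list (map d is)" by (auto intro!: Nat.gr0I)
  have a0: "a div prod_list (map d is) < d i" using a by (rule less_mult_imp_div_less)
  have "kron_list A is $$ (a mod prod_list (map d is), 0) = prod_list (map c is)"
    by (rule Cons.IH) (use Cons.prems p in auto)
  moreover have "A i $$ (a div prod_list (map d is), 0) = c i" using Cons.prems(2) a0 by simp
  ultimately show ?case using K A a p a0 by (simp add: kron_def)
qed simp

lemma digit_0 [simp]: "digit ds l 0 = 0"
  by (induction ds l "0::nat" rule: digit.induct) auto

lemma all_digits_0:
  assumes "\<And>d. d \<in> set ds \<Longrightarrow> 0 < d" "a < prod_list ds" "\<And>l. l < length ds \<Longrightarrow> digit ds l a = 0"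
  shows "a = 0"
  using assms
proof (induction ds arbitrary: a)
  case (Cons d ds)
  have "prod_list ds \<noteq> 0" using Cons.prems(1) by (auto simp: prod_list_zero_iff)
  moreover have "a div prod_list ds = 0" using Cons.prems(3)[of 0] by simp
  ultimately have a: "a < prod_list ds" by (simp add: div_eq_0_iff)
  have "digit ds l a = 0" if "l < length ds" for l using Cons.prems(3)[of "Suc l"] that a by simp
  then show ?case using Cons.IH[OF _ a] Cons.prems(1) by simp
qed simp

text \<open>Right inverse of \<open>digit\<close>, used to exhibit many members of each block.\<close>

fun from_digits :: "nat list \<Rightarrow> (nat \<Rightarrow> nat) \<Rightarrow> nat" where
  "from_digits [] f = 0"
| "from_digits (d # ds) f = f 0 * prod_list ds + from_digits ds (\<lambda>l. f (Suc l))"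

lemma from_digits_less:
  assumes "\<And>l. l < length ds \<Longrightarrow> f l < ds ! l"
  shows "from_digits ds f < prod_list ds"
  using assms
proof (induction ds arbitrary: f)
  case (Cons d ds)
  have "from_digits ds (\<lambda>l. f (Suc l)) < prod_list ds" using Cons.prems by (intro Cons.IH) fastforce
  then have "from_digits (d # ds) f < (f 0 + 1) * prod_list ds" by simp
  also have "\<dots> \<le> d * prod_list ds" using Cons.prems[of 0] by (intro mult_right_mono) auto
  finally show ?case by simp
qed simp

lemma digit_from_digits:
  assumes "\<And>l. l < length ds \<Longrightarrow> f l < ds ! l" "l < length ds"
  shows "digit ds l (from_digits ds f) = f l"
  using assms
proof (induction ds l "from_digits ds f" arbitrary: f rule: digit.induct)
  case (2 d ds f)
  have "from_digits ds (\<lambda>l. f (Suc l)) < prod_list ds" using 2 by (intro from_digits_less) fastforce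
  then show ?case by (simp add: div_add1_eq)
next
  case (3 d ds l f)
  have *: "from_digits ds (\<lambda>l. f (Suc l)) < prod_list ds" using 3 by (intro from_digits_less) fastforce
  then have "from_digits (d # ds) f mod prod_list ds = from_digits ds (\<lambda>l. f (Suc l))" by simp
  then show ?case using 3(1)[of "\<lambda>l. f (Suc l)"] 3(2,3) by fastforce
qed simp

text \<open>Averaging is the projection on the constants, so in an orthonormal basis that starts with the normalized
constant vector it keeps the first coordinate and kills the others.\<close>

lemma avg_mat_mult_orthogonal:
  assumes H: "H \<in> carrier_mat n n" "transpose_mat H * H = 1\<^sub>m n" "\<And>i. i < n \<Longrightarrow> H $$ (i, 0) = 1 / sqrt (real n)"
  shows "avg_mat n * H = H * mat_diag n (\<lambda>a. if a = 0 then 1 else 0)"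
proof (rule eq_matI)
  fix i j assume "i < dim_row (H * mat_diag n (\<lambda>a. if a = 0 then 1 else 0 :: real))"
    "j < dim_col (H * mat_diag n (\<lambda>a. if a = 0 then 1 else 0 :: real))"
  then have ij: "i < n" "j < n" using H by auto
  have "(avg_mat n * H) $$ (i, j) = (\<Sum>k<n. 1 / sqrt n * (H $$ (k, 0) * H $$ (k, j)))"
    using ij H(1,3) by (auto simp: avg_mat_def scalar_prod_def lessThan_atLeast0 real_sqrt_mult_self intro!: sum.cong)
  also have "(\<Sum>k<n. 1 / sqrt n * (H $$ (k, 0) * H $$ (k, j))) = 1 / sqrt n * (transpose_mat H * H) $$ (0, j)"
    using ij H(1) by (simp add: scalar_prod_def lessThan_atLeast0 sum_distrib_left)
  also have "\<dots> = (H * mat_diag n (\<lambda>a. if a = 0 then 1 else 0)) $$ (i, j)"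
    using ij H(1,3) by (simp add: H(2) mat_diag_mult_right[of _ n n])
  finally show "(avg_mat n * H) $$ (i, j) = (H * mat_diag n (\<lambda>a. if a = 0 then 1 else 0)) $$ (i, j)" .
qed (use H in \<open>simp_all add: avg_mat_def\<close>)

lemma ex_uniform_orthogonal:
  assumes "0 < n"
  shows "\<exists>H\<in>carrier_mat n n. transpose_mat H * H = 1\<^sub>m n \<and> (\<forall>i<n. H $$ (i, 0) = 1 / sqrt (real n))"
proof -
  have "vec n (\<lambda>_. 1 / sqrt (real n)) \<bullet> vec n (\<lambda>_. 1 / sqrt (real n)) = 1"
    using assms by (simp add: scalar_prod_def)
  then obtain H where "H \<in> carrier_mat n n" "transpose_mat H = H" "H * H = 1\<^sub>m n"
    "\<forall>i<n. H $$ (i, 0) = vec n (\<lambda>_. 1 / sqrt (real n)) $ i"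
    using ex_householder[OF _ assms, of "vec n (\<lambda>_. 1 / sqrt (real n))"] by auto
  then show ?thesis by (intro bexI[of _ H]) auto
qed

text \<open>The indices of the basis vectors that span the range of the \<open>j\<close>-th factor projection:
contrasts of factor \<open>j\<close>, and index 0 for the constants.\<close>

definition one_factor :: "nat list \<Rightarrow> nat \<Rightarrow> nat \<Rightarrow> bool" where
  "one_factor ns j a \<longleftrightarrow> (\<forall>l<length ns. l \<noteq> j \<longrightarrow> digit ns l a = 0)"

text \<open>Column 0 is prescribed so that the other columns span the contrasts.\<close>

definition eigenbasis :: "nat list \<Rightarrow> real mat \<Rightarrow> bool" where
  "eigenbasis ns Q \<longleftrightarrow> Q \<in> carrier_mat (prod_list ns) (prod_list ns) \<and>
     transpose_mat Q * Q = 1\<^sub>m (prod_list ns) \<and>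
     (\<forall>i<prod_list ns. Q $$ (i, 0) = 1 / sqrt (real (prod_list ns))) \<and>
     (\<forall>j<length ns. factor_proj ns j \<in> carrier_mat (prod_list ns) (prod_list ns) \<and>
       factor_proj ns j * Q = Q * mat_diag (prod_list ns) (\<lambda>a. if one_factor ns j a then 1 else 0))"

text \<open>A Kronecker product of orthogonal matrices, each with constant first column, diagonalizes the Kronecker
products of identity and averaging matrices, by the mixed product rule.\<close>

lemma ex_eigenbasis:
  assumes pos: "\<And>m. m \<in> set ns \<Longrightarrow> 0 < m"
  defines "n \<equiv> prod_list ns"
  shows "\<exists>Q. eigenbasis ns Q"
proof -
  let ?d = "\<lambda>i. ns ! i"
  let ?is = "[0..<length ns]"
  have mapd: "map ?d ?is = ns" by (simp add: map_nth)
  have "\<forall>i\<in>{..<length ns}. \<exists>H. H \<in> carrier_mat (?d i) (?d i) \<and> transpose_mat H * H = 1\<^sub>m (?d i) \<and>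
      (\<forall>a<?d i. H $$ (a, 0) = 1 / sqrt (real (?d i)))"
  proof
    fix i assume "i \<in> {..<length ns}"
    then show "\<exists>H. H \<in> carrier_mat (?d i) (?d i) \<and> transpose_mat H * H = 1\<^sub>m (?d i) \<and>
      (\<forall>a<?d i. H $$ (a, 0) = 1 / sqrt (real (?d i)))"
      using ex_uniform_orthogonal[of "?d i"] pos by auto
  qed
  from bchoice[OF this] obtain H where all: "\<forall>i\<in>{..<length ns}. H i \<in> carrier_mat (?d i) (?d i) \<and>
      transpose_mat (H i) * H i = 1\<^sub>m (?d i) \<and> (\<forall>a<?d i. H i $$ (a, 0) = 1 / sqrt (real (?d i)))"
    by (elim exE)
  have H: "H i \<in> carrier_mat (?d i) (?d i)" "transpose_mat (H i) * H i = 1\<^sub>m (?d i)"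
    "\<And>a. a < ?d i \<Longrightarrow> H i $$ (a, 0) = 1 / sqrt (real (?d i))" if "i < length ns" for i
    using all that by simp_all
  define Q where "Q = kron_list H ?is"
  have Q: "Q \<in> carrier_mat n n"
    using kron_list_carrier[of ?is H ?d] H(1) unfolding mapd Q_def n_def by simp
  have cong: "kron_list A ?is = kron_list B ?is" if "\<And>i. i < length ns \<Longrightarrow> A i = B i" for A B
    using that unfolding kron_list_def by (intro arg_cong[of _ _ "\<lambda>xs. foldr kron xs _"] map_cong) auto
  have one: "kron_list (\<lambda>i. 1\<^sub>m (?d i)) ?is = 1\<^sub>m n"
    using kron_list_mat_diag[of ?d "\<lambda>_ _. 1" ?is] unfolding mapd n_def by simp
  have "transpose_mat Q * Q = kron_list (\<lambda>i. transpose_mat (H i) * H i) ?is"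
    unfolding Q_def kron_list_transpose using H(1) by (intro kron_list_mult[where d = ?d]) auto
  also have "\<dots> = 1\<^sub>m n" unfolding one[symmetric] by (rule cong) (simp add: H(2))
  finally have QQ: "transpose_mat Q * Q = 1\<^sub>m n" .
  have "Q $$ (i, 0) = 1 / sqrt (real n)" if "i < n" for i
  proof -
    have prod: "prod_list (map (\<lambda>x. 1 / sqrt (real x)) xs) = 1 / sqrt (real (prod_list xs))" for xs
      by (induction xs) (simp_all add: real_sqrt_mult)
    have "Q $$ (i, 0) = prod_list (map (\<lambda>i. 1 / sqrt (real (?d i))) ?is)"
      unfolding Q_def using that H(1,3) by (intro kron_list_column_0[where d = ?d]) (auto simp: mapd n_def)
    also have "map (\<lambda>i. 1 / sqrt (real (?d i))) ?is = map (\<lambda>x. 1 / sqrt (real x)) (map ?d ?is)"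
      by simp
    finally show ?thesis unfolding mapd prod n_def .
  qed
  moreover have "factor_proj ns j \<in> carrier_mat n n \<and>
       factor_proj ns j * Q = Q * mat_diag n (\<lambda>a. if one_factor ns j a then 1 else 0)"
    if j: "j < length ns" for j
  proof -
    define A where "A i = (if i = j then 1\<^sub>m (?d i) else avg_mat (?d i))" for i
    define f where "f i a = (if i = j \<or> a = 0 then 1 else 0 :: real)" for i a :: nat
    have fp: "factor_proj ns j = kron_list A ?is" by (simp add: factor_proj_def kron_list_def A_def[abs_def])
    have Ac: "A i \<in> carrier_mat (?d i) (?d i)" for i by (simp add: A_def avg_mat_def)
    have AH: "A i * H i = H i * mat_diag (?d i) (f i)" if "i < length ns" for i
      using H[OF that] avg_mat_mult_orthogonal[OF H[OF that]] by (cases "i = j") (simp_all add: A_def f_def[abs_def])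
    have diag: "kron_list (\<lambda>i. mat_diag (?d i) (f i)) ?is = mat_diag n (\<lambda>a. if one_factor ns j a then 1 else 0)"
    proof -
      have "(\<Prod>l<length ?is. f (?is ! l) (digit (map ?d ?is) l a)) = (if one_factor ns j a then 1 else 0)" for a
        by (auto simp: mapd one_factor_def f_def intro!: prod.neutral prod_zero)
      then show ?thesis unfolding kron_list_mat_diag mapd n_def by simp
    qed
    have "factor_proj ns j * Q = kron_list (\<lambda>i. A i * H i) ?is"
      unfolding fp Q_def using H(1) Ac by (intro kron_list_mult[where d = ?d]) auto
    also have "\<dots> = kron_list (\<lambda>i. H i * mat_diag (?d i) (f i)) ?is" by (rule cong) (rule AH)
    also have "\<dots> = Q * kron_list (\<lambda>i. mat_diag (?d i) (f i)) ?is"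
      unfolding Q_def using H(1) by (intro kron_list_mult[where d = ?d, symmetric]) (auto simp: mat_diag_dim)
    finally show ?thesis using kron_list_carrier[of ?is A ?d] Ac unfolding diag fp mapd n_def by simp
  qed
  ultimately show ?thesis using Q QQ unfolding eigenbasis_def n_def by blast
qed

section \<open>The eigenspaces of the crossed design\<close>

text \<open>The blocks of eigenvector indices on which the restricted covariance is scalar: one for each factor
(\<open>j < length ns\<close>) and the remaining indices for \<open>j = length ns\<close>. Index 0, the
constant vector, belongs to none.\<close>

definition effect_class :: "nat list \<Rightarrow> nat \<Rightarrow> nat set" where
  "effect_class ns j = {a \<in> {1..<prod_list ns}.
     if j < length ns then one_factor ns j a else \<forall>i<length ns. \<not> one_factor ns i a}"

lemma finite_effect_class [simp]: "finite (effect_class ns j)"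
  by (simp add: effect_class_def)

lemma one_factor_unique:
  assumes "\<And>m. m \<in> set ns \<Longrightarrow> 0 < m" "a < prod_list ns" "0 < a" "one_factor ns i a" "one_factor ns j a"
  shows "i = j"
proof (rule ccontr)
  assume "i \<noteq> j"
  then have "digit ns l a = 0" if "l < length ns" for l
    using assms(4,5) that by (cases "l = i") (auto simp: one_factor_def)
  with all_digits_0[of ns a] assms show False by auto
qed

lemma effect_class_disjoint:
  assumes "\<And>m. m \<in> set ns \<Longrightarrow> 0 < m"
  shows "disjoint_family_on (effect_class ns) {..length ns}"
  unfolding disjoint_family_on_def
proof (intro ballI impI equals0I)
  fix i j a assume ij: "i \<in> {..length ns}" "j \<in> {..length ns}" "i \<noteq> j"
    and "a \<in> effect_class ns i \<inter> effect_class ns j"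
  then have a: "a \<in> effect_class ns i" "a \<in> effect_class ns j" by auto
  then have "a < prod_list ns" "0 < a" by (auto simp: effect_class_def)
  from one_factor_unique[OF assms this] a ij show False
    by (cases "i < length ns"; cases "j < length ns") (auto simp: effect_class_def)
qed

lemma effect_class_Union: "(\<Union>j\<in>{..length ns}. effect_class ns j) = {1..<prod_list ns}"
proof (intro equalityI subsetI)
  fix a assume a: "a \<in> {1..<prod_list ns}"
  show "a \<in> (\<Union>j\<in>{..length ns}. effect_class ns j)"
  proof (cases "\<exists>j<length ns. one_factor ns j a")
    case True
    then obtain j where "j < length ns" "one_factor ns j a" by blast
    with a show ?thesis by (intro UN_I[of j]) (auto simp: effect_class_def)
  next
    case False
    with a show ?thesis by (intro UN_I[of "length ns"]) (auto simp: effect_class_def)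
  qed
qed (auto simp: effect_class_def)

text \<open>The values \<open>1..c\<close> of a single digit give \<open>c\<close> distinct members of the block of a
factor. For the residual block, digit 0 takes these values while digit 1 equals 1; this is where a second
factor is required.\<close>

lemma card_effect_class_ge:
  assumes len: "2 \<le> length ns" and big: "\<And>m. m \<in> set ns \<Longrightarrow> c < m" and c: "0 < c" and j: "j \<le> length ns"
  shows "c \<le> card (effect_class ns j)"
proof -
  define dg where "dg b l = (if j < length ns then if l = j then b else 0
    else if l = 0 then b else if l = 1 then 1 else 0)" for b l :: nat
  let ?g = "\<lambda>b. from_digits ns (dg b)"
  define t where "t = (if j < length ns then j else 0)"
  have t: "t < length ns" using len by (auto simp: t_def)
  have nth: "c < ns ! l" if "l < length ns" for l using big that by simp
  have dg: "dg b l < ns ! l" if "b \<in> {1..c}" "l < length ns" for b l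
    using nth[OF that(2)] that(1) c by (auto simp: dg_def)
  have dig: "digit ns l (?g b) = dg b l" if "b \<in> {1..c}" "l < length ns" for b l
    using that by (intro digit_from_digits dg)
  have dgt: "dg b t = b" for b by (auto simp: dg_def t_def)
  have inj: "inj_on ?g {1..c}"
  proof (rule inj_onI)
    fix x y assume "x \<in> {1..c}" "y \<in> {1..c}" "?g x = ?g y"
    then have "dg x t = dg y t" using dig[OF _ t] by metis
    then show "x = y" unfolding dgt .
  qed
  have "?g ` {1..c} \<subseteq> effect_class ns j"
  proof clarify
    fix b assume b: "b \<in> {1..c}"
    have less: "?g b < prod_list ns" using dg[OF b] by (intro from_digits_less)
    have "?g b \<noteq> 0"
    proof
      assume "?g b = 0"
      then have "dg b t = 0" using dig[OF b t] by simp
      then show False using b unfolding dgt by simp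
    qed
    moreover have "one_factor ns j (?g b)" if "j < length ns"
      using dig[OF b] that by (simp add: one_factor_def) (simp add: dg_def)
    moreover have "\<not> one_factor ns i (?g b)" if "\<not> j < length ns" "i < length ns" for i
    proof -
      define l where "l = (if i = 0 then 1 else 0 :: nat)"
      have l: "l < length ns" "l \<noteq> i" using len by (auto simp: l_def)
      have "dg b l \<noteq> 0" using b that by (auto simp: dg_def l_def)
      with l dig[OF b l(1)] show ?thesis by (auto simp: one_factor_def)
    qed
    ultimately show "?g b \<in> effect_class ns j" using less by (auto simp: effect_class_def)
  qed
  from card_mono[OF finite_effect_class this] show ?thesis unfolding card_image[OF inj] by simp
qed

section \<open>Conjugation by a contrast basis\<close>

text \<open>Eigenvalue, at the \<open>a\<close>-th vector of an eigenbasis, of the partial derivative of the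
covariance with respect to \<open>\<psi> $ j\<close>.\<close>

definition deriv_eigval :: "nat list \<Rightarrow> nat \<Rightarrow> nat \<Rightarrow> real" where
  "deriv_eigval ns j a =
     (if j < length ns then (if one_factor ns j a then real (n_except ns j) else 0) else 1)"

definition cov_eigval :: "nat list \<Rightarrow> real vec \<Rightarrow> nat \<Rightarrow> real" where
  "cov_eigval ns \<psi> a = (\<Sum>j\<le>length ns. \<psi> $ j * deriv_eigval ns j a)"

lemma cov_eigval_pos:
  assumes "\<psi> \<in> param_set (length ns + 1)"
  shows "0 < cov_eigval ns \<psi> a"
proof -
  have "0 \<le> (\<Sum>j<length ns. \<psi> $ j * deriv_eigval ns j a)"
    using assms by (intro sum_nonneg) (auto simp: param_set_def deriv_eigval_def)
  moreover have "cov_eigval ns \<psi> a = (\<Sum>j<length ns. \<psi> $ j * deriv_eigval ns j a) + \<psi> $ length ns"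
    by (simp add: cov_eigval_def deriv_eigval_def flip: lessThan_Suc_atMost)
  ultimately show ?thesis using assms by (auto simp: param_set_def)
qed

text \<open>Without its constant column 0, an eigenbasis is itself a contrast basis.\<close>

definition tail_cols :: "real mat \<Rightarrow> real mat" where
  "tail_cols Q = mat (dim_row Q) (dim_col Q - 1) (\<lambda>(i, j). Q $$ (i, Suc j))"

text \<open>The columns of \<open>V\<close> together with the normalized constant vector form a square matrix with
orthonormal columns, hence also with orthonormal rows.\<close>

lemma contrast_basis_projection:
  assumes V: "contrast_basis n V" and n: "0 < n"
  shows "V * transpose_mat V = 1\<^sub>m n - avg_mat n"
proof -
  from V have Vc: "V \<in> carrier_mat n (n - 1)" and VV: "transpose_mat V * V = 1\<^sub>m (n - 1)"
    and V1: "transpose_mat V *\<^sub>v ones n = 0\<^sub>v (n - 1)" by (auto simp: contrast_basis_def)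
  define u where "u = (1 / sqrt (real n)) "
  define Q where "Q = mat n n (\<lambda>(i, j). if j = 0 then u else V $$ (i, j - 1))"
  have Q: "Q \<in> carrier_mat n n" by (simp add: Q_def)
  have uu: "real n * (u * u) = 1" using n by (simp add: u_def)
  have col: "(\<Sum>k<n. V $$ (k, j)) = 0" if "j < n - 1" for j
    using arg_cong[OF V1, of "\<lambda>v. v $ j"] that Vc by (simp add: ones_def scalar_prod_def lessThan_atLeast0)
  have orth: "(\<Sum>k<n. V $$ (k, i) * V $$ (k, j)) = (if i = j then 1 else 0)" if "i < n - 1" "j < n - 1" for i j
    using arg_cong[OF VV, of "\<lambda>M. M $$ (i, j)"] that Vc by (simp add: scalar_prod_def lessThan_atLeast0)
  have "(transpose_mat Q * Q) $$ (i, j) = 1\<^sub>m n $$ (i, j)" if "i < n" "j < n" for i j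
  proof -
    have "(transpose_mat Q * Q) $$ (i, j) = (\<Sum>k<n. Q $$ (k, i) * Q $$ (k, j))"
      using that Q by (simp add: scalar_prod_def lessThan_atLeast0)
    also have "\<dots> = (if i = j then 1 else 0)"
    proof (cases "i = 0"; cases "j = 0")
      assume "i = 0" "j = 0"
      then show ?thesis using n uu by (simp add: Q_def)
    next
      assume "i = 0" "j \<noteq> 0"
      then show ?thesis using that col[of "j - 1"] by (simp add: Q_def flip: sum_distrib_left)
    next
      assume "i \<noteq> 0" "j = 0"
      then show ?thesis using that col[of "i - 1"] by (simp add: Q_def flip: sum_distrib_right)
    next
      assume "i \<noteq> 0" "j \<noteq> 0"
      then show ?thesis using that orth[of "i - 1" "j - 1"] by (auto simp: Q_def)
    qed
    finally show ?thesis using that by simp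
  qed
  then have "transpose_mat Q * Q = 1\<^sub>m n" using Q by (intro eq_matI) auto
  then have QQ: "Q * transpose_mat Q = 1\<^sub>m n" by (intro mat_mult_left_right_inverse[OF _ Q]) (use Q in auto)
  show ?thesis
  proof (rule eq_matI)
    fix i j assume "i < dim_row (1\<^sub>m n - avg_mat n)" "j < dim_col (1\<^sub>m n - avg_mat n)"
    then have ij: "i < n" "j < n" by (auto simp: avg_mat_def)
    have "1\<^sub>m n $$ (i, j) = (\<Sum>k<Suc (n - 1). Q $$ (i, k) * Q $$ (j, k))"
      using ij Q n by (simp add: scalar_prod_def lessThan_atLeast0 flip: QQ)
    also have "\<dots> = u * u + (\<Sum>k<n - 1. V $$ (i, k) * V $$ (j, k))"
      using ij by (subst sum.lessThan_Suc_shift) (simp add: Q_def)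
    also have "(\<Sum>k<n - 1. V $$ (i, k) * V $$ (j, k)) = (V * transpose_mat V) $$ (i, j)"
      using ij Vc by (simp add: scalar_prod_def lessThan_atLeast0)
    also have "u * u = avg_mat n $$ (i, j)" using ij by (simp add: u_def avg_mat_def)
    finally show "(V * transpose_mat V) $$ (i, j) = (1\<^sub>m n - avg_mat n) $$ (i, j)"
      using ij by (simp add: avg_mat_def)
  qed (use Vc in \<open>auto simp: avg_mat_def\<close>)
qed

lemma tail_cols_contrast_basis:
  assumes Q: "Q \<in> carrier_mat n n" "transpose_mat Q * Q = 1\<^sub>m n"
    and Q0: "\<forall>i<n. Q $$ (i, 0) = 1 / sqrt (real n)" and n: "0 < n"
  shows "contrast_basis n (tail_cols Q)"
  unfolding contrast_basis_def
proof (intro conjI)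
  have orth: "(\<Sum>k<n. Q $$ (k, i) * Q $$ (k, j)) = (if i = j then 1 else 0)" if "i < n" "j < n" for i j
    using arg_cong[OF Q(2), of "\<lambda>M. M $$ (i, j)"] that Q(1) by (simp add: scalar_prod_def lessThan_atLeast0)
  show W: "tail_cols Q \<in> carrier_mat n (n - 1)" using Q by (simp add: tail_cols_def)
  show "transpose_mat (tail_cols Q) * tail_cols Q = 1\<^sub>m (n - 1)"
  proof (rule eq_matI)
    fix i j assume "i < dim_row (1\<^sub>m (n - 1))" "j < dim_col (1\<^sub>m (n - 1) :: real mat)"
    then show "(transpose_mat (tail_cols Q) * tail_cols Q) $$ (i, j) = 1\<^sub>m (n - 1) $$ (i, j)"
      using orth[of "Suc i" "Suc j"] Q(1) by (simp add: tail_cols_def scalar_prod_def lessThan_atLeast0)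
  qed (use W in auto)
  show "transpose_mat (tail_cols Q) *\<^sub>v ones n = 0\<^sub>v (n - 1)"
  proof (rule eq_vecI)
    fix i assume "i < dim_vec (0\<^sub>v (n - 1))"
    then have i: "Suc i < n" by auto
    have "(\<Sum>k<n. Q $$ (k, 0) * Q $$ (k, Suc i)) = 0" using orth[of 0 "Suc i"] i by simp
    then have "1 / sqrt (real n) * (\<Sum>k<n. Q $$ (k, Suc i)) = 0" unfolding sum_distrib_left by (simp add: Q0)
    then have "(\<Sum>k<n. Q $$ (k, Suc i)) = 0" using n by simp
    then show "(transpose_mat (tail_cols Q) *\<^sub>v ones n) $ i = 0\<^sub>v (n - 1) $ i"
      using i Q(1) by (simp add: tail_cols_def ones_def scalar_prod_def lessThan_atLeast0)
  qed (use W in auto)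
qed

text \<open>Both \<open>V\<close> and the tail of the eigenbasis project on the contrast space, so they differ by an
orthogonal matrix \<open>U\<close> only. Therefore every restricted matrix is diagonal in the basis
\<open>U\<close>, whatever contrast basis is chosen.\<close>

lemma contrast_conjugation:
  assumes V: "contrast_basis n V" and Q: "Q \<in> carrier_mat n n" "transpose_mat Q * Q = 1\<^sub>m n"
    and Q0: "\<forall>i<n. Q $$ (i, 0) = 1 / sqrt (real n)" and n: "0 < n"
  defines "U \<equiv> transpose_mat V * tail_cols Q"
  shows "U \<in> carrier_mat (n - 1) (n - 1)" "transpose_mat U * U = 1\<^sub>m (n - 1)"
    "U * transpose_mat (tail_cols Q) = transpose_mat V"
    "\<And>M f. M \<in> carrier_mat n n \<Longrightarrow> M * Q = Q * mat_diag n f \<Longrightarrow>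
       transpose_mat V * M * V = orth_diag (n - 1) U (\<lambda>i. f (Suc i))"
proof -
  define W where "W = tail_cols Q"
  have Wb: "contrast_basis n W" unfolding W_def by (rule tail_cols_contrast_basis[OF Q Q0 n])
  have Vc: "V \<in> carrier_mat n (n - 1)" and VV: "transpose_mat V * V = 1\<^sub>m (n - 1)"
    and Wc: "W \<in> carrier_mat n (n - 1)" and WW: "transpose_mat W * W = 1\<^sub>m (n - 1)"
    using V Wb by (auto simp: contrast_basis_def)
  have proj: "W * transpose_mat W = V * transpose_mat V"
    using contrast_basis_projection[OF V n] contrast_basis_projection[OF Wb n] by simp
  have U: "U = transpose_mat V * W" by (simp add: U_def W_def)
  show Uc: "U \<in> carrier_mat (n - 1) (n - 1)" using Vc Wc unfolding U by (intro carrier_matI) simp_all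
  have UT: "transpose_mat U = transpose_mat W * V"
    using Vc Wc by (simp add: U transpose_mult[of _ "n - 1" n _ "n - 1"])
  show UW: "U * transpose_mat (tail_cols Q) = transpose_mat V"
  proof -
    have "U * transpose_mat W = transpose_mat V * (W * transpose_mat W)"
      using Vc Wc by (simp add: U assoc_mult_mat_dim)
    also have "\<dots> = (transpose_mat V * V) * transpose_mat V"
      unfolding proj using Vc by (simp add: assoc_mult_mat_dim)
    finally show ?thesis using Vc by (simp add: VV W_def)
  qed
  have "transpose_mat U * U = transpose_mat W * ((V * transpose_mat V) * W)"
    unfolding UT unfolding U using Vc Wc by (simp add: assoc_mult_mat_dim)
  also have "\<dots> = (transpose_mat W * W) * (transpose_mat W * W)"
    unfolding proj[symmetric] using Wc by (simp add: assoc_mult_mat_dim)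
  finally show "transpose_mat U * U = 1\<^sub>m (n - 1)" by (simp add: WW)
  fix M f assume M: "M \<in> carrier_mat n n" and MQ: "M * Q = Q * mat_diag n f"
  have MW: "M * W = W * mat_diag (n - 1) (\<lambda>i. f (Suc i))"
  proof (rule eq_matI)
    fix i j assume "i < dim_row (W * mat_diag (n - 1) (\<lambda>i. f (Suc i)))"
      "j < dim_col (W * mat_diag (n - 1) (\<lambda>i. f (Suc i)))"
    then have ij: "i < n" "Suc j < n" "j < n - 1" using Wc by auto
    have "(M * W) $$ (i, j) = (M * Q) $$ (i, Suc j)"
      using ij M Q(1) by (simp add: W_def tail_cols_def scalar_prod_def)
    also have "\<dots> = (W * mat_diag (n - 1) (\<lambda>i. f (Suc i))) $$ (i, j)"
      unfolding MQ mat_diag_mult_right[OF Q(1)] mat_diag_mult_right[OF Wc]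
      using ij Q(1) by (simp add: W_def tail_cols_def)
    finally show "(M * W) $$ (i, j) = (W * mat_diag (n - 1) (\<lambda>i. f (Suc i))) $$ (i, j)" .
  qed (use M Wc in auto)
  have "orth_diag (n - 1) U (\<lambda>i. f (Suc i)) = transpose_mat V * (W * mat_diag (n - 1) (\<lambda>i. f (Suc i))) * transpose_mat W * V"
    unfolding orth_diag_def UT unfolding U using Vc Wc by (simp add: assoc_mult_mat_dim)
  also have "\<dots> = transpose_mat V * M * (W * transpose_mat W) * V"
    unfolding MW[symmetric] using Vc Wc M by (simp add: assoc_mult_mat_dim)
  also have "\<dots> = transpose_mat V * M * V * (transpose_mat V * V)"
    unfolding proj using Vc M by (simp add: assoc_mult_mat_dim)
  finally show "transpose_mat V * M * V = orth_diag (n - 1) U (\<lambda>i. f (Suc i))"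
    using Vc M by (simp add: VV right_mult_one_mat' )
qed

section \<open>The statistic as a sum of squared standardized chi-squares\<close>

lemma deriv_mat_eigenbasis:
  assumes Q: "eigenbasis ns Q"
  defines "n \<equiv> prod_list ns"
  shows "mat n n (\<lambda>ab. if j < length ns then real (n_except ns j) * factor_proj ns j $$ ab else 1\<^sub>m n $$ ab) * Q
    = Q * mat_diag n (deriv_eigval ns j)" (is "?D * Q = _")
proof (rule eq_matI)
  have Qc: "Q \<in> carrier_mat n n" using Q by (simp add: eigenbasis_def n_def)
  fix a b assume "a < dim_row (Q * mat_diag n (deriv_eigval ns j))" "b < dim_col (Q * mat_diag n (deriv_eigval ns j))"
  then have ab: "a < n" "b < n" using Qc by auto
  show "(?D * Q) $$ (a, b) = (Q * mat_diag n (deriv_eigval ns j)) $$ (a, b)"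
  proof (cases "j < length ns")
    case True
    then have F: "factor_proj ns j \<in> carrier_mat n n"
      and FQ: "factor_proj ns j * Q = Q * mat_diag n (\<lambda>a. if one_factor ns j a then 1 else 0)"
      using Q by (auto simp: eigenbasis_def n_def)
    have "(?D * Q) $$ (a, b) = real (n_except ns j) * (factor_proj ns j * Q) $$ (a, b)"
      using True ab F Qc by (simp add: scalar_prod_def sum_distrib_left mult.assoc)
    also have "\<dots> = (Q * mat_diag n (deriv_eigval ns j)) $$ (a, b)"
      unfolding FQ mat_diag_mult_right[OF Qc] using ab True by (simp add: deriv_eigval_def)
    finally show ?thesis .
  next
    case False
    have "?D = 1\<^sub>m n" using False by (intro eq_matI) auto
    then show ?thesis unfolding mat_diag_mult_right[OF Qc] using ab False Qc by (simp add: deriv_eigval_def)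
  qed
qed (use Q in \<open>auto simp: eigenbasis_def n_def\<close>)

lemma model_cov_eigenbasis:
  assumes Q: "eigenbasis ns Q"
  defines "n \<equiv> prod_list ns"
  shows "model_cov ns \<psi> * Q = Q * mat_diag n (cov_eigval ns \<psi>)"
proof (rule eq_matI)
  have Qc: "Q \<in> carrier_mat n n" using Q by (simp add: eigenbasis_def n_def)
  let ?D = "\<lambda>j. mat n n (\<lambda>ab. if j < length ns then real (n_except ns j) * factor_proj ns j $$ ab else 1\<^sub>m n $$ ab)"
  fix a b assume "a < dim_row (Q * mat_diag n (cov_eigval ns \<psi>))" "b < dim_col (Q * mat_diag n (cov_eigval ns \<psi>))"
  then have ab: "a < n" "b < n" using Qc by auto
  have cov: "model_cov ns \<psi> $$ (a, c) = (\<Sum>j\<le>length ns. \<psi> $ j * ?D j $$ (a, c))" if "c < n" for c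
    using ab that by (simp add: model_cov_def n_def mult.assoc flip: lessThan_Suc_atMost)
  have "(model_cov ns \<psi> * Q) $$ (a, b) = (\<Sum>c<n. model_cov ns \<psi> $$ (a, c) * Q $$ (c, b))"
    using ab Qc by (simp add: model_cov_def scalar_prod_def lessThan_atLeast0 flip: n_def)
  also have "\<dots> = (\<Sum>c<n. \<Sum>j\<le>length ns. \<psi> $ j * (?D j $$ (a, c) * Q $$ (c, b)))"
    by (intro sum.cong refl) (simp add: cov sum_distrib_right mult.assoc del: index_mat)
  also have "\<dots> = (\<Sum>j\<le>length ns. \<psi> $ j * (\<Sum>c<n. ?D j $$ (a, c) * Q $$ (c, b)))"
    by (subst sum.swap) (simp add: sum_distrib_left)
  also have "\<dots> = (\<Sum>j\<le>length ns. \<psi> $ j * (?D j * Q) $$ (a, b))"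
    using ab Qc by (intro sum.cong refl arg_cong2[of _ _ _ _ "(*)"]) (simp add: scalar_prod_def lessThan_atLeast0)
  also have "\<dots> = (Q * mat_diag n (cov_eigval ns \<psi>)) $$ (a, b)"
    using ab unfolding deriv_mat_eigenbasis[OF Q, folded n_def] mat_diag_mult_right[OF Qc]
    by (simp add: cov_eigval_def sum_distrib_left mult_ac)
  finally show "(model_cov ns \<psi> * Q) $$ (a, b) = (Q * mat_diag n (cov_eigval ns \<psi>)) $$ (a, b)" .
qed (use Q in \<open>auto simp: eigenbasis_def n_def model_cov_def\<close>)

text \<open>The coordinate of \<open>y\<close> along the \<open>a\<close>-th eigenvector, divided by its standard
deviation.\<close>

definition std_contrast :: "nat list \<Rightarrow> real mat \<Rightarrow> real vec \<Rightarrow> real vec \<Rightarrow> nat \<Rightarrow> real" where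
  "std_contrast ns Q \<psi> y a = (\<Sum>b<prod_list ns. Q $$ (b, a) * y $ b) / sqrt (cov_eigval ns \<psi> a)"

lemma sum_effect_classes:
  fixes f :: "nat \<Rightarrow> real"
  assumes "\<And>m. m \<in> set ns \<Longrightarrow> 0 < m"
  shows "(\<Sum>i<prod_list ns - 1. f (Suc i)) = (\<Sum>l\<le>length ns. \<Sum>a\<in>effect_class ns l. f a)"
proof -
  have "(\<Sum>i<prod_list ns - 1. f (Suc i)) = sum f {1..<prod_list ns}"
    by (rule sum.reindex_bij_witness[where i = "\<lambda>a. a - 1" and j = Suc]) auto
  also have "\<dots> = sum f (\<Union>l\<in>{..length ns}. effect_class ns l)" by (simp add: effect_class_Union)
  also have "\<dots> = (\<Sum>l\<le>length ns. \<Sum>a\<in>effect_class ns l. f a)"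
    using effect_class_disjoint[OF assms] by (intro sum.UNION_disjoint) (auto simp: disjoint_family_on_def)
  finally show ?thesis .
qed

text \<open>On the block \<open>l\<close> all eigenvalues are constant, so both score and information only involve
the block sums of squares. The factor \<open>G\<close> is lower triangular, because the derivative with
respect to the variance of a factor vanishes outside the block of this factor, and only the last row, for
the error variance, meets all blocks.\<close>

lemma restr_score_stat_eq:
  assumes pos: "\<And>m. m \<in> set ns \<Longrightarrow> 0 < m" and V: "contrast_basis (prod_list ns) V" and Q: "eigenbasis ns Q"
    and \<psi>: "\<psi> \<in> param_set (length ns + 1)" and y: "y \<in> carrier_vec (prod_list ns)"
    and ne: "\<And>l. l \<le> length ns \<Longrightarrow> effect_class ns l \<noteq> {}"
  shows "restr_score_stat ns V \<psi> y =
    (\<Sum>l\<le>length ns. ((\<Sum>a\<in>effect_class ns l. (std_contrast ns Q \<psi> y a)\<^sup>2 - 1)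
       / sqrt (2 * real (card (effect_class ns l))))\<^sup>2)"
proof -
  define n m L where "n = prod_list ns" and "m = n - 1" and "L = length ns"
  have n0: "0 < n" unfolding n_def using pos by (induction ns) auto
  note V = V[folded n_def]
  have Qc: "Q \<in> carrier_mat n n" and QQ: "transpose_mat Q * Q = 1\<^sub>m n"
    and Q0: "\<forall>i<n. Q $$ (i, 0) = 1 / sqrt (real n)" using Q by (auto simp: eigenbasis_def n_def)
  have Vc: "V \<in> carrier_mat n m" using V by (simp add: contrast_basis_def m_def)
  have \<psi>c: "\<psi> \<in> carrier_vec (L + 1)" using \<psi> by (simp add: param_set_def L_def)
  define U where "U = transpose_mat V * tail_cols Q"
  note conj = contrast_conjugation[OF V Qc QQ Q0 n0, folded U_def m_def]
  note U = conj(1,2)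
  define d where "d = cov_eigval ns \<psi>"
  have d: "0 < d a" for a unfolding d_def by (rule cov_eigval_pos[OF \<psi>])
  define g where "g j a = deriv_eigval ns j a / d a" for j a
  have cov: "restr_cov ns V \<psi> = orth_diag m U (\<lambda>i. d (Suc i))"
    unfolding restr_cov_def d_def
    by (rule conj(4)[OF _ model_cov_eigenbasis[OF Q, folded n_def]]) (simp add: model_cov_def n_def)
  have isq: "psd_inv_sqrt (restr_cov ns V \<psi>) = orth_diag m U (\<lambda>i. 1 / sqrt (d (Suc i)))"
    unfolding cov by (rule psd_inv_sqrt_orth_diag[OF U d])
  have A: "restr_A ns V \<psi> j = orth_diag m U (\<lambda>i. g j (Suc i))" if "j < L + 1" for j
  proof -
    have "restr_cov_deriv ns V \<psi> j = orth_diag m U (\<lambda>i. deriv_eigval ns j (Suc i))"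
      unfolding restr_cov_deriv_eq[OF Vc[unfolded n_def] \<psi>c[unfolded L_def] that[unfolded L_def]] n_def[symmetric]
      by (rule conj(4)[OF _ deriv_mat_eigenbasis[OF Q, folded n_def]]) simp
    then show ?thesis unfolding restr_A_def isq g_def
      by (simp only: orth_diag_mult[OF U], intro orth_diag_cong[OF U]) (simp add: abs_of_pos[OF d])
  qed
  define z where "z = std_contrast ns Q \<psi> y"
  define zv where "zv = vec m (\<lambda>i. z (Suc i))"
  have zv: "zv \<in> carrier_vec m" by (simp add: zv_def)
  have R: "restr_resid ns V \<psi> y = U *\<^sub>v zv"
  proof -
    define W where "W = tail_cols Q"
    have Wc: "W \<in> carrier_mat n m" using Qc by (simp add: W_def tail_cols_def m_def)
    have Wy: "transpose_mat W *\<^sub>v y = vec m (\<lambda>i. \<Sum>b<n. Q $$ (b, Suc i) * y $ b)"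
      using Wc y Qc by (intro eq_vecI)
        (auto simp: W_def tail_cols_def scalar_prod_def lessThan_atLeast0 n_def m_def)
    have "transpose_mat V *\<^sub>v y = U *\<^sub>v (transpose_mat W *\<^sub>v y)"
      unfolding conj(3)[symmetric] W_def[symmetric] using U(1) Wc y
      by (subst assoc_mult_mat_vec_dim) (auto simp: n_def)
    then have "restr_resid ns V \<psi> y = U *\<^sub>v vec m (\<lambda>i. 1 / sqrt (d (Suc i)) * (transpose_mat W *\<^sub>v y) $ i)"
      unfolding restr_resid_def isq using Wc by (simp add: orth_diag_mult_vec[OF U] carrier_vecI)
    also have "vec m (\<lambda>i. 1 / sqrt (d (Suc i)) * (transpose_mat W *\<^sub>v y) $ i) = zv"
      unfolding Wy zv_def z_def by (intro eq_vecI) (auto simp: std_contrast_def n_def d_def)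
    finally show ?thesis .
  qed
  define C where "C = effect_class ns"
  define mm where "mm l = real (card (C l))" for l
  have mm: "0 < mm l" if "l \<le> L" for l
    using ne[of l] that by (simp add: mm_def C_def L_def card_gt_0_iff)
  have classes: "(\<Sum>i<m. f (Suc i)) = (\<Sum>l\<le>L. \<Sum>a\<in>C l. f a)" for f :: "nat \<Rightarrow> real"
    unfolding m_def n_def L_def C_def by (rule sum_effect_classes) (rule pos)
  \<comment> \<open>the value of the covariance eigenvalue \<open>d\<close> on the block \<open>l\<close>\<close>
  define lam where "lam l = (if l < L then \<psi> $ l * real (n_except ns l) else 0) + \<psi> $ L" for l
  \<comment> \<open>the value on the block \<open>l\<close> of the eigenvalue \<open>g j\<close> of the matrix \<open>restr_A ns V \<psi> j\<close>\<close>
  define \<gamma> where "\<gamma> j l = (if j < L then (if l = j then real (n_except ns j) else 0) else 1) / lam l" for j l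
  have on_class: "deriv_eigval ns j a = (if j < L then (if l = j then real (n_except ns j) else 0) else 1)"
    if "a \<in> C l" "l \<le> L" "j \<le> L" for a j l
  proof -
    have a: "a < n" "0 < a" and l: "if l < L then one_factor ns l a else \<forall>i<L. \<not> one_factor ns i a"
      using that by (auto simp: C_def effect_class_def n_def L_def)
    have "one_factor ns j a \<longleftrightarrow> l = j" if "j < L"
      using l that one_factor_unique[OF pos a(1)[unfolded n_def] a(2)] by (auto split: if_splits)
    then show ?thesis by (auto simp: deriv_eigval_def L_def)
  qed
  have d_class: "d a = lam l" if "a \<in> C l" "l \<le> L" for a l
  proof -
    have "d a = (\<Sum>j<L. \<psi> $ j * deriv_eigval ns j a) + \<psi> $ L * deriv_eigval ns L a"
      by (simp add: d_def cov_eigval_def L_def flip: lessThan_Suc_atMost)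
    also have "(\<Sum>j<L. \<psi> $ j * deriv_eigval ns j a) = (\<Sum>j<L. if l = j then \<psi> $ j * real (n_except ns j) else 0)"
      using on_class[OF that] by (intro sum.cong) auto
    finally show ?thesis using on_class[OF that, of L] by (simp add: lam_def)
  qed
  have g_class: "g j a = \<gamma> j l" if "a \<in> C l" "l \<le> L" "j \<le> L" for a j l
    unfolding g_def \<gamma>_def by (simp only: on_class[OF that] d_class[OF that(1,2)])
  have lam: "0 < lam l" if l: "l \<le> L" for l
  proof -
    obtain a where "a \<in> C l" using ne[of l] l by (auto simp: C_def L_def)
    from d_class[OF this l] d[of a] show ?thesis by simp
  qed
  define G where "G = mat (L + 1) (L + 1) (\<lambda>(j, l). \<gamma> j l * sqrt (mm l / 2))"
  define w where "w = vec (L + 1) (\<lambda>l. (\<Sum>a\<in>C l. (z a)\<^sup>2 - 1) / sqrt (2 * mm l))"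
  have Gc: "G \<in> carrier_mat (L + 1) (L + 1)" by (simp add: G_def)
  have wc: "w \<in> carrier_vec (L + 1)" by (simp add: w_def)
  have set: "{..<L + 1} = {..L}" by auto
  have half: "sqrt (mm l / 2) * (x / sqrt (2 * mm l)) = x / 2" if "l \<le> L" for l x
    using mm[OF that] by (simp add: real_sqrt_mult real_sqrt_divide field_simps)
  have sqm: "sqrt (mm l / 2) * sqrt (mm l / 2) = mm l / 2" if "l \<le> L" for l
    using mm[OF that] by simp
  have score: "restr_score ns V \<psi> y = G *\<^sub>v w"
  proof (rule eq_vecI)
    fix j assume "j < dim_vec (G *\<^sub>v w)"
    then have j: "j < L + 1" "j \<le> L" using Gc by auto
    have "restr_score ns V \<psi> y $ j = ((\<Sum>i<m. g j (Suc i) * (z (Suc i))\<^sup>2) - (\<Sum>i<m. g j (Suc i))) / 2"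
      using j unfolding restr_score_def L_def[symmetric] R
      by (simp only: index_vec A orth_diag_quadratic_form[OF U zv] mat_trace_orth_diag[OF U]) (simp add: zv_def)
    also have "\<dots> = (\<Sum>i<m. g j (Suc i) * ((z (Suc i))\<^sup>2 - 1)) / 2"
      by (simp add: algebra_simps sum_subtractf)
    also have "\<dots> = (\<Sum>l\<le>L. \<Sum>a\<in>C l. g j a * ((z a)\<^sup>2 - 1)) / 2"
      unfolding classes[of "\<lambda>a. g j a * ((z a)\<^sup>2 - 1)"] ..
    also have "\<dots> = (\<Sum>l\<le>L. \<gamma> j l * (\<Sum>a\<in>C l. (z a)\<^sup>2 - 1)) / 2"
      using j by (intro arg_cong2[of _ _ _ _ "(/)"] sum.cong refl) (simp add: g_class sum_distrib_left)
    also have "\<dots> = (\<Sum>l\<le>L. \<gamma> j l * (\<Sum>a\<in>C l. (z a)\<^sup>2 - 1) / 2)"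
      by (rule sum_divide_distrib)
    also have "\<dots> = (\<Sum>l\<le>L. \<gamma> j l * sqrt (mm l / 2) * ((\<Sum>a\<in>C l. (z a)\<^sup>2 - 1) / sqrt (2 * mm l)))"
    proof (intro sum.cong refl)
      fix l assume "l \<in> {..L}"
      then have "l \<le> L" by simp
      from half[OF this] show "\<gamma> j l * (\<Sum>a\<in>C l. (z a)\<^sup>2 - 1) / 2 =
          \<gamma> j l * sqrt (mm l / 2) * ((\<Sum>a\<in>C l. (z a)\<^sup>2 - 1) / sqrt (2 * mm l))"
        by (simp only: mult.assoc)
    qed
    also have "\<dots> = (G *\<^sub>v w) $ j"
      using j unfolding set[symmetric] by (simp add: G_def w_def scalar_prod_def lessThan_atLeast0)
    finally show "restr_score ns V \<psi> y $ j = (G *\<^sub>v w) $ j" .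
  qed (simp add: restr_score_def G_def L_def)
  have info: "restr_info ns V \<psi> = G * transpose_mat G"
  proof (rule eq_matI)
    fix i j assume "i < dim_row (G * transpose_mat G)" "j < dim_col (G * transpose_mat G)"
    then have ij: "i < L + 1" "i \<le> L" "j < L + 1" "j \<le> L" using Gc by auto
    have "restr_info ns V \<psi> $$ (i, j) = (\<Sum>k<m. g i (Suc k) * g j (Suc k)) / 2"
      using ij unfolding restr_info_def L_def[symmetric]
      by (simp only: index_mat A orth_diag_mult[OF U] mat_trace_orth_diag[OF U] split)
    also have "\<dots> = (\<Sum>l\<le>L. \<Sum>a\<in>C l. g i a * g j a) / 2"
      unfolding classes[of "\<lambda>a. g i a * g j a"] ..
    also have "\<dots> = (\<Sum>l\<le>L. \<gamma> i l * \<gamma> j l * mm l) / 2"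
      using ij by (intro arg_cong2[of _ _ _ _ "(/)"] sum.cong refl) (simp add: g_class mm_def)
    also have "\<dots> = (\<Sum>l\<le>L. (\<gamma> i l * sqrt (mm l / 2)) * (\<gamma> j l * sqrt (mm l / 2)))"
    proof -
      have "\<gamma> i l * \<gamma> j l * mm l / 2 = (\<gamma> i l * sqrt (mm l / 2)) * (\<gamma> j l * sqrt (mm l / 2))" if "l \<le> L" for l
        using sqm[OF that] by (simp add: algebra_simps)
      then show ?thesis by (subst sum_divide_distrib, intro sum.cong refl) auto
    qed
    also have "\<dots> = (G * transpose_mat G) $$ (i, j)"
      using ij unfolding set[symmetric] by (simp add: G_def scalar_prod_def lessThan_atLeast0)
    finally show "restr_info ns V \<psi> $$ (i, j) = (G * transpose_mat G) $$ (i, j)" .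
  qed (simp_all add: restr_info_def G_def L_def)
  have "det G \<noteq> 0"
  proof -
    have "det G = prod_list (diag_mat G)"
      by (rule det_lower_triangular[OF _ Gc]) (auto simp: G_def \<gamma>_def)
    moreover have "0 < n_except ns j" for j
      unfolding n_except_def using pos by (intro prod_pos) auto
    then have "G $$ (j, j) \<noteq> 0" if "j < L + 1" for j
      using that mm[of j] lam[of j] by (auto simp: G_def \<gamma>_def)
    then have "0 \<notin> set (diag_mat G)" using Gc by (auto simp: diag_mat_def)
    ultimately show ?thesis by (simp add: prod_list_zero_iff)
  qed
  then have "restr_score_stat ns V \<psi> y = w \<bullet> w"
    unfolding restr_score_stat_def restr_std_score_def score info
    by (rule standardized_norm_eq[OF Gc wc])
  also have "\<dots> = (\<Sum>l\<le>L. (w $ l)\<^sup>2)" unfolding scalar_prod_self(1)[OF wc] set ..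
  finally show ?thesis by (simp add: w_def C_def mm_def L_def z_def)
qed

section \<open>Translation-invariant measures on coordinate space\<close>

abbreviation lebPi :: "nat set \<Rightarrow> (nat \<Rightarrow> real) measure" where
  "lebPi I \<equiv> PiM I (\<lambda>_. lborel)"

interpretation lebesgue_product: product_sigma_finite "\<lambda>_ :: nat. lborel :: real measure"
  by standard

lemma distr_lebPi_translate:
  assumes I: "finite I"
  shows "distr (lebPi I) (lebPi I) (\<lambda>x. \<lambda>i\<in>I. x i + v i) = lebPi I"
proof (rule lebesgue_product.PiM_eqI[OF I])
  have [measurable]: "(\<lambda>x. \<lambda>i\<in>I. x i + v i) \<in> measurable (lebPi I) (lebPi I)"
    by (intro measurable_restrict) measurable
  fix A assume A: "\<And>i. i \<in> I \<Longrightarrow> A i \<in> sets (lborel :: real measure)"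
  have "emeasure (distr (lebPi I) (lebPi I) (\<lambda>x. \<lambda>i\<in>I. x i + v i)) (Pi\<^sub>E I A)
      = emeasure (lebPi I) ((\<lambda>x. \<lambda>i\<in>I. x i + v i) -` Pi\<^sub>E I A \<inter> space (lebPi I))"
    using A I by (intro emeasure_distr) (auto intro!: sets_PiM_I_finite)
  also have "(\<lambda>x. \<lambda>i\<in>I. x i + v i) -` Pi\<^sub>E I A \<inter> space (lebPi I) = Pi\<^sub>E I (\<lambda>i. (\<lambda>x. v i + x) -` A i)"
    by (auto simp: space_PiM PiE_iff add.commute)
  also have "emeasure (lebPi I) \<dots> = (\<Prod>i\<in>I. emeasure lborel ((\<lambda>x. v i + x) -` A i))"
  proof (intro lebesgue_product.emeasure_PiM[OF I])
    fix i assume "i \<in> I"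
    then have "(+) (v i) -` A i \<inter> space borel \<in> sets borel"
      using A by (intro measurable_sets[of _ borel borel]) auto
    then show "(+) (v i) -` A i \<in> sets lborel" by simp
  qed
  also have "\<dots> = (\<Prod>i\<in>I. emeasure lborel (A i))"
  proof (intro prod.cong refl)
    fix i assume "i \<in> I"
    have "emeasure lborel (A i) = emeasure (distr lborel borel ((+) (v i))) (A i)"
      by (simp add: lborel_distr_plus)
    also have "\<dots> = emeasure lborel ((+) (v i) -` A i)"
      using A[OF \<open>i \<in> I\<close>] by (subst emeasure_distr) auto
    finally show "emeasure lborel ((+) (v i) -` A i) = emeasure lborel (A i)" ..
  qed
  finally show "emeasure (distr (lebPi I) (lebPi I) (\<lambda>x. \<lambda>i\<in>I. x i + v i)) (Pi\<^sub>E I A) = (\<Prod>i\<in>I. emeasure lborel (A i))" .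
qed simp

lemma nn_integral_lebPi_translate:
  assumes I: "finite I" and f: "f \<in> borel_measurable (lebPi I)"
  shows "(\<integral>\<^sup>+x. f (\<lambda>i\<in>I. x i + v i) \<partial>lebPi I) = (\<integral>\<^sup>+x. f x \<partial>lebPi I)"
proof -
  have [measurable]: "(\<lambda>x. \<lambda>i\<in>I. x i + v i) \<in> measurable (lebPi I) (lebPi I)"
    by (intro measurable_restrict) measurable
  have "(\<integral>\<^sup>+x. f x \<partial>lebPi I) = (\<integral>\<^sup>+x. f x \<partial>distr (lebPi I) (lebPi I) (\<lambda>x. \<lambda>i\<in>I. x i + v i))"
    by (simp add: distr_lebPi_translate[OF I])
  also have "\<dots> = (\<integral>\<^sup>+x. f (\<lambda>i\<in>I. x i + v i) \<partial>lebPi I)"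
    by (rule nn_integral_distr) (use f in auto)
  finally show ?thesis ..
qed

text \<open>Uniqueness of invariant measure, in Weil's form. In the double integral of \<open>f x * g y\<close>,
replace \<open>x\<close> by \<open>x + y\<close>, exchange the integrals, replace \<open>y\<close> by
\<open>y - x\<close>, exchange again and replace \<open>x\<close> by \<open>x + y\<close>.\<close>

lemma translation_invariant_nn_integral:
  assumes I: "finite I" and \<nu>: "sigma_finite_measure \<nu>" "sets \<nu> = sets (lebPi I)"
    and inv: "\<And>f v. f \<in> borel_measurable (lebPi I) \<Longrightarrow>
      (\<integral>\<^sup>+x. f (\<lambda>i\<in>I. x i + v i) \<partial>\<nu>) = (\<integral>\<^sup>+x. f x \<partial>\<nu>)"
    and f[measurable]: "f \<in> borel_measurable (lebPi I)" and g[measurable]: "g \<in> borel_measurable (lebPi I)"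
  shows "(\<integral>\<^sup>+x. f x \<partial>\<nu>) * (\<integral>\<^sup>+y. g y \<partial>lebPi I) = (\<integral>\<^sup>+y. f y \<partial>lebPi I) * (\<integral>\<^sup>+x. g (\<lambda>i\<in>I. - x i) \<partial>\<nu>)"
proof -
  let ?L = "lebPi I"
  have sp: "space \<nu> = space ?L" using \<nu>(2) by (rule sets_eq_imp_space_eq)
  have sf: "sigma_finite_measure ?L" by (rule lebesgue_product.sigma_finite[OF I])
  interpret pair_sigma_finite \<nu> ?L using \<nu>(1) sf by (rule pair_sigma_finite.intro)
  note [measurable_cong] = \<nu>(2)
  have plus[measurable]: "(\<lambda>(x, y). \<lambda>i\<in>I. x i + y i) \<in> measurable (?L \<Otimes>\<^sub>M ?L) ?L"
    unfolding split_beta' by (intro measurable_restrict) measurable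
  have minus[measurable]: "(\<lambda>(x, y). \<lambda>i\<in>I. y i - x i) \<in> measurable (?L \<Otimes>\<^sub>M ?L) ?L"
    unfolding split_beta' by (intro measurable_restrict) measurable
  have neg[measurable]: "(\<lambda>x. \<lambda>i\<in>I. - x i) \<in> measurable ?L ?L"
    by (intro measurable_restrict) measurable
  have pm[measurable]: "(\<lambda>(x, y). \<lambda>i\<in>I. x i + y i) \<in> measurable (\<nu> \<Otimes>\<^sub>M ?L) ?L"
    "(\<lambda>(x, y). \<lambda>i\<in>I. y i - x i) \<in> measurable (\<nu> \<Otimes>\<^sub>M ?L) ?L"
    using plus minus by (simp_all cong: measurable_cong_sets sets_pair_measure_cong add: \<nu>(2))
  have m1: "(\<lambda>(x, y). f (\<lambda>i\<in>I. x i + y i) * g y) \<in> borel_measurable (\<nu> \<Otimes>\<^sub>M ?L)"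
    using measurable_compose[OF pm(1) f] by (simp add: split_beta') measurable
  have m2: "(\<lambda>(x, y). f y * g (\<lambda>i\<in>I. y i - x i)) \<in> borel_measurable (\<nu> \<Otimes>\<^sub>M ?L)"
    using measurable_compose[OF pm(2) g] by (simp add: split_beta') measurable
  have f\<nu>: "f \<in> borel_measurable \<nu>" by measurable
  have gn: "(\<lambda>x. g (\<lambda>i\<in>I. - x i)) \<in> borel_measurable ?L" by measurable
  have "(\<integral>\<^sup>+x. f x \<partial>\<nu>) * (\<integral>\<^sup>+y. g y \<partial>?L) = (\<integral>\<^sup>+y. (\<integral>\<^sup>+x. f x \<partial>\<nu>) * g y \<partial>?L)"
    by (simp add: nn_integral_cmult)
  also have "\<dots> = (\<integral>\<^sup>+y. (\<integral>\<^sup>+x. f (\<lambda>i\<in>I. x i + y i) * g y \<partial>\<nu>) \<partial>?L)"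
  proof (rule nn_integral_cong)
    fix y
    have "(\<lambda>x. f (\<lambda>i\<in>I. x i + y i)) \<in> borel_measurable ?L"
      by (intro measurable_compose[OF _ f] measurable_restrict) measurable
    then have "(\<lambda>x. f (\<lambda>i\<in>I. x i + y i)) \<in> borel_measurable \<nu>" by (simp cong: measurable_cong_sets add: \<nu>(2))
    then show "(\<integral>\<^sup>+x. f x \<partial>\<nu>) * g y = (\<integral>\<^sup>+x. f (\<lambda>i\<in>I. x i + y i) * g y \<partial>\<nu>)"
      by (simp add: nn_integral_multc inv[OF f])
  qed
  also have "\<dots> = (\<integral>\<^sup>+x. (\<integral>\<^sup>+y. f (\<lambda>i\<in>I. x i + y i) * g y \<partial>?L) \<partial>\<nu>)"
    by (rule Fubini'[OF m1])
  also have "\<dots> = (\<integral>\<^sup>+x. (\<integral>\<^sup>+y. f y * g (\<lambda>i\<in>I. y i - x i) \<partial>?L) \<partial>\<nu>)"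
  proof (rule nn_integral_cong)
    fix x
    have "(\<lambda>y. f (\<lambda>i\<in>I. x i + y i)) \<in> borel_measurable ?L"
      by (intro measurable_compose[OF _ f] measurable_restrict) measurable
    then have "(\<lambda>y. f (\<lambda>i\<in>I. x i + y i) * g y) \<in> borel_measurable ?L" by measurable
    from nn_integral_lebPi_translate[OF I this, of "\<lambda>i. - x i"]
    have "(\<integral>\<^sup>+y. f (\<lambda>i\<in>I. x i + y i) * g y \<partial>?L) =
        (\<integral>\<^sup>+y. f (\<lambda>i\<in>I. x i + (\<lambda>i\<in>I. y i + - x i) i) * g (\<lambda>i\<in>I. y i + - x i) \<partial>?L)" ..
    also have "\<dots> = (\<integral>\<^sup>+y. f y * g (\<lambda>i\<in>I. y i - x i) \<partial>?L)"
    proof (rule nn_integral_cong)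
      fix y assume "y \<in> space ?L"
      then have "(\<lambda>i\<in>I. x i + (\<lambda>i\<in>I. y i + - x i) i) = y"
        by (auto simp: space_PiM PiE_def extensional_def fun_eq_iff)
      then show "f (\<lambda>i\<in>I. x i + (\<lambda>i\<in>I. y i + - x i) i) * g (\<lambda>i\<in>I. y i + - x i) = f y * g (\<lambda>i\<in>I. y i - x i)"
        by simp
    qed
    finally show "(\<integral>\<^sup>+y. f (\<lambda>i\<in>I. x i + y i) * g y \<partial>?L) = (\<integral>\<^sup>+y. f y * g (\<lambda>i\<in>I. y i - x i) \<partial>?L)" .
  qed
  also have "\<dots> = (\<integral>\<^sup>+y. (\<integral>\<^sup>+x. f y * g (\<lambda>i\<in>I. y i - x i) \<partial>\<nu>) \<partial>?L)"
    by (rule Fubini'[OF m2, symmetric])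
  also have "\<dots> = (\<integral>\<^sup>+y. f y * (\<integral>\<^sup>+x. g (\<lambda>i\<in>I. - x i) \<partial>\<nu>) \<partial>?L)"
  proof (rule nn_integral_cong)
    fix y
    have "(\<lambda>x. g (\<lambda>i\<in>I. y i - x i)) \<in> borel_measurable ?L"
      by (intro measurable_compose[OF _ g] measurable_restrict) measurable
    from inv[OF this, of y] have "(\<integral>\<^sup>+x. g (\<lambda>i\<in>I. y i - x i) \<partial>\<nu>) = (\<integral>\<^sup>+x. g (\<lambda>i\<in>I. y i - (\<lambda>i\<in>I. x i + y i) i) \<partial>\<nu>)" ..
    also have "\<dots> = (\<integral>\<^sup>+x. g (\<lambda>i\<in>I. - x i) \<partial>\<nu>)"
      by (intro nn_integral_cong arg_cong[where f = g]) auto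
    finally have "(\<integral>\<^sup>+x. g (\<lambda>i\<in>I. y i - x i) \<partial>\<nu>) = (\<integral>\<^sup>+x. g (\<lambda>i\<in>I. - x i) \<partial>\<nu>)" .
    moreover have "(\<lambda>x. g (\<lambda>i\<in>I. y i - x i)) \<in> borel_measurable \<nu>"
      using \<open>(\<lambda>x. g (\<lambda>i\<in>I. y i - x i)) \<in> borel_measurable ?L\<close> by (simp cong: measurable_cong_sets add: \<nu>(2))
    ultimately show "(\<integral>\<^sup>+x. f y * g (\<lambda>i\<in>I. y i - x i) \<partial>\<nu>) = f y * (\<integral>\<^sup>+x. g (\<lambda>i\<in>I. - x i) \<partial>\<nu>)"
      by (simp add: nn_integral_cmult)
  qed
  also have "\<dots> = (\<integral>\<^sup>+y. f y \<partial>?L) * (\<integral>\<^sup>+x. g (\<lambda>i\<in>I. - x i) \<partial>\<nu>)"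
    by (simp add: nn_integral_multc)
  finally show ?thesis .
qed

section \<open>Affine images of Gaussian vectors\<close>

lemma prob_space_std_normal: "prob_space std_normal_distribution"
  using real_dist_normal_dist by (simp add: real_distribution_def)

interpretation normal_product: product_sigma_finite "\<lambda>_ :: nat. std_normal_distribution"
proof (unfold product_sigma_finite_def, rule allI)
  interpret prob_space std_normal_distribution by (rule prob_space_std_normal)
  show "sigma_finite_measure std_normal_distribution" by unfold_locales
qed

text \<open>Standardization of a Gaussian vector whose density is \<open>c\<close> times the standard normal density
\<open>G\<close> at \<open>A x\<close>. The right inverse \<open>K'\<close> of \<open>K\<close> makes the
image \<open>\<nu>\<close> of Lebesgue measure under \<open>A\<close> translation invariant. Uniqueness
of invariant measure, applied to \<open>f * G\<close> and \<open>G\<close>, compares \<open>\<nu>\<close>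
with Lebesgue measure, and the unknown constants cancel because the density has total mass one.\<close>

lemma distr_affine_gaussian:
  fixes X :: "'a \<Rightarrow> nat \<Rightarrow> real" and K K' :: "nat \<Rightarrow> nat \<Rightarrow> real" and \<mu> :: "nat \<Rightarrow> real"
  assumes M: "prob_space M" and I: "finite I"
    and inv: "\<And>i l. i \<in> I \<Longrightarrow> l \<in> I \<Longrightarrow> (\<Sum>j\<in>I. K i j * K' j l) = (if i = l then 1 else 0)"
    and X[measurable]: "X \<in> measurable M (lebPi I)"
  defines "A \<equiv> \<lambda>x. \<lambda>i\<in>I. \<Sum>j\<in>I. K i j * (x j - \<mu> j)"
  assumes density: "distr M (lebPi I) X = density (lebPi I) (\<lambda>x. c * (\<Prod>i\<in>I. ennreal (std_normal_density (A x i))))"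
  shows "distr M (lebPi I) (\<lambda>\<omega>. A (X \<omega>)) = PiM I (\<lambda>_. std_normal_distribution)"
proof -
  interpret M: prob_space M by fact
  let ?L = "lebPi I"
  define G where "G z = (\<Prod>i\<in>I. ennreal (std_normal_density (z i)))" for z :: "nat \<Rightarrow> real"
  have A[measurable]: "A \<in> measurable ?L ?L"
    unfolding A_def by (intro measurable_restrict) measurable
  have G[measurable]: "G \<in> borel_measurable ?L" unfolding G_def by measurable
  define \<nu> where "\<nu> = distr ?L ?L A"
  have sets_\<nu>[measurable_cong]: "sets \<nu> = sets ?L" by (simp add: \<nu>_def)
  have space_\<nu>: "space \<nu> = space ?L" by (simp add: \<nu>_def)
  have inv_\<nu>: "(\<integral>\<^sup>+z. f (\<lambda>i\<in>I. z i + v i) \<partial>\<nu>) = (\<integral>\<^sup>+z. f z \<partial>\<nu>)" if f[measurable]: "f \<in> borel_measurable ?L" for f v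
  proof -
    \<comment> \<open>a preimage under \<open>K\<close> of the translation vector \<open>v\<close>\<close>
    define w where "w j = (\<Sum>l\<in>I. K' j l * v l)" for j
    have Kw: "(\<Sum>j\<in>I. K i j * w j) = v i" if "i \<in> I" for i
    proof -
      have "(\<Sum>j\<in>I. K i j * w j) = (\<Sum>l\<in>I. (\<Sum>j\<in>I. K i j * K' j l) * v l)"
        by (simp add: w_def sum_distrib_left sum_distrib_right mult.assoc) (rule sum.swap)
      also have "\<dots> = (\<Sum>l\<in>I. if i = l then v l else 0)" using inv that by (intro sum.cong) auto
      finally show ?thesis using that I by simp
    qed
    have tr[measurable]: "(\<lambda>z. \<lambda>i\<in>I. z i + v i) \<in> measurable ?L ?L"
      by (intro measurable_restrict) measurable
    have "(\<integral>\<^sup>+z. f (\<lambda>i\<in>I. z i + v i) \<partial>\<nu>) = (\<integral>\<^sup>+x. f (\<lambda>i\<in>I. A x i + v i) \<partial>?L)"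
      unfolding \<nu>_def by (rule nn_integral_distr) measurable
    also have "\<dots> = (\<integral>\<^sup>+x. f (A (\<lambda>i\<in>I. x i + w i)) \<partial>?L)"
    proof (rule nn_integral_cong)
      fix x
      have "(\<lambda>i\<in>I. A x i + v i) = A (\<lambda>i\<in>I. x i + w i)"
      proof (rule ext)
        fix i
        show "(\<lambda>i\<in>I. A x i + v i) i = A (\<lambda>i\<in>I. x i + w i) i"
        proof (cases "i \<in> I")
          case True
          have "(\<Sum>j\<in>I. K i j * (x j + w j - \<mu> j)) = (\<Sum>j\<in>I. K i j * (x j - \<mu> j)) + v i"
            unfolding Kw[OF True, symmetric] sum.distrib[symmetric] by (simp add: algebra_simps)
          then show ?thesis using True by (simp add: A_def)
        qed (simp add: A_def)
      qed
      then show "f (\<lambda>i\<in>I. A x i + v i) = f (A (\<lambda>i\<in>I. x i + w i))" by simp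
    qed
    also have "\<dots> = (\<integral>\<^sup>+x. f (A x) \<partial>?L)"
      by (rule nn_integral_lebPi_translate[OF I, of "\<lambda>x. f (A x)"]) measurable
    also have "\<dots> = (\<integral>\<^sup>+z. f z \<partial>\<nu>)" unfolding \<nu>_def by (rule nn_integral_distr[symmetric]) measurable
    finally show ?thesis .
  qed
  have law: "(\<integral>\<^sup>+\<omega>. f (A (X \<omega>)) \<partial>M) = c * (\<integral>\<^sup>+z. f z * G z \<partial>\<nu>)" if f[measurable]: "f \<in> borel_measurable ?L" for f
  proof -
    have "(\<integral>\<^sup>+\<omega>. f (A (X \<omega>)) \<partial>M) = (\<integral>\<^sup>+x. f (A x) \<partial>distr M ?L X)"
      by (rule nn_integral_distr[symmetric]) measurable
    also have "\<dots> = (\<integral>\<^sup>+x. (c * G (A x)) * f (A x) \<partial>?L)"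
      unfolding density G_def[symmetric] by (rule nn_integral_density) measurable
    also have "\<dots> = c * (\<integral>\<^sup>+x. f (A x) * G (A x) \<partial>?L)"
      by (simp add: mult.assoc mult.commute[of "G _"] nn_integral_cmult)
    also have "(\<integral>\<^sup>+x. f (A x) * G (A x) \<partial>?L) = (\<integral>\<^sup>+z. f z * G z \<partial>\<nu>)"
      unfolding \<nu>_def by (rule nn_integral_distr[symmetric]) measurable
    finally show ?thesis .
  qed
  have total: "c * (\<integral>\<^sup>+z. G z \<partial>\<nu>) = 1"
    using law[of "\<lambda>_. 1"] by (simp add: M.emeasure_space_1)
  then have fin: "(\<integral>\<^sup>+z. G z \<partial>\<nu>) \<noteq> \<infinity>"
    by (cases "c = 0") (auto simp: ennreal_mult_top)
  have Gpos: "0 < G z" for z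
    by (auto simp: G_def prod_ennreal normal_density_pos intro!: prod_pos)
  have sf: "sigma_finite_measure \<nu>"
  proof
    \<comment> \<open>\<open>G\<close> is positive and \<open>\<nu>\<close>-integrable, so its superlevel sets have finite measure and cover the space.\<close>
    define B where "B k = {z \<in> space \<nu>. 1 \<le> of_nat (Suc k) * G z}" for k :: nat
    have B: "B k \<in> sets \<nu>" for k unfolding B_def by measurable
    have finB: "emeasure \<nu> (B k) \<noteq> \<infinity>" for k
    proof -
      have "emeasure \<nu> (B k) = (\<integral>\<^sup>+z. indicator (B k) z \<partial>\<nu>)" using B by simp
      also have "\<dots> \<le> (\<integral>\<^sup>+z. of_nat (Suc k) * G z \<partial>\<nu>)"
        by (intro nn_integral_mono) (auto simp: B_def split: split_indicator)
      also have "\<dots> = of_nat (Suc k) * (\<integral>\<^sup>+z. G z \<partial>\<nu>)" by (rule nn_integral_cmult) measurable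
      also have "\<dots> < \<infinity>" using fin by (simp add: ennreal_mult_less_top less_top ennreal_of_nat_eq_real_of_nat)
      finally show ?thesis by simp
    qed
    have cov: "\<Union>(range B) = space \<nu>"
    proof
      show "space \<nu> \<subseteq> \<Union>(range B)"
      proof
        fix z assume z: "z \<in> space \<nu>"
        define p where "p = (\<Prod>i\<in>I. std_normal_density (z i))"
        have p: "0 < p" unfolding p_def by (intro prod_pos) (simp add: normal_density_pos)
        have Gp: "G z = ennreal p" unfolding G_def p_def by (intro prod_ennreal) (simp add: normal_density_nonneg)
        obtain k where "1 / p < real (Suc k)" using reals_Archimedean2[of "1 / p"] less_trans[of "1 / p" "real _" "real (Suc _)"] by (metis lessI of_nat_less_iff)
        then have "1 \<le> real (Suc k) * p" using p by (simp add: field_simps)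
        then have "1 \<le> of_nat (Suc k) * G z"
          unfolding Gp ennreal_of_nat_eq_real_of_nat using p
          by (subst ennreal_mult[symmetric]) (auto simp: ennreal_1[symmetric] intro!: ennreal_leI simp del: ennreal_1)
        with z show "z \<in> \<Union>(range B)" unfolding B_def by blast
      qed
    qed (auto simp: B_def)
    show "\<exists>A. countable A \<and> A \<subseteq> sets \<nu> \<and> \<Union>A = space \<nu> \<and> (\<forall>a\<in>A. emeasure \<nu> a \<noteq> \<infinity>)"
      using B finB cov by (intro exI[of _ "range B"]) auto
  qed
  have Gint: "(\<integral>\<^sup>+z. G z \<partial>?L) = 1"
  proof -
    have "(\<integral>\<^sup>+z. G z \<partial>?L) = (\<Prod>i\<in>I. (\<integral>\<^sup>+x. ennreal (std_normal_density x) \<partial>lborel))"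
      unfolding G_def by (rule lebesgue_product.product_nn_integral_prod[OF I]) measurable
    also have "(\<integral>\<^sup>+x. ennreal (std_normal_density x) \<partial>lborel) = emeasure std_normal_distribution UNIV"
      by (simp add: emeasure_density)
    also have "\<dots> = 1" using prob_space.emeasure_space_1[OF prob_space_std_normal] by simp
    finally show ?thesis by simp
  qed
  have Gneg: "(\<integral>\<^sup>+z. G (\<lambda>i\<in>I. - z i) \<partial>\<nu>) = (\<integral>\<^sup>+z. G z \<partial>\<nu>)"
  proof -
    have "G (\<lambda>i\<in>I. - z i) = G z" for z
      unfolding G_def by (intro prod.cong) (auto simp: normal_density_def)
    then show ?thesis by simp
  qed
  have main: "(\<integral>\<^sup>+\<omega>. f (A (X \<omega>)) \<partial>M) = (\<integral>\<^sup>+z. f z * G z \<partial>?L)" if f[measurable]: "f \<in> borel_measurable ?L" for f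
  proof -
    have fG: "(\<lambda>z. f z * G z) \<in> borel_measurable ?L" by measurable
    have "(\<integral>\<^sup>+z. f z * G z \<partial>\<nu>) * 1 = (\<integral>\<^sup>+z. f z * G z \<partial>?L) * (\<integral>\<^sup>+z. G z \<partial>\<nu>)"
      unfolding Gint[symmetric] Gneg[symmetric]
      by (rule translation_invariant_nn_integral[OF I sf sets_\<nu> _ fG G]) (rule inv_\<nu>)
    then have "(\<integral>\<^sup>+\<omega>. f (A (X \<omega>)) \<partial>M) = (\<integral>\<^sup>+z. f z * G z \<partial>?L) * (c * (\<integral>\<^sup>+z. G z \<partial>\<nu>))"
      unfolding law[OF f] by (simp add: mult_ac)
    then show ?thesis by (simp add: total)
  qed
  show ?thesis
  proof (rule normal_product.PiM_eqI[OF I])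
    show "sets (distr M ?L (\<lambda>\<omega>. A (X \<omega>))) = sets (PiM I (\<lambda>_. std_normal_distribution))"
      by (simp, intro sets_PiM_cong) auto
    fix B assume B': "\<And>i. i \<in> I \<Longrightarrow> B i \<in> sets std_normal_distribution"
    then have B: "\<And>i. i \<in> I \<Longrightarrow> B i \<in> sets borel" by simp
    have PB[measurable]: "Pi\<^sub>E I B \<in> sets ?L" using B I by (intro sets_PiM_I_finite) auto
    have "emeasure (distr M ?L (\<lambda>\<omega>. A (X \<omega>))) (Pi\<^sub>E I B) = (\<integral>\<^sup>+z. indicator (Pi\<^sub>E I B) z \<partial>distr M ?L (\<lambda>\<omega>. A (X \<omega>)))"
      using PB by simp
    also have "\<dots> = (\<integral>\<^sup>+\<omega>. indicator (Pi\<^sub>E I B) (A (X \<omega>)) \<partial>M)" by (rule nn_integral_distr) measurable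
    also have "\<dots> = (\<integral>\<^sup>+z. indicator (Pi\<^sub>E I B) z * G z \<partial>?L)" by (rule main) measurable
    also have "\<dots> = (\<integral>\<^sup>+z. (\<Prod>i\<in>I. ennreal (std_normal_density (z i)) * indicator (B i) (z i)) \<partial>?L)"
    proof (rule nn_integral_cong)
      fix z assume z: "z \<in> space ?L"
      have "indicator (Pi\<^sub>E I B) z = (\<Prod>i\<in>I. indicator (B i) (z i) :: ennreal)"
        using z I by (auto simp: space_PiM PiE_iff split: split_indicator intro!: prod_zero[symmetric] prod.neutral[symmetric])
      then show "indicator (Pi\<^sub>E I B) z * G z = (\<Prod>i\<in>I. ennreal (std_normal_density (z i)) * indicator (B i) (z i))"
        by (simp add: G_def prod.distrib mult.commute)
    qed
    also have "\<dots> = (\<Prod>i\<in>I. (\<integral>\<^sup>+x. ennreal (std_normal_density x) * indicator (B i) x \<partial>lborel))"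
      using B by (intro lebesgue_product.product_nn_integral_prod[OF I]) (auto intro!: borel_measurable_times_ennreal)
    also have "\<dots> = (\<Prod>i\<in>I. emeasure std_normal_distribution (B i))"
      using B by (intro prod.cong) (auto simp: emeasure_density)
    finally show "emeasure (distr M ?L (\<lambda>\<omega>. A (X \<omega>))) (Pi\<^sub>E I B) = (\<Prod>i\<in>I. emeasure std_normal_distribution (B i))" .
  qed
qed

definition iid_std_normal :: "'a measure \<Rightarrow> (nat \<Rightarrow> 'a \<Rightarrow> real) \<Rightarrow> nat set \<Rightarrow> bool" where
  "iid_std_normal M Z I \<longleftrightarrow> prob_space M \<and> prob_space.indep_vars M (\<lambda>_. borel) Z I \<and>
     (\<forall>i\<in>I. distr M borel (Z i) = std_normal_distribution)"

lemma iid_std_normalI: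
  assumes M: "prob_space M" and I: "I \<noteq> {}"
    and Z: "\<And>i. i \<in> I \<Longrightarrow> Z i \<in> borel_measurable M"
    and law: "distr M (PiM I (\<lambda>_. borel)) (\<lambda>\<omega>. \<lambda>i\<in>I. Z i \<omega>) = PiM I (\<lambda>_. std_normal_distribution)"
  shows "iid_std_normal M Z I"
proof -
  interpret M: prob_space M by fact
  have comp: "distr M borel (Z i) = std_normal_distribution" if i: "i \<in> I" for i
  proof -
    have [measurable]: "(\<lambda>\<omega>. \<lambda>i\<in>I. Z i \<omega>) \<in> measurable M (PiM I (\<lambda>_. borel))"
      using Z by (intro measurable_restrict) auto
    have "distr M borel (Z i) = distr M borel ((\<lambda>x. x i) \<circ> (\<lambda>\<omega>. \<lambda>i\<in>I. Z i \<omega>))"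
      using i by (intro distr_cong) auto
    also have "\<dots> = distr (distr M (PiM I (\<lambda>_. borel)) (\<lambda>\<omega>. \<lambda>i\<in>I. Z i \<omega>)) borel (\<lambda>x. x i)"
      using i by (intro distr_distr[symmetric]) measurable
    also have "\<dots> = distr (PiM I (\<lambda>_. std_normal_distribution)) std_normal_distribution (\<lambda>x. x i)"
      unfolding law by (intro distr_cong) auto
    also have "\<dots> = std_normal_distribution"
      by (rule distr_PiM_component) (use i prob_space_std_normal in auto)
    finally show ?thesis .
  qed
  have "M.indep_vars (\<lambda>_. borel) Z I"
  proof (subst M.indep_vars_iff_distr_eq_PiM'[OF I])
    show "distr M (PiM I (\<lambda>_. borel)) (\<lambda>\<omega>. \<lambda>i\<in>I. Z i \<omega>) = PiM I (\<lambda>i. distr M borel (Z i))"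
      unfolding law by (intro PiM_cong refl) (simp add: comp)
  qed (rule Z)
  with comp M show ?thesis by (simp add: iid_std_normal_def)
qed

section \<open>Standardized chi-square laws and their limit\<close>

lemma iid_std_normal_PiM:
  assumes "I \<noteq> {}"
  shows "iid_std_normal (PiM I (\<lambda>_. std_normal_distribution)) (\<lambda>i z. z i) I"
proof (rule iid_std_normalI[OF prob_space_PiM assms])
  show "prob_space std_normal_distribution" by (rule prob_space_std_normal)
  show "(\<lambda>z. z i) \<in> borel_measurable (PiM I (\<lambda>_. std_normal_distribution))" if "i \<in> I" for i
    using measurable_component_singleton[OF that, of "\<lambda>_. std_normal_distribution"] by simp
  have "distr (PiM I (\<lambda>_. std_normal_distribution)) (PiM I (\<lambda>_. borel)) (\<lambda>z. \<lambda>i\<in>I. z i)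
      = distr (PiM I (\<lambda>_. std_normal_distribution)) (PiM I (\<lambda>_. std_normal_distribution)) (\<lambda>z. z)"
    by (rule distr_cong) (auto simp: space_PiM PiE_def extensional_def intro!: sets_PiM_cong)
  then show "distr (PiM I (\<lambda>_. std_normal_distribution)) (PiM I (\<lambda>_. borel)) (\<lambda>z. \<lambda>i\<in>I. z i)
      = PiM I (\<lambda>_. std_normal_distribution)"
    by (simp add: distr_id)
qed

definition std_chi_square :: "nat \<Rightarrow> real measure" where
  "std_chi_square m = distr (PiM {..<m} (\<lambda>_. std_normal_distribution)) borel
     (\<lambda>z. (\<Sum>i<m. (z i)\<^sup>2 - 1) / sqrt (2 * real m))"

lemma iid_std_normal_measurable:
  assumes "iid_std_normal M Z I" "i \<in> I"
  shows "Z i \<in> borel_measurable M"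
proof -
  interpret prob_space M using assms by (simp add: iid_std_normal_def)
  show ?thesis using assms by (auto simp: iid_std_normal_def indep_vars_def)
qed

lemma iid_std_normal_subset:
  assumes "iid_std_normal M Z I" "J \<subseteq> I"
  shows "iid_std_normal M Z J"
proof -
  interpret prob_space M using assms by (simp add: iid_std_normal_def)
  show ?thesis using assms indep_vars_subset[of "\<lambda>_. borel" Z I J] by (auto simp: iid_std_normal_def)
qed

lemma char_sum_iid_std_normal:
  assumes Z: "iid_std_normal M Z J" and h[measurable]: "h \<in> borel_measurable borel"
  shows "char (distr M borel (\<lambda>\<omega>. \<Sum>i\<in>J. h (Z i \<omega>))) t = char (distr std_normal_distribution borel h) t ^ card J"
proof -
  interpret prob_space M using Z by (simp add: iid_std_normal_def)
  have ind: "indep_vars (\<lambda>_. borel) Z J" using Z by (simp add: iid_std_normal_def)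
  have "char (distr M borel (\<lambda>\<omega>. \<Sum>i\<in>J. h (Z i \<omega>))) t = (\<Prod>i\<in>J. char (distr M borel (\<lambda>\<omega>. h (Z i \<omega>))) t)"
    by (rule char_distr_sum[OF indep_vars_compose2[OF ind]]) simp
  also have "\<dots> = (\<Prod>i\<in>J. char (distr std_normal_distribution borel h) t)"
  proof (intro prod.cong refl)
    fix i assume i: "i \<in> J"
    have [measurable]: "Z i \<in> borel_measurable M" by (rule iid_std_normal_measurable[OF Z i])
    have "distr M borel (\<lambda>\<omega>. h (Z i \<omega>)) = distr (distr M borel (Z i)) borel h"
      by (subst distr_distr) (auto simp: comp_def)
    also have "distr M borel (Z i) = std_normal_distribution" using Z i by (simp add: iid_std_normal_def)
    finally show "char (distr M borel (\<lambda>\<omega>. h (Z i \<omega>))) t = char (distr std_normal_distribution borel h) t" by simp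
  qed
  finally show ?thesis by simp
qed

lemma real_distribution_distr:
  assumes "prob_space M" "X \<in> borel_measurable M"
  shows "real_distribution (distr M borel X)"
  using prob_space.prob_space_distr[OF assms] by (simp add: real_distribution_def real_distribution_axioms_def)

text \<open>Such a law is determined by its characteristic function, which depends on the number of summands only.\<close>

lemma distr_sum_iid_std_normal_unique:
  assumes Z: "iid_std_normal M Z J" and Z': "iid_std_normal M' Z' J'" and card: "card J = card J'"
    and h: "(h :: real \<Rightarrow> real) \<in> borel_measurable borel"
  shows "distr M borel (\<lambda>\<omega>. \<Sum>i\<in>J. h (Z i \<omega>)) = distr M' borel (\<lambda>\<omega>. \<Sum>i\<in>J'. h (Z' i \<omega>))"
proof (rule Levy_uniqueness)
  have m: "(\<lambda>\<omega>. \<Sum>i\<in>I. h (X i \<omega>)) \<in> borel_measurable N" if "iid_std_normal N X I" for N :: "'c measure" and X I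
    by (intro borel_measurable_sum measurable_compose[OF _ h] iid_std_normal_measurable[OF that])
  have m': "(\<lambda>\<omega>. \<Sum>i\<in>I. h (X i \<omega>)) \<in> borel_measurable N" if "iid_std_normal N X I" for N :: "'d measure" and X I
    by (intro borel_measurable_sum measurable_compose[OF _ h] iid_std_normal_measurable[OF that])
  show "real_distribution (distr M borel (\<lambda>\<omega>. \<Sum>i\<in>J. h (Z i \<omega>)))"
    using Z by (intro real_distribution_distr m) (auto simp: iid_std_normal_def)
  show "real_distribution (distr M' borel (\<lambda>\<omega>. \<Sum>i\<in>J'. h (Z' i \<omega>)))"
    using Z' by (intro real_distribution_distr m') (auto simp: iid_std_normal_def)
  show "char (distr M borel (\<lambda>\<omega>. \<Sum>i\<in>J. h (Z i \<omega>))) = char (distr M' borel (\<lambda>\<omega>. \<Sum>i\<in>J'. h (Z' i \<omega>)))"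
    by (rule ext) (simp only: char_sum_iid_std_normal[OF Z h] char_sum_iid_std_normal[OF Z' h] card)
qed

lemma distr_std_chi_square:
  assumes Z: "iid_std_normal M Z J" and m: "card J = m" "0 < m"
  shows "distr M borel (\<lambda>\<omega>. (\<Sum>i\<in>J. (Z i \<omega>)\<^sup>2 - 1) / sqrt (2 * real m)) = std_chi_square m"
proof -
  let ?h = "\<lambda>x :: real. (x\<^sup>2 - 1) / sqrt (2 * real m)"
  have "distr M borel (\<lambda>\<omega>. \<Sum>i\<in>J. ?h (Z i \<omega>)) =
      distr (PiM {..<m} (\<lambda>_. std_normal_distribution)) borel (\<lambda>z. \<Sum>i<m. ?h (z i))"
    using m by (intro distr_sum_iid_std_normal_unique[OF Z iid_std_normal_PiM]) auto
  then show ?thesis by (simp add: std_chi_square_def sum_divide_distrib)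
qed

lemma real_distribution_std_chi_square: "real_distribution (std_chi_square m)"
proof -
  have [measurable]: "(\<lambda>z. z i) \<in> borel_measurable (PiM {..<m} (\<lambda>_. std_normal_distribution))" if "i \<in> {..<m}" for i
    using measurable_component_singleton[OF that, of "\<lambda>_. std_normal_distribution"] by simp
  show ?thesis unfolding std_chi_square_def
    by (intro real_distribution_distr prob_space_PiM prob_space_std_normal) measurable
qed

text \<open>The central limit theorem for squares of standard normal variables, which have mean 1 and variance 2.\<close>

lemma weak_conv_std_chi_square: "weak_conv_m std_chi_square std_normal_distribution"
proof -
  let ?M = "PiM UNIV (\<lambda>_ :: nat. std_normal_distribution)"
  have Z: "iid_std_normal ?M (\<lambda>i z. z i) UNIV" by (rule iid_std_normal_PiM) simp
  interpret prob_space ?M using Z by (simp add: iid_std_normal_def)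
  have ind: "indep_vars (\<lambda>_. borel) (\<lambda>i z. z i :: real) UNIV" using Z by (simp add: iid_std_normal_def)
  have [measurable]: "(\<lambda>z. z i) \<in> borel_measurable ?M" for i
    by (rule iid_std_normal_measurable[OF Z]) simp
  have law: "distr ?M borel (\<lambda>z. z i) = std_normal_distribution" for i
    using Z by (simp add: iid_std_normal_def)
  have E: "expectation (\<lambda>z. f (z i)) = (LINT x|std_normal_distribution. f x)" if "f \<in> borel_measurable borel" for f :: "real \<Rightarrow> real" and i
    using integral_distr[of "\<lambda>z. z i" ?M borel f] that unfolding law by simp
  have int: "integrable ?M (\<lambda>z. f (z i))" if "integrable std_normal_distribution f" "f \<in> borel_measurable borel" for f :: "real \<Rightarrow> real" and i
    using integrable_distr_eq[of "\<lambda>z. z i" ?M borel f] that unfolding law by simp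
  have m2: "(LINT x|std_normal_distribution. x\<^sup>2) = 1" "integrable std_normal_distribution (\<lambda>x. x\<^sup>2)"
    using std_normal_distribution_even_moments[of 1] by auto
  have m4: "(LINT x|std_normal_distribution. x ^ 4) = 3" "integrable std_normal_distribution (\<lambda>x. x ^ 4)"
    using std_normal_distribution_even_moments[of 2] by (auto simp: fact_numeral)
  have mean: "expectation (\<lambda>z. (z i)\<^sup>2) = 1" for i
    by (simp add: E[of "\<lambda>x. x\<^sup>2"] m2)
  have var: "variance (\<lambda>z. (z i)\<^sup>2) = (sqrt 2)\<^sup>2" for i
  proof -
    have "variance (\<lambda>z. (z i)\<^sup>2) = (LINT x|std_normal_distribution. (x\<^sup>2 - 1)\<^sup>2)"
      unfolding mean by (rule E[of "\<lambda>x. (x\<^sup>2 - 1)\<^sup>2"]) measurable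
    also have "\<dots> = (LINT x|std_normal_distribution. x ^ 4 - 2 * x\<^sup>2 + 1)"
      by (intro Bochner_Integration.integral_cong refl) (simp add: power2_eq_square power4_eq_xxxx algebra_simps)
    also have "\<dots> = 2" 
      using m2 m4 prob_space.prob_space[OF prob_space_std_normal]
        finite_measure.integrable_const[OF prob_space.finite_measure[OF prob_space_std_normal], of "1::real"]
      by simp
    finally show ?thesis by simp
  qed
  have "weak_conv_m (\<lambda>n. distr ?M borel (\<lambda>z. (\<Sum>i<n. (z i)\<^sup>2 - 1) / sqrt (n * (sqrt 2)\<^sup>2))) std_normal_distribution"
  proof (rule central_limit_theorem[where \<mu> = "distr std_normal_distribution borel (\<lambda>x. x\<^sup>2)"])
    show "indep_vars (\<lambda>i. borel) (\<lambda>i z. (z i)\<^sup>2 :: real) UNIV"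
      by (rule indep_vars_compose2[OF ind]) measurable
    show "integrable ?M (\<lambda>z. ((z i)\<^sup>2)\<^sup>2)" for i
      using int[OF m4(2), of i] by (simp flip: power_mult)
    show "distr ?M borel (\<lambda>z. (z i)\<^sup>2) = distr std_normal_distribution borel (\<lambda>x. x\<^sup>2)" for i
      using distr_distr[of "\<lambda>x. x\<^sup>2" borel borel "\<lambda>z. z i" ?M] unfolding law by (simp add: comp_def)
  qed (use var[unfolded mean] in \<open>simp_all add: mean\<close>)
  moreover have "distr ?M borel (\<lambda>z. (\<Sum>i<n. (z i)\<^sup>2 - 1) / sqrt (n * (sqrt 2)\<^sup>2)) = std_chi_square n" if "0 < n" for n
    using distr_std_chi_square[OF iid_std_normal_subset[OF Z, of "{..<n}"], of n] that by (simp add: mult.commute)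
  ultimately show ?thesis
    unfolding weak_conv_m_def weak_conv_def
    by (auto elim!: Lim_transform_eventually intro!: eventually_mono[OF eventually_gt_at_top[of 0]])
qed

text \<open>The characteristic function of the sum of squares of \<open>d\<close> independent variables with laws
\<open>std_chi_square (m l)\<close>.\<close>

definition sum_sq_char :: "nat \<Rightarrow> (nat \<Rightarrow> nat) \<Rightarrow> real \<Rightarrow> complex" where
  "sum_sq_char d m t = (\<Prod>l<d. char (distr (std_chi_square (m l)) borel (\<lambda>x. x\<^sup>2)) t)"

text \<open>The blocks are disjoint, so their sums of squares are independent.\<close>

lemma char_sum_std_chi_square:
  assumes Z: "iid_std_normal M Z I" and J: "\<And>l. l < d \<Longrightarrow> J l \<subseteq> I" "disjoint_family_on J {..<d}"
    and m: "\<And>l. l < d \<Longrightarrow> 0 < card (J l)"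
  shows "char (distr M borel (\<lambda>\<omega>. \<Sum>l<d. ((\<Sum>i\<in>J l. (Z i \<omega>)\<^sup>2 - 1) / sqrt (2 * real (card (J l))))\<^sup>2)) t
    = sum_sq_char d (\<lambda>l. card (J l)) t"
proof -
  interpret prob_space M using Z by (simp add: iid_std_normal_def)
  have ind: "indep_vars (\<lambda>_. borel) Z I" using Z by (simp add: iid_std_normal_def)
  let ?h = "\<lambda>l (z :: nat \<Rightarrow> real). (\<Sum>i\<in>J l. (z i)\<^sup>2 - 1) / sqrt (2 * real (card (J l)))"
  have hm: "?h l \<in> borel_measurable (PiM (J l) (\<lambda>_. borel))" for l by measurable
  have Zm: "Z i \<in> borel_measurable M" if "i \<in> J l" "l < d" for i l
    using iid_std_normal_measurable[OF Z] J(1) that by blast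
  have hZm[measurable]: "(\<lambda>\<omega>. ?h l (\<lambda>i. Z i \<omega>)) \<in> borel_measurable M" if "l < d" for l
    using Zm that by (intro borel_measurable_divide borel_measurable_sum borel_measurable_diff borel_measurable_power) auto
  have "indep_vars (\<lambda>l. PiM (J l) (\<lambda>_. borel)) (\<lambda>l \<omega>. restrict (\<lambda>i. Z i \<omega>) (J l)) {..<d}"
    using J by (intro indep_vars_restrict[OF ind]) auto
  then have "indep_vars (\<lambda>_. borel) (\<lambda>l \<omega>. (?h l (restrict (\<lambda>i. Z i \<omega>) (J l)))\<^sup>2) {..<d}"
    by (rule indep_vars_compose2) (use hm in \<open>intro borel_measurable_power\<close>)
  then have "indep_vars (\<lambda>_. borel) (\<lambda>l \<omega>. (?h l (\<lambda>i. Z i \<omega>))\<^sup>2) {..<d}"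
    by simp
  from char_distr_sum[OF this, of t]
  have "char (distr M borel (\<lambda>\<omega>. \<Sum>l<d. (?h l (\<lambda>i. Z i \<omega>))\<^sup>2)) t = (\<Prod>l<d. char (distr M borel (\<lambda>\<omega>. (?h l (\<lambda>i. Z i \<omega>))\<^sup>2)) t)" .
  also have "\<dots> = sum_sq_char d (\<lambda>l. card (J l)) t"
    unfolding sum_sq_char_def
  proof (intro prod.cong refl)
    fix l assume "l \<in> {..<d}"
    then have l: "l < d" by simp
    have "distr M borel (\<lambda>\<omega>. (?h l (\<lambda>i. Z i \<omega>))\<^sup>2) = distr (distr M borel (\<lambda>\<omega>. ?h l (\<lambda>i. Z i \<omega>))) borel (\<lambda>x. x\<^sup>2)"
      using hZm[OF l] by (subst distr_distr) (auto simp: comp_def)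
    also have "distr M borel (\<lambda>\<omega>. ?h l (\<lambda>i. Z i \<omega>)) = std_chi_square (card (J l))"
      by (rule distr_std_chi_square[OF iid_std_normal_subset[OF Z J(1)[OF l]] refl m[OF l]])
    finally show "char (distr M borel (\<lambda>\<omega>. (?h l (\<lambda>i. Z i \<omega>))\<^sup>2)) t =
      char (distr (std_chi_square (card (J l))) borel (\<lambda>x. x\<^sup>2)) t" by simp
  qed
  finally show ?thesis .
qed

lemma real_distribution_chi_square: "real_distribution (chi_square d)"
proof -
  have [measurable]: "(\<lambda>z. z i) \<in> borel_measurable (PiM {..<d} (\<lambda>_. std_normal_distribution))" if "i \<in> {..<d}" for i
    using measurable_component_singleton[OF that, of "\<lambda>_. std_normal_distribution"] by simp
  show ?thesis unfolding chi_square_def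
    by (intro real_distribution_distr prob_space_PiM prob_space_std_normal) measurable
qed

lemma char_chi_square:
  assumes "0 < d"
  shows "char (chi_square d) t = char (distr std_normal_distribution borel (\<lambda>x. x\<^sup>2)) t ^ d"
  using char_sum_iid_std_normal[OF iid_std_normal_PiM, of "{..<d}" "\<lambda>x. x\<^sup>2" t] assms
  by (simp add: chi_square_def lessThan_empty_iff)

text \<open>The function \<open>x \<mapsto> iexp (t * x\<^sup>2)\<close> is bounded and continuous, so the weak limit
of each standardized chi-square law carries over to the characteristic function of its square.\<close>

lemma sum_sq_char_tendsto:
  assumes d: "0 < d" and m: "\<And>l. l < d \<Longrightarrow> filterlim (\<lambda>k. m k l) at_top sequentially"
  shows "(\<lambda>k. sum_sq_char d (m k) t) \<longlonglongrightarrow> char (chi_square d) t"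
proof -
  have sq: "char (distr N borel (\<lambda>x. x\<^sup>2)) t = (CLINT x|N. iexp (t * x\<^sup>2))" if "real_distribution N" for N
  proof -
    interpret real_distribution N by fact
    show ?thesis unfolding char_def by (rule integral_distr) measurable
  qed
  have "(\<lambda>n. CLINT x|std_chi_square n. iexp (t * x\<^sup>2)) \<longlonglongrightarrow> (CLINT x|std_normal_distribution. iexp (t * x\<^sup>2))"
    by (rule weak_conv_imp_integral_bdd_continuous_conv[OF real_distribution_std_chi_square real_dist_normal_dist weak_conv_std_chi_square])
       (auto intro!: continuous_intros)
  then have lim: "(\<lambda>n. char (distr (std_chi_square n) borel (\<lambda>x. x\<^sup>2)) t) \<longlonglongrightarrow> char (distr std_normal_distribution borel (\<lambda>x. x\<^sup>2)) t"
    by (simp add: sq real_distribution_std_chi_square real_dist_normal_dist)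
  have "(\<lambda>k. sum_sq_char d (m k) t) \<longlonglongrightarrow> (\<Prod>l<d. char (distr std_normal_distribution borel (\<lambda>x. x\<^sup>2)) t)"
    unfolding sum_sq_char_def using m by (intro tendsto_prod filterlim_compose[OF lim]) auto
  then show ?thesis by (simp add: char_chi_square[OF d])
qed

section \<open>Continuity of the chi-square law\<close>

lemma emeasure_std_normal_finite:
  assumes "finite A"
  shows "emeasure std_normal_distribution A = 0"
proof -
  have A: "A \<in> null_sets lborel" using assms by (rule finite_imp_null_set_lborel)
  then have "emeasure std_normal_distribution A = (\<integral>\<^sup>+x. ennreal (std_normal_density x) * indicator A x \<partial>lborel)"
    by (intro emeasure_density) (auto simp: null_sets_def)
  also have "\<dots> = 0" by (rule nn_integral_null_set[OF A])
  finally show ?thesis .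
qed

text \<open>Given the other coordinates, a single coordinate must hit one of at most two values, which has
probability zero.\<close>

lemma chi_square_no_atoms:
  assumes d: "0 < d"
  shows "measure (chi_square d) {x} = 0"
proof -
  let ?N = "std_normal_distribution"
  let ?M = "\<lambda>I. PiM I (\<lambda>_ :: nat. ?N)"
  define I where "I = {1..<d}"
  have I: "finite I" "0 \<notin> I" "{..<d} = insert 0 I" using d by (auto simp: I_def)
  have m[measurable]: "(\<lambda>z. \<Sum>i<d. (z i)\<^sup>2) \<in> borel_measurable (?M {..<d})"
  proof (intro borel_measurable_sum borel_measurable_power)
    fix i assume "i \<in> {..<d}"
    then show "(\<lambda>z. z i) \<in> borel_measurable (?M {..<d})"
      using measurable_component_singleton[of i "{..<d}" "\<lambda>_. ?N"] by simp
  qed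
  have "emeasure (chi_square d) {x} = (\<integral>\<^sup>+z. indicator {x} (\<Sum>i<d. (z i)\<^sup>2) \<partial>?M {..<d})"
    unfolding chi_square_def by (subst nn_integral_indicator[symmetric], simp, subst nn_integral_distr) auto
  also have "\<dots> = (\<integral>\<^sup>+z. (\<integral>\<^sup>+u. indicator {x} (\<Sum>i<d. ((z(0 := u)) i)\<^sup>2) \<partial>?N) \<partial>?M I)"
    unfolding I(3)
    by (rule normal_product.product_nn_integral_insert[OF I(1,2)])
       (use m[unfolded I(3)] in measurable)
  also have "\<dots> = (\<integral>\<^sup>+z. 0 \<partial>?M I)"
  proof (rule nn_integral_cong)
    fix z :: "nat \<Rightarrow> real"
    define s where "s = x - (\<Sum>i\<in>I. (z i)\<^sup>2)"
    have sum: "(\<Sum>i<d. ((z(0 := u)) i)\<^sup>2) = u\<^sup>2 + (\<Sum>i\<in>I. (z i)\<^sup>2)" for u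
      unfolding I(3) using I(1,2) by (auto intro!: sum.cong)
    have "{u. u\<^sup>2 = s} \<subseteq> {sqrt s, - sqrt s}"
    proof
      fix u :: real assume "u \<in> {u. u\<^sup>2 = s}"
      then have "\<bar>u\<bar> = sqrt s" by (auto simp flip: real_sqrt_abs)
      then show "u \<in> {sqrt s, - sqrt s}" by auto
    qed
    then have fin: "finite {u. u\<^sup>2 = s}" by (rule finite_subset) simp
    have "(\<integral>\<^sup>+u. indicator {x} (\<Sum>i<d. ((z(0 := u)) i)\<^sup>2) \<partial>?N) = (\<integral>\<^sup>+u. indicator {u. u\<^sup>2 = s} u \<partial>?N)"
      unfolding sum s_def by (intro nn_integral_cong) (auto split: split_indicator)
    also have "\<dots> = emeasure ?N {u. u\<^sup>2 = s}"
      using fin by (intro nn_integral_indicator) (simp add: borel_closed finite_imp_closed)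
    finally show "(\<integral>\<^sup>+u. indicator {x} (\<Sum>i<d. ((z(0 := u)) i)\<^sup>2) \<partial>?N) = 0"
      by (simp add: emeasure_std_normal_finite[OF fin])
  qed
  finally show ?thesis by (simp add: measure_def)
qed

lemma isCont_cdf_chi_square:
  assumes "0 < d"
  shows "isCont (cdf (chi_square d)) x"
proof -
  interpret real_distribution "chi_square d" by (rule real_distribution_chi_square)
  show ?thesis using chi_square_no_atoms[OF assms] by (simp add: isCont_cdf)
qed

text \<open>By continuity the level set is nonempty and the superlevel set is closed, so the infimum is attained at
the level itself.\<close>

lemma cdf_quantile:
  assumes M: "real_distribution M" and cont: "\<And>x. isCont (cdf M) x" and p: "0 < p" "p < 1"
  shows "cdf M (quantile M p) = p"
proof -
  interpret real_distribution M by fact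
  let ?S = "{x. p \<le> cdf M x}"
  have "eventually (\<lambda>x. p < cdf M x) at_top"
    using cdf_lim_at_top_prob p(2) by (rule order_tendstoD)
  then obtain b where b: "p < cdf M b" by (metis eventually_at_top_linorder order_refl)
  have "eventually (\<lambda>x. cdf M x < p) at_bot"
    using cdf_lim_at_bot p(1) by (rule order_tendstoD)
  then obtain a where a: "cdf M a < p" by (metis eventually_at_bot_linorder order_refl)
  have "a \<le> b" using a b cdf_nondecreasing[of b a] by linarith
  then obtain x where x: "cdf M x = p"
    using IVT[of "cdf M" a p b] a b cont by auto
  have lower: "a \<le> y" if "y \<in> ?S" for y
    using that a cdf_nondecreasing[of y a] by (cases "a \<le> y") auto
  have bdd: "bdd_below ?S" using lower by (intro bdd_belowI[of _ a])
  have "closed ?S"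
    using cont by (intro closed_Collect_le continuous_on_const) (simp add: continuous_at_imp_continuous_on)
  then have "Inf ?S \<in> ?S" using x bdd by (intro closed_contains_Inf) auto
  moreover have "Inf ?S \<le> x" using x bdd by (intro cInf_lower) auto
  then have "cdf M (Inf ?S) \<le> p" using cdf_nondecreasing[of "Inf ?S" x] x by simp
  ultimately show ?thesis by (simp add: quantile_def)
qed

lemma cdf_tendsto_chi_square:
  assumes d: "0 < d" and m: "\<And>l. l < d \<Longrightarrow> filterlim (\<lambda>k. m k l) at_top sequentially"
    and \<nu>: "\<And>k. real_distribution (\<nu> k)" "\<And>k t. char (\<nu> k) t = sum_sq_char d (m k) t"
  shows "(\<lambda>k. cdf (\<nu> k) x) \<longlonglongrightarrow> cdf (chi_square d) x"
proof -
  have "weak_conv_m \<nu> (chi_square d)"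
  proof (rule levy_continuity[OF \<nu>(1) real_distribution_chi_square])
    show "(\<lambda>k. char (\<nu> k) t) \<longlonglongrightarrow> char (chi_square d) t" for t
      unfolding \<nu>(2) by (rule sum_sq_char_tendsto[OF d m])
  qed
  then show ?thesis using isCont_cdf_chi_square[OF d] by (simp add: weak_conv_m_def weak_conv_def)
qed

section \<open>The law of the statistic and its limit\<close>

lemma model_cov_spectral:
  assumes Q: "eigenbasis ns Q"
  shows "model_cov ns \<psi> = orth_diag (prod_list ns) Q (cov_eigval ns \<psi>)"
proof -
  let ?n = "prod_list ns"
  have Qc: "Q \<in> carrier_mat ?n ?n" and QQ: "transpose_mat Q * Q = 1\<^sub>m ?n"
    using Q by (auto simp: eigenbasis_def)
  have QQ': "Q * transpose_mat Q = 1\<^sub>m ?n"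
    by (rule mat_mult_left_right_inverse[OF _ Qc QQ]) (use Qc in simp)
  have \<Sigma>: "model_cov ns \<psi> \<in> carrier_mat ?n ?n" by (simp add: model_cov_def)
  have "model_cov ns \<psi> = model_cov ns \<psi> * (Q * transpose_mat Q)" unfolding QQ' using \<Sigma> by simp
  also have "\<dots> = model_cov ns \<psi> * Q * transpose_mat Q"
    using \<Sigma> Qc by (intro assoc_mult_mat_dim[symmetric]) auto
  also have "\<dots> = orth_diag ?n Q (cov_eigval ns \<psi>)" unfolding model_cov_eigenbasis[OF Q] orth_diag_def ..
  finally show ?thesis .
qed

text \<open>In eigencoordinates the quadratic form of the density is a sum of squares. The constant absorbs the
determinant of the covariance; the total mass determines it.\<close>

lemma mvn_density_eigenbasis:
  assumes Q: "eigenbasis ns Q" and \<psi>: "\<psi> \<in> param_set (length ns + 1)"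
  defines "n \<equiv> prod_list ns"
  defines "K \<equiv> \<lambda>i j. Q $$ (j, i) / sqrt (cov_eigval ns \<psi> i)"
  shows "\<exists>c. \<forall>x. ennreal (mvn_density (\<beta> \<cdot>\<^sub>v ones n) (model_cov ns \<psi>) (vec n x)) =
    c * (\<Prod>i<n. ennreal (std_normal_density (\<Sum>j<n. K i j * (x j - \<beta>))))"
proof -
  have Qc: "Q \<in> carrier_mat n n" and QQ: "transpose_mat Q * Q = 1\<^sub>m n"
    using Q by (auto simp: eigenbasis_def n_def)
  have QQ': "Q * transpose_mat Q = 1\<^sub>m n"
    by (rule mat_mult_left_right_inverse[OF _ Qc QQ]) (use Qc in simp)
  define d where "d = cov_eigval ns \<psi>"
  have d: "0 < d i" for i unfolding d_def by (rule cov_eigval_pos[OF \<psi>])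
  have \<Sigma>: "model_cov ns \<psi> = orth_diag n Q d" unfolding n_def d_def by (rule model_cov_spectral[OF Q])
  have inv: "mat_inv (model_cov ns \<psi>) = orth_diag n Q (\<lambda>i. 1 / d i)"
  proof -
    have "orth_diag n Q d * orth_diag n Q (\<lambda>i. 1 / d i) = 1\<^sub>m n"
      unfolding orth_diag_mult[OF Qc QQ] orth_diag_one[OF Qc QQ, symmetric]
      by (rule orth_diag_cong[OF Qc QQ]) (use d in \<open>simp add: less_imp_neq[symmetric]\<close>)
    then show ?thesis unfolding \<Sigma>
      by (rule mat_inv_eqI[OF orth_diag_carrier[OF Qc QQ] orth_diag_carrier[OF Qc QQ]])
  qed
  define A where "A x i = (\<Sum>j<n. K i j * (x j - \<beta>))" for x i
  define b where "b = sqrt ((2 * pi) ^ n * det (model_cov ns \<psi>))"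
  have quad: "(vec n x - \<beta> \<cdot>\<^sub>v ones n) \<bullet> (mat_inv (model_cov ns \<psi>) *\<^sub>v (vec n x - \<beta> \<cdot>\<^sub>v ones n)) = (\<Sum>i<n. (A x i)\<^sup>2)" for x
  proof -
    define v where "v = vec n x - \<beta> \<cdot>\<^sub>v ones n"
    have v: "v \<in> carrier_vec n" by (simp add: v_def ones_def carrier_vecI)
    define w where "w = transpose_mat Q *\<^sub>v v"
    have w: "w \<in> carrier_vec n" using Qc unfolding w_def by (intro carrier_vecI) simp
    have vw: "v = Q *\<^sub>v w" unfolding w_def using Qc v QQ'
      by (subst assoc_mult_mat_vec_dim[symmetric]) auto
    have wi: "w $ i = sqrt (d i) * A x i" if "i < n" for i
    proof -
      have "w $ i = (\<Sum>j<n. Q $$ (j, i) * (x j - \<beta>))"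
        using that Qc by (simp add: w_def v_def ones_def scalar_prod_def lessThan_atLeast0)
      also have "\<dots> = sqrt (d i) * A x i"
        using d[of i] by (simp add: A_def K_def sum_distrib_left d_def[symmetric] less_imp_neq[symmetric])
      finally show ?thesis .
    qed
    have "v \<bullet> (mat_inv (model_cov ns \<psi>) *\<^sub>v v) = (\<Sum>i<n. 1 / d i * (w $ i)\<^sup>2)"
      unfolding inv vw by (rule orth_diag_quadratic_form[OF Qc QQ w])
    also have "\<dots> = (\<Sum>i<n. (A x i)\<^sup>2)"
      using d by (intro sum.cong) (auto simp: wi power_mult_distrib less_imp_le less_imp_neq[symmetric])
    finally show ?thesis by (simp add: v_def)
  qed
  have dim: "dim_vec (\<beta> \<cdot>\<^sub>v ones n) = n" by (simp add: ones_def)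
  have "ennreal (mvn_density (\<beta> \<cdot>\<^sub>v ones n) (model_cov ns \<psi>) (vec n x)) =
      ennreal (sqrt (2 * pi) ^ n / b) * (\<Prod>i<n. ennreal (std_normal_density (A x i)))" for x
  proof -
    have "(\<Prod>i<n. std_normal_density (A x i)) = (1 / sqrt (2 * pi)) ^ n * exp (\<Sum>i<n. - (A x i)\<^sup>2 / 2)"
      by (simp add: std_normal_density_def prod.distrib exp_sum prod_dividef power_one_over divide_simps)
    then have "mvn_density (\<beta> \<cdot>\<^sub>v ones n) (model_cov ns \<psi>) (vec n x) =
        sqrt (2 * pi) ^ n / b * (\<Prod>i<n. std_normal_density (A x i))"
      unfolding mvn_density_def quad dim b_def[symmetric]
      by (simp add: sum_negf power_one_over flip: sum_divide_distrib)
    moreover have "ennreal (sqrt (2 * pi) ^ n / b * (\<Prod>i<n. std_normal_density (A x i))) =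
        ennreal (sqrt (2 * pi) ^ n / b) * ennreal (\<Prod>i<n. std_normal_density (A x i))"
      by (rule ennreal_mult'') (intro prod_nonneg ballI normal_density_nonneg)
    moreover have "(\<Prod>i<n. ennreal (std_normal_density (A x i))) = ennreal (\<Prod>i<n. std_normal_density (A x i))"
      by (rule prod_ennreal) simp
    ultimately show ?thesis by simp
  qed
  then show ?thesis unfolding A_def by blast
qed

text \<open>The affine map to all \<open>prod_list ns\<close> eigencoordinates of the centred observation is
invertible. The mean is constant and hence orthogonal to the eigenvectors with index at least 1, so the
standardized contrasts do not see the centring.\<close>

lemma std_contrast_iid:
  assumes pos: "\<And>m. m \<in> set ns \<Longrightarrow> 0 < m" and Q: "eigenbasis ns Q"
    and \<psi>: "\<psi> \<in> param_set (length ns + 1)" and model: "crossed_model ns \<beta> \<psi> M Y"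
  shows "\<exists>Z. iid_std_normal M Z {1..<prod_list ns} \<and>
    (\<forall>\<omega>\<in>space M. \<forall>a\<in>{1..<prod_list ns}. std_contrast ns Q \<psi> (Y \<omega>) a = Z a \<omega>)"
proof -
  define n where "n = prod_list ns"
  have n0: "0 < n" unfolding n_def using pos by (induction ns) auto
  have Qc: "Q \<in> carrier_mat n n" and QQ: "transpose_mat Q * Q = 1\<^sub>m n"
    and Q0: "\<forall>i<n. Q $$ (i, 0) = 1 / sqrt (real n)"
    using Q by (auto simp: eigenbasis_def n_def)
  define d where "d = cov_eigval ns \<psi>"
  have d: "0 < d i" for i unfolding d_def by (rule cov_eigval_pos[OF \<psi>])
  define K where "K i j = Q $$ (j, i) / sqrt (d i)" for i j
  define K' where "K' j l = Q $$ (j, l) * sqrt (d l)" for j l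
  have orth: "(\<Sum>j<n. Q $$ (j, i) * Q $$ (j, l)) = (if i = l then 1 else 0)" if "i < n" "l < n" for i l
    using arg_cong[OF QQ, of "\<lambda>M. M $$ (i, l)"] that Qc by (simp add: scalar_prod_def lessThan_atLeast0)
  have KK: "(\<Sum>j\<in>{..<n}. K i j * K' j l) = (if i = l then 1 else 0)" if "i \<in> {..<n}" "l \<in> {..<n}" for i l
  proof -
    have "(\<Sum>j<n. K i j * K' j l) = (\<Sum>j<n. Q $$ (j, i) * Q $$ (j, l)) * (sqrt (d l) / sqrt (d i))"
      unfolding sum_distrib_right by (intro sum.cong) (auto simp: K_def K'_def)
    then show ?thesis using orth[of i l] that d[of i] by auto
  qed
  have dim: "dim_vec (\<beta> \<cdot>\<^sub>v ones n) = n" by (simp add: ones_def)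
  define X where "X \<omega> = (\<lambda>i\<in>{..<n}. Y \<omega> $ i)" for \<omega>
  have M: "prob_space M" using model by (simp add: crossed_model_def)
  have Yc: "Y \<omega> \<in> carrier_vec n" if "\<omega> \<in> space M" for \<omega>
    using model that unfolding crossed_model_def mvn_distributed_def n_def[symmetric] dim by blast
  have "distributed M (lebPi {..<n}) X (\<lambda>x. ennreal (mvn_density (\<beta> \<cdot>\<^sub>v ones n) (model_cov ns \<psi>) (vec n x)))"
    using model unfolding crossed_model_def mvn_distributed_def n_def[symmetric] dim X_def by blast
  then have Xm[measurable]: "X \<in> measurable M (lebPi {..<n})"
    and Xd: "distr M (lebPi {..<n}) X = density (lebPi {..<n})
      (\<lambda>x. ennreal (mvn_density (\<beta> \<cdot>\<^sub>v ones n) (model_cov ns \<psi>) (vec n x)))"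
    by (auto simp: distributed_def)
  define A where "A x = (\<lambda>i\<in>{..<n}. \<Sum>j<n. K i j * (x j - \<beta>))" for x
  obtain c where c: "\<And>x. ennreal (mvn_density (\<beta> \<cdot>\<^sub>v ones n) (model_cov ns \<psi>) (vec n x)) =
    c * (\<Prod>i<n. ennreal (std_normal_density (\<Sum>j<n. K i j * (x j - \<beta>))))"
    using mvn_density_eigenbasis[OF Q \<psi>, of \<beta>] unfolding n_def[symmetric] K_def d_def by blast
  have law: "distr M (lebPi {..<n}) (\<lambda>\<omega>. A (X \<omega>)) = PiM {..<n} (\<lambda>_. std_normal_distribution)"
    unfolding A_def
  proof (rule distr_affine_gaussian[OF M finite_lessThan KK Xm, where c = c])
    show "distr M (lebPi {..<n}) X = density (lebPi {..<n}) (\<lambda>x. c *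
        (\<Prod>i\<in>{..<n}. ennreal (std_normal_density ((\<lambda>i\<in>{..<n}. \<Sum>j<n. K i j * (x j - \<beta>)) i))))"
      unfolding Xd c by simp
  qed
  define Z where "Z i \<omega> = A (X \<omega>) i" for i \<omega>
  have A[measurable]: "A \<in> measurable (lebPi {..<n}) (lebPi {..<n})"
    unfolding A_def by (intro measurable_restrict) measurable
  have Zm: "Z i \<in> borel_measurable M" if "i \<in> {..<n}" for i
  proof -
    have "(\<lambda>x. A x i) \<in> borel_measurable (lebPi {..<n})"
      using measurable_compose[OF A measurable_component_singleton[OF that]] by simp
    then show ?thesis unfolding Z_def by measurable
  qed
  have "iid_std_normal M Z {..<n}"
  proof (rule iid_std_normalI[OF M _ Zm])
    have "distr M (PiM {..<n} (\<lambda>_. borel)) (\<lambda>\<omega>. \<lambda>i\<in>{..<n}. Z i \<omega>) = distr M (lebPi {..<n}) (\<lambda>\<omega>. A (X \<omega>))"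
      by (rule distr_cong) (auto simp: Z_def A_def intro!: sets_PiM_cong)
    then show "distr M (PiM {..<n} (\<lambda>_. borel)) (\<lambda>\<omega>. \<lambda>i\<in>{..<n}. Z i \<omega>) = PiM {..<n} (\<lambda>_. std_normal_distribution)"
      by (simp add: law)
  qed (use n0 in auto)
  then have "iid_std_normal M Z {1..<n}" by (rule iid_std_normal_subset) auto
  moreover have "std_contrast ns Q \<psi> (Y \<omega>) a = Z a \<omega>" if \<omega>: "\<omega> \<in> space M" and a: "a \<in> {1..<n}" for \<omega> a
  proof -
    have "1 / sqrt (real n) * (\<Sum>j<n. Q $$ (j, a)) = (\<Sum>j<n. Q $$ (j, 0) * Q $$ (j, a))"
      unfolding sum_distrib_left using Q0 by (intro sum.cong) auto
    also have "\<dots> = 0" using orth[of 0 a] a by simp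
    finally have sum0: "(\<Sum>j<n. Q $$ (j, a)) = 0" using n0 by simp
    have "Z a \<omega> = (\<Sum>j<n. K a j * (Y \<omega> $ j - \<beta>))" using a by (simp add: Z_def A_def X_def)
    also have "\<dots> = ((\<Sum>j<n. Q $$ (j, a) * Y \<omega> $ j) - (\<Sum>j<n. Q $$ (j, a)) * \<beta>) / sqrt (d a)"
      by (simp add: K_def sum_distrib_right sum_divide_distrib diff_divide_distrib right_diff_distrib sum_subtractf)
    finally show ?thesis unfolding sum0 by (simp add: std_contrast_def n_def d_def)
  qed
  ultimately show ?thesis unfolding n_def by blast
qed

text \<open>The characteristic function does not involve \<open>\<psi>\<close>, \<open>\<beta>\<close> or
\<open>V\<close>: the statistic is pivotal.\<close>

lemma restr_score_stat_law:
  assumes pos: "\<And>m. m \<in> set ns \<Longrightarrow> 0 < m" and V: "contrast_basis (prod_list ns) V"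
    and \<psi>: "\<psi> \<in> param_set (length ns + 1)" and model: "crossed_model ns \<beta> \<psi> M Y"
    and ne: "\<And>l. l \<le> length ns \<Longrightarrow> effect_class ns l \<noteq> {}"
  shows "\<exists>\<nu>. real_distribution \<nu> \<and>
    (\<forall>t. char \<nu> t = sum_sq_char (length ns + 1) (\<lambda>l. card (effect_class ns l)) t) \<and>
    (\<forall>c. measure M {\<omega> \<in> space M. restr_score_stat ns V \<psi> (Y \<omega>) \<le> c} = cdf \<nu> c)"
proof -
  obtain Q where Q: "eigenbasis ns Q" using ex_eigenbasis[OF pos] by blast
  obtain Z where Z: "iid_std_normal M Z {1..<prod_list ns}"
    and ZY: "\<And>\<omega> a. \<omega> \<in> space M \<Longrightarrow> a \<in> {1..<prod_list ns} \<Longrightarrow> std_contrast ns Q \<psi> (Y \<omega>) a = Z a \<omega>"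
    using std_contrast_iid[OF pos Q \<psi> model] by blast
  have M: "prob_space M" using model by (simp add: crossed_model_def)
  have Yc: "Y \<omega> \<in> carrier_vec (prod_list ns)" if "\<omega> \<in> space M" for \<omega>
    using model that by (simp add: crossed_model_def mvn_distributed_def ones_def)
  let ?C = "effect_class ns"
  have C: "?C l \<subseteq> {1..<prod_list ns}" for l by (auto simp: effect_class_def)
  define T where "T \<omega> = (\<Sum>l<length ns + 1. ((\<Sum>i\<in>?C l. (Z i \<omega>)\<^sup>2 - 1) / sqrt (2 * real (card (?C l))))\<^sup>2)" for \<omega>
  have T: "restr_score_stat ns V \<psi> (Y \<omega>) = T \<omega>" if \<omega>: "\<omega> \<in> space M" for \<omega>
  proof -
    have "(\<Sum>a\<in>?C l. (std_contrast ns Q \<psi> (Y \<omega>) a)\<^sup>2 - 1) = (\<Sum>a\<in>?C l. (Z a \<omega>)\<^sup>2 - 1)" for l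
      by (intro sum.cong refl) (simp add: ZY[OF \<omega> subsetD[OF C]])
    then show ?thesis
      using restr_score_stat_eq[OF pos V Q \<psi> Yc[OF \<omega>] ne] by (simp add: T_def lessThan_Suc_atMost)
  qed
  have Zm: "Z i \<in> borel_measurable M" if "i \<in> ?C l" for i l
    using iid_std_normal_measurable[OF Z] C that by blast
  have Tm[measurable]: "T \<in> borel_measurable M"
    unfolding T_def using Zm
    by (intro borel_measurable_sum borel_measurable_power borel_measurable_divide borel_measurable_diff borel_measurable_const) auto
  have "char (distr M borel T) t = sum_sq_char (length ns + 1) (\<lambda>l. card (?C l)) t" for t
    unfolding T_def
  proof (rule char_sum_std_chi_square[OF Z])
    show "disjoint_family_on ?C {..<length ns + 1}"
      using effect_class_disjoint[OF pos] by (simp add: lessThan_Suc_atMost)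
    show "0 < card (?C l)" if "l < length ns + 1" for l
      using ne[of l] that by (simp add: card_gt_0_iff)
  qed (rule C)
  moreover have "measure M {\<omega> \<in> space M. restr_score_stat ns V \<psi> (Y \<omega>) \<le> c} = cdf (distr M borel T) c" for c
  proof -
    have "{\<omega> \<in> space M. restr_score_stat ns V \<psi> (Y \<omega>) \<le> c} = T -` {..c} \<inter> space M" using T by auto
    then show ?thesis by (simp add: cdf_def2 measure_distr)
  qed
  ultimately show ?thesis using real_distribution_distr[OF M Tm] by blast
qed

theorem corollary4:
  fixes \<alpha> :: real and r :: nat
    and ns :: "nat \<Rightarrow> nat list" and \<beta> :: "nat \<Rightarrow> real" and V :: "nat \<Rightarrow> real mat"
    and P :: "nat \<Rightarrow> real vec \<Rightarrow> 'a measure" and Y :: "nat \<Rightarrow> 'a \<Rightarrow> real vec"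
  assumes "0 < \<alpha>" and "\<alpha> < 1" and "3 \<le> r"
    and "\<And>k. length (ns k) = r - 1"
    and "\<And>k m. m \<in> set (ns k) \<Longrightarrow> 0 < m"
    and "\<And>k. contrast_basis (prod_list (ns k)) (V k)"
    and "\<And>k \<psi>. \<psi> \<in> param_set r \<Longrightarrow> crossed_model (ns k) (\<beta> k) \<psi> (P k \<psi>) (Y k)"
    and "filterlim (\<lambda>k. Min (set (ns k))) at_top sequentially"
  shows "(\<lambda>k. SUP \<psi>\<in>param_set r.
           \<bar>measure (P k \<psi>) {\<omega> \<in> space (P k \<psi>). \<psi> \<in> restr_conf_region (ns k) (V k) \<alpha> (Y k \<omega>)}
              - (1 - \<alpha>)\<bar>) \<longlonglongrightarrow> 0"
proof -
  have len: "length (ns k) + 1 = r" "2 \<le> length (ns k)" for k using assms(3) assms(4)[of k] by auto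
  have r0: "0 < r" using assms(3) by simp
  let ?card = "\<lambda>k l. card (effect_class (ns k) l)"
  define q where "q = quantile (chi_square r) (1 - \<alpha>)"
  have ge: "c \<le> ?card k l" if "c < Min (set (ns k))" "0 < c" "l < r" for c k l
  proof (rule card_effect_class_ge)
    show "c < m" if "m \<in> set (ns k)" for m
      using \<open>c < Min (set (ns k))\<close> Min_le[OF _ that] by simp
  qed (use that len[of k] in auto)
  have card_lim: "filterlim (\<lambda>k. ?card k l) at_top sequentially" if l: "l < r" for l
    unfolding filterlim_at_top
  proof
    fix c
    have "eventually (\<lambda>k. c + 2 \<le> Min (set (ns k))) sequentially"
      using assms(8) unfolding filterlim_at_top by blast
    then show "eventually (\<lambda>k. c \<le> ?card k l) sequentially"
    proof eventually_elim
      case (elim k)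
      then have "c + 1 \<le> ?card k l" using l by (intro ge) auto
      then show ?case by simp
    qed
  qed
  have "eventually (\<lambda>k. 2 \<le> Min (set (ns k))) sequentially"
    using assms(8) unfolding filterlim_at_top by blast
  \<comment> \<open>From \<open>k0\<close> on, all blocks are nonempty and the information is invertible; earlier \<open>k\<close> do not affect the limit.\<close>
  then obtain k0 where large: "\<forall>k\<ge>k0. 2 \<le> Min (set (ns k))" unfolding eventually_sequentially by blast
  have k0: "1 < Min (set (ns k))" if "k0 \<le> k" for k
    using large[rule_format, OF that] by linarith
  \<comment> \<open>any admissible parameter serves to select the common law\<close>
  define \<psi>0 where "\<psi>0 = ones r"
  have \<psi>0: "\<psi>0 \<in> param_set r" using r0 by (auto simp: \<psi>0_def param_set_def ones_def)
  have law: "\<exists>\<nu>. real_distribution \<nu> \<and> (\<forall>t. char \<nu> t = sum_sq_char r (?card k) t) \<and>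
      (\<forall>c. measure (P k \<psi>) {\<omega> \<in> space (P k \<psi>). restr_score_stat (ns k) (V k) \<psi> (Y k \<omega>) \<le> c} = cdf \<nu> c)"
    if k: "k0 \<le> k" and \<psi>: "\<psi> \<in> param_set r" for k \<psi>
  proof -
    have ne: "effect_class (ns k) l \<noteq> {}" if "l \<le> length (ns k)" for l
      using ge[OF k0[OF k], of l] that len(1)[of k] by auto
    show ?thesis
    proof (rule restr_score_stat_law[of "ns k", unfolded len(1)])
      show "crossed_model (ns k) (\<beta> k) \<psi> (P k \<psi>) (Y k)" by (rule assms(7)[OF \<psi>])
    qed (use assms(5,6) \<psi> ne in auto)
  qed
  have "\<forall>k. \<exists>\<nu>. real_distribution \<nu> \<and> (\<forall>t. char \<nu> t = sum_sq_char r (?card (k + k0)) t)"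
    using law[OF le_add2 \<psi>0] by blast
  from choice[OF this] obtain \<nu> where
    "\<forall>k. real_distribution (\<nu> k) \<and> (\<forall>t. char (\<nu> k) t = sum_sq_char r (?card (k + k0)) t)" ..
  then have \<nu>: "real_distribution (\<nu> k)" "char (\<nu> k) t = sum_sq_char r (?card (k + k0)) t" for k t
    by simp_all
  have cover: "measure (P k' \<psi>) {\<omega> \<in> space (P k' \<psi>). \<psi> \<in> restr_conf_region (ns k') (V k') \<alpha> (Y k' \<omega>)} = cdf (\<nu> k) q"
    if k': "k' = k + k0" and \<psi>: "\<psi> \<in> param_set r" for k k' \<psi>
  proof -
    obtain \<nu>' where \<nu>': "real_distribution \<nu>'" "\<And>t. char \<nu>' t = sum_sq_char r (?card k') t"
      "\<And>c. measure (P k' \<psi>) {\<omega> \<in> space (P k' \<psi>). restr_score_stat (ns k') (V k') \<psi> (Y k' \<omega>) \<le> c} = cdf \<nu>' c"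
      using law[OF _ \<psi>, of k'] k' by auto
    \<comment> \<open>The law at \<open>\<psi>\<close> is the one already obtained at \<open>\<psi>0\<close>, since both have the same characteristic function.\<close>
    have "\<nu>' = \<nu> k" using \<nu>' \<nu> k' by (intro Levy_uniqueness) auto
    then show ?thesis using \<nu>'(3)[of q] \<psi> unfolding restr_conf_region_def len(1) q_def by simp
  qed
  have "(\<lambda>k. cdf (\<nu> k) q) \<longlonglongrightarrow> cdf (chi_square r) q"
  proof (rule cdf_tendsto_chi_square[OF r0 _ \<nu>])
    show "filterlim (\<lambda>k. ?card (k + k0) l) at_top sequentially" if "l < r" for l
      by (rule filterlim_compose[OF card_lim[OF that] filterlim_add_const_nat_at_top])
  qed
  moreover have "cdf (chi_square r) q = 1 - \<alpha>"
    unfolding q_def using assms(1,2)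
    by (intro cdf_quantile real_distribution_chi_square isCont_cdf_chi_square r0) auto
  ultimately have lim: "(\<lambda>k. \<bar>cdf (\<nu> k) q - (1 - \<alpha>)\<bar>) \<longlonglongrightarrow> 0"
    by (intro tendsto_rabs_zero LIM_zero) simp
  define f where "f k = (SUP \<psi>\<in>param_set r. \<bar>measure (P k \<psi>) {\<omega> \<in> space (P k \<psi>).
      \<psi> \<in> restr_conf_region (ns k) (V k) \<alpha> (Y k \<omega>)} - (1 - \<alpha>)\<bar>)" for k
  have "f (k + k0) = \<bar>cdf (\<nu> k) q - (1 - \<alpha>)\<bar>" for k
  proof -
    have "f (k + k0) = (SUP \<psi>\<in>param_set r. \<bar>cdf (\<nu> k) q - (1 - \<alpha>)\<bar>)"
      unfolding f_def by (intro SUP_cong refl) (simp only: cover[OF refl])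
    then show ?thesis using \<psi>0 by (auto intro!: cSUP_const)
  qed
  with lim have "(\<lambda>k. f (k + k0)) \<longlonglongrightarrow> 0" by presburger
  then have "f \<longlonglongrightarrow> 0" by (rule LIMSEQ_offset)
  then show ?thesis unfolding f_def .
qed

end
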